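(* Let $M$ be a Hausdorff manifold and let $A$ be a Hopf algebroid over $\mathcal{C}^{\infty}_{c}(M)$. Then the manifold $\mathcal{G}_{sp}(A)=\coprod_{y\in M}\mathcal{G}_{sp}(A)_{y}$, with target $t(a_{y})=y$, source $s(a_{y})=\tau_{W,a}^{-1}(y)$ (where $a\in G^{S}_{w}(A)$ is normalized on an open neighbourhood $W$ of $y$), multiplication $b_{z}a_{y}=(ba)_{z}$ whenever $s(b_{z})=y$, units $1_{y}=f_{y}$ (where $f\in\mathcal{C}^{\infty}_{c}(M)\subset A$ equals $1$ near $y$) and inverses $(a_{y})^{-1}=(S(a))_{s(a_{y})}$, is an étale Lie groupoid over $M$. If $B$ is another Hopf algebroid over $\mathcal{C}^{\infty}_{c}(M)$ and $\alpha:A\to B$ is a homomorphism of Hopf algebroids over $\mathcal{C}^{\infty}_{c}(M)$, then the morphism of spectral sheaves $\mathcal{E}_{sp}(\alpha):\mathcal{E}_{sp}(A)\to\mathcal{E}_{sp}(B)$ restricts to a morphism of étale Lie groupoids $\mathcal{G}_{sp}(\alpha):\mathcal{G}_{sp}(A)\to\mathcal{G}_{sp}(B)$ over $M$, and this gives a functor $$\mathcal{G}_{sp}:\mathrm{HoAlgd}(\mathcal{C}^{\infty}_{c}(M))\to\mathrm{EtGrpd}(M).$$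
   Context: All manifolds and maps are smooth; $\mathbb{F}\in\{\mathbb{R},\mathbb{C}\}$ is fixed; $M$ is a Hausdorff manifold; $\mathcal{C}^{\infty}_{c}(M)$ is the ring of $\mathbb{F}$-valued smooth functions with compact support; "$f_{x}=1$" means that the germ of $f$ at $x$ is that of the constant $1$. Hopf algebroids. Algebras are associative $\mathbb{F}$-algebras, possibly without identity. Let $R$ be a commutative algebra with local identities (for all $r_{1},\dots,r_{k}\in R$ there is $r\in R$ with $rr_{i}=r_{i}$ for all $i$). A Hopf algebroid over $R$ is an algebra $A$ containing $R$ as a subalgebra, with local identities in $R$ (for all $a_{1},\dots,a_{k}\in A$ there is $r\in R$ with $ra_{i}=a_{i}r=a_{i}$ for all $i$), with $\mathbb{F}$-linear maps $\Delta:A\to A\otimes_{R}^{ll}A$, $\epsilon:A\to R$, $S:A\to A$ such that: (i) $\Delta,\epsilon$ are left $R$-linear and $(\mathrm{id}\otimes\epsilon)\circ\Delta=\mathrm{id}=(\epsilon\otimes\mathrm{id})\circ\Delta$; (ii) $\epsilon|_{R}=\mathrm{id}$, $\Delta|_{R}$ is the canonical embedding $R\cong R\otimes_{R}R\subset A\otimes_{R}^{ll}A$, and the two right $R$-actions on $A\otimes^{ll}_{R}A$ coincide on $\Delta A$; (iii) $\Delta(ab)=\Delta(a)\Delta(b)$; (iv) $S|_{R}=\mathrm{id}$, $S\circ S=\mathrm{id}$; (v) $S(ab)=S(b)S(a)$; (vi) $\mu\circ(S\otimes\mathrm{id})\circ\Delta=\epsilon\circ S$ with $\mu:A\otimes_{R}^{rl}A\to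 A$ the multiplication. Here $\otimes^{ll}_{R}$ is the tensor product with respect to the left $R$-actions on both factors, $\otimes^{rl}_{R}$ that with respect to the right action on the first and left action on the second factor. A homomorphism of Hopf algebroids over $R$ is an algebra homomorphism $\alpha$ with $\alpha|_{R}=\mathrm{id}$, $\epsilon\circ\alpha=\epsilon$, $(\alpha\otimes\alpha)\circ\Delta=\Delta\circ\alpha$, $S\circ\alpha=\alpha\circ S$. The category is $\mathrm{HoAlgd}(R)$. An element $a\in A$ is weakly grouplike if $\Delta(a)=a\otimes a'$ for some $a'\in A$, and $S$-invariant weakly grouplike if moreover $a'$ can be chosen with $\Delta(S(a))=S(a')\otimes S(a)$; the set of the latter is $G^{S}_{w}(A)$. Étale groupoids. An étale Lie groupoid over $M$ is a (not necessarily Hausdorff, no second countability required) manifold $G$ with a groupoid structure with object manifold $M$ all of whose structure maps (source $s$, target $t$, multiplication, inverse, unit) are local diffeomorphisms; $M\subset G$ via units. $\mathrm{EtGrpd}(M)$ has as morphisms the smooth groupoid maps $\phi$ with $\phi|_{M}=\mathrm{id}$. Spectral sheaf and arrows. Let $A$ be a Hopf algebroid over $R=\mathcal{C}^{\infty}_{c}(M)$. For $y\in M$ put $N_{y}(A)=\{a\in A: fa=0$ for some $f\in\mathcal{C}^{\infty}_{c}(M)$ with $f_{y}=1\}$, $A_{y}=A/N_{y}(A)$, $a_{y}=a+N_{y}(A)$. Then $A_{y}$ is, with the induced maps $\Delta_{y},\epsilon_{y}$, a coalgebra over the ring $R_{y}=(\mathcal{C}^{\infty}_{M})_{y}$ of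 germs; $G(A_{y})=\{\zeta\in A_{y}:\Delta_{y}(\zeta)=\zeta\otimes\zeta,\ \epsilon_{y}(\zeta)=1\}$. An element $a$ is normalized at $y$ if $\epsilon(a)_{y}=1$, and normalized on $W\subset M$ if normalized at each point of $W$. The spectral sheaf $\mathcal{E}_{sp}(A)\to M$ has stalks $\mathcal{E}_{sp}(A)_{y}=G(A_{y})$, and topology (and smooth structure making the projection a local diffeomorphism) with basis the sets $a_{W}=\{a_{y}:y\in W\}$, $W\subset M$ open, $a$ weakly grouplike and normalized on $W$. For a homomorphism $\alpha$, $\mathcal{E}_{sp}(\alpha)(a_{y})=\alpha(a)_{y}$. $\mathcal{G}_{sp}(A)\subset\mathcal{E}_{sp}(A)$ is the open subset with $\mathcal{G}_{sp}(A)_{y}=\{a_{y}:a\in G^{S}_{w}(A),\ \epsilon(a)_{y}=1\}$. For $a\in G^{S}_{w}(A)$ normalized on an open $W\subset M$ there are a unique open $V\subset M$ and diffeomorphism $\tau_{W,a}:V\to W$ with $\epsilon(S(fa))=f\circ\tau_{W,a}$ for $f\in\mathcal{C}^{\infty}_{c}(W)$ and with $f\mapsto\epsilon(S(fa))$ mapping $\mathcal{C}^{\infty}_{c}(W)$ onto $\mathcal{C}^{\infty}_{c}(V)$. In the formulas of the claim, elements of $\mathcal{G}_{sp}(A)_{y}$ are represented by elements $a\in G^{S}_{w}(A)$ normalized at $y$; the formulas do not depend on the chosen representatives. *)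

theory Defs
  imports
    "HOL-Analysis.Analysis"
    "HOL-Library.Multiset"
    "HOL-Library.Set_Algebras"
begin

section \<open>The ground field\<close>

text \<open>
  The ground field is \<open>\<real>\<close> or \<open>\<complex>\<close>: as a field, a type of this class consists of the real
  numbers alone or is generated over them by a square root of \<open>-1\<close>.
\<close>

class real_or_complex = real_normed_field +
  assumes real_or_complex:
    "(\<forall>x. \<exists>r. x = r *\<^sub>R 1) \<or> (\<exists>i. i * i = - 1 \<and> (\<forall>x. \<exists>r s. x = r *\<^sub>R 1 + s *\<^sub>R i))"

instance real :: real_or_complex
  by standard auto

instance complex :: real_or_complex
proof
  have "\<forall>x. \<exists>r s. x = r *\<^sub>R 1 + s *\<^sub>R \<i>"
    by (metis complex_eq mult.commute scaleR_conv_of_real mult.right_neutral)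
  then show "(\<forall>x::complex. \<exists>r. x = r *\<^sub>R 1) \<or>
      (\<exists>i::complex. i * i = - 1 \<and> (\<forall>x. \<exists>r s. x = r *\<^sub>R 1 + s *\<^sub>R i))"
    by (intro disjI2 exI [of _ \<i>]) simp
qed

section \<open>Smooth manifolds and smooth maps\<close>

text \<open>
  \<^const>\<open>Euclidean_space\<close> \<open>n\<close> consists of the real sequences vanishing from index \<open>n\<close> on, so that the
  dimension is a natural number (possibly \<open>0\<close>). In the following, \<open>U\<close> is an open subset of it.
  A function is of class \<open>C\<^sup>k\<^sup>+\<^sup>1\<close> if it is continuous and has partial derivatives of class \<open>C\<^sup>k\<close>.
\<close>

primrec Ck_on :: "nat \<Rightarrow> nat \<Rightarrow> (nat \<Rightarrow> real) set \<Rightarrow> ((nat \<Rightarrow> real) \<Rightarrow> 'v::real_normed_vector) \<Rightarrow> bool"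
  where
    "Ck_on n 0 U f \<longleftrightarrow> continuous_map (subtopology (Euclidean_space n) U) euclidean f"
  | "Ck_on n (Suc k) U f \<longleftrightarrow>
       continuous_map (subtopology (Euclidean_space n) U) euclidean f \<and>
       (\<forall>i<n. \<exists>g. (\<forall>x\<in>U. ((\<lambda>t. f (x(i := t))) has_vector_derivative g x) (at (x i))) \<and> Ck_on n k U g)"

definition smooth_on :: "nat \<Rightarrow> (nat \<Rightarrow> real) set \<Rightarrow> ((nat \<Rightarrow> real) \<Rightarrow> 'v::real_normed_vector) \<Rightarrow> bool"
  where "smooth_on n U f \<longleftrightarrow> (\<forall>k. Ck_on n k U f)"

definition smooth_between ::
    "nat \<Rightarrow> nat \<Rightarrow> (nat \<Rightarrow> real) set \<Rightarrow> ((nat \<Rightarrow> real) \<Rightarrow> nat \<Rightarrow> real) \<Rightarrow> bool"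
  where "smooth_between n m U F \<longleftrightarrow> (\<forall>j<m. smooth_on n U (\<lambda>x. F x j))"

text \<open>
  A manifold is given by a topological space, a dimension and a smooth atlas, which need not be
  maximal. A chart is a pair of its domain and the coordinate map, whose values outside the domain
  are irrelevant. Neither the Hausdorff property nor second countability is part of the definition.
\<close>

record 'p manifold =
  mtop :: "'p topology"
  mdim :: nat
  atlas :: "('p set \<times> ('p \<Rightarrow> nat \<Rightarrow> real)) set"

abbreviation points :: "'p manifold \<Rightarrow> 'p set"
  where "points X \<equiv> topspace (mtop X)"

definition smooth_manifold :: "'p manifold \<Rightarrow> bool"
  where "smooth_manifold X \<longleftrightarrow>
    (\<forall>(U, \<phi>) \<in> atlas X.
       openin (mtop X) U \<and> openin (Euclidean_space (mdim X)) (\<phi> ` U) \<and>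
       homeomorphic_map (subtopology (mtop X) U)
         (subtopology (Euclidean_space (mdim X)) (\<phi> ` U)) \<phi>) \<and>
    (\<Union>(U, \<phi>) \<in> atlas X. U) = points X \<and>
    (\<forall>(U, \<phi>) \<in> atlas X. \<forall>(V, \<psi>) \<in> atlas X.
       smooth_between (mdim X) (mdim X) (\<phi> ` (U \<inter> V)) (\<psi> \<circ> inv_into U \<phi>))"

definition smooth_map :: "'p manifold \<Rightarrow> 'q manifold \<Rightarrow> ('p \<Rightarrow> 'q) \<Rightarrow> bool"
  where "smooth_map X Y f \<longleftrightarrow>
    continuous_map (mtop X) (mtop Y) f \<and>
    (\<forall>(U, \<phi>) \<in> atlas X. \<forall>(V, \<psi>) \<in> atlas Y.
       smooth_between (mdim X) (mdim Y) (\<phi> ` (U \<inter> f -` V)) (\<psi> \<circ> f \<circ> inv_into U \<phi>))"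

definition diffeomorphism :: "'p manifold \<Rightarrow> 'q manifold \<Rightarrow> ('p \<Rightarrow> 'q) \<Rightarrow> bool"
  where "diffeomorphism X Y f \<longleftrightarrow>
    bij_betw f (points X) (points Y) \<and> smooth_map X Y f \<and> smooth_map Y X (inv_into (points X) f)"

definition open_submanifold :: "'p manifold \<Rightarrow> 'p set \<Rightarrow> 'p manifold"
  where "open_submanifold X V =
    \<lparr>mtop = subtopology (mtop X) V, mdim = mdim X, atlas = (\<lambda>(U, \<phi>). (U \<inter> V, \<phi>)) ` atlas X\<rparr>"

definition local_diffeomorphism :: "'p manifold \<Rightarrow> 'q manifold \<Rightarrow> ('p \<Rightarrow> 'q) \<Rightarrow> bool"
  where "local_diffeomorphism X Y f \<longleftrightarrow>
    (\<forall>x \<in> points X. \<exists>U. openin (mtop X) U \<and> x \<in> U \<and> openin (mtop Y) (f ` U) \<and>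
       diffeomorphism (open_submanifold X U) (open_submanifold Y (f ` U)) f)"

definition smooth_function :: "'p manifold \<Rightarrow> ('p \<Rightarrow> 'v::real_normed_vector) \<Rightarrow> bool"
  where "smooth_function X f \<longleftrightarrow>
    (\<forall>(U, \<phi>) \<in> atlas X. smooth_on (mdim X) (\<phi> ` U) (f \<circ> inv_into U \<phi>))"

text \<open>
  Functions on \<open>X\<close> are extended by \<open>0\<close> to the whole underlying type. For open \<open>W\<close> in a Hausdorff
  manifold \<open>X\<close>, compactly supported functions on \<open>W\<close> are identified with those on \<open>X\<close> whose support
  lies in \<open>W\<close>.
\<close>

definition support :: "'p manifold \<Rightarrow> ('p \<Rightarrow> 'v::real_normed_vector) \<Rightarrow> 'p set"
  where "support X f = mtop X closure_of {x \<in> points X. f x \<noteq> 0}"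

definition Cc_infinity :: "'p manifold \<Rightarrow> ('p \<Rightarrow> 'v::real_normed_vector) set"
  where "Cc_infinity X =
    {f. smooth_function X f \<and> compactin (mtop X) (support X f) \<and> (\<forall>x. x \<notin> points X \<longrightarrow> f x = 0)}"

definition Cc_infinity_on :: "'p manifold \<Rightarrow> 'p set \<Rightarrow> ('p \<Rightarrow> 'v::real_normed_vector) set"
  where "Cc_infinity_on X W = {f \<in> Cc_infinity X. support X f \<subseteq> W}"

definition same_germ :: "'p manifold \<Rightarrow> 'p \<Rightarrow> ('p \<Rightarrow> 'v) \<Rightarrow> ('p \<Rightarrow> 'v) \<Rightarrow> bool"
  where "same_germ X y f g \<longleftrightarrow> (\<exists>U. openin (mtop X) U \<and> y \<in> U \<and> (\<forall>x\<in>U. f x = g x))"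

text \<open>
  On a Hausdorff manifold every germ of a smooth function is represented by compactly supported
  functions, so a germ at \<open>y\<close> is identified with the set of these representatives.
\<close>

definition germ :: "'p manifold \<Rightarrow> 'p \<Rightarrow> ('p \<Rightarrow> 'v::real_normed_vector) \<Rightarrow> ('p \<Rightarrow> 'v) set"
  where "germ X y f = {g \<in> Cc_infinity X. same_germ X y g f}"

section \<open>Etale Lie groupoids\<close>

text \<open>The product \<open>gmult G g h\<close> is meaningful when the source of \<open>g\<close> is the target of \<open>h\<close>.\<close>

record ('m, 'g) groupoid =
  arrows :: "'g manifold"
  gsrc :: "'g \<Rightarrow> 'm"
  gtgt :: "'g \<Rightarrow> 'm"
  gmult :: "'g \<Rightarrow> 'g \<Rightarrow> 'g"
  gunit :: "'m \<Rightarrow> 'g"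
  ginv :: "'g \<Rightarrow> 'g"

definition composable :: "('m, 'g) groupoid \<Rightarrow> ('g \<times> 'g) set"
  where "composable G =
    {(g, h). g \<in> points (arrows G) \<and> h \<in> points (arrows G) \<and> gsrc G g = gtgt G h}"

text \<open>
  When the source map is a local diffeomorphism, so is the second projection from the fibred product
  of composable pairs, and the smooth structure of the fibred product is the one pulled back
  along it: the second projection is injective on the pairs with first component in \<open>V\<close> if the
  source map is injective on \<open>V\<close>.
\<close>

definition composable_pairs :: "('m, 'g) groupoid \<Rightarrow> ('g \<times> 'g) manifold"
  where "composable_pairs G =
    \<lparr>mtop = subtopology (prod_topology (mtop (arrows G)) (mtop (arrows G))) (composable G),
     mdim = mdim (arrows G),
     atlas = {(composable G \<inter> (V \<times> U), \<phi> \<circ> snd) |V U \<phi>.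
       openin (mtop (arrows G)) V \<and> inj_on (gsrc G) V \<and> (U, \<phi>) \<in> atlas (arrows G)}\<rparr>"

locale etale_groupoid =
  fixes M :: "'m manifold" and G :: "('m, 'g) groupoid"
  assumes base_manifold: "smooth_manifold M"
    and arrows_manifold: "smooth_manifold (arrows G)"
    and src_closed: "g \<in> points (arrows G) \<Longrightarrow> gsrc G g \<in> points M"
    and tgt_closed: "g \<in> points (arrows G) \<Longrightarrow> gtgt G g \<in> points M"
    and mult_closed: "(g, h) \<in> composable G \<Longrightarrow> gmult G g h \<in> points (arrows G)"
    and unit_closed: "x \<in> points M \<Longrightarrow> gunit G x \<in> points (arrows G)"
    and inv_closed: "g \<in> points (arrows G) \<Longrightarrow> ginv G g \<in> points (arrows G)"
    and src_mult: "(g, h) \<in> composable G \<Longrightarrow> gsrc G (gmult G g h) = gsrc G h"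
    and tgt_mult: "(g, h) \<in> composable G \<Longrightarrow> gtgt G (gmult G g h) = gtgt G g"
    and mult_assoc: "(g, h) \<in> composable G \<Longrightarrow> (h, k) \<in> composable G \<Longrightarrow>
      gmult G (gmult G g h) k = gmult G g (gmult G h k)"
    and src_unit: "x \<in> points M \<Longrightarrow> gsrc G (gunit G x) = x"
    and tgt_unit: "x \<in> points M \<Longrightarrow> gtgt G (gunit G x) = x"
    and unit_right: "g \<in> points (arrows G) \<Longrightarrow> gmult G g (gunit G (gsrc G g)) = g"
    and unit_left: "g \<in> points (arrows G) \<Longrightarrow> gmult G (gunit G (gtgt G g)) g = g"
    and src_inv: "g \<in> points (arrows G) \<Longrightarrow> gsrc G (ginv G g) = gtgt G g"
    and tgt_inv: "g \<in> points (arrows G) \<Longrightarrow> gtgt G (ginv G g) = gsrc G g"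
    and inv_left: "g \<in> points (arrows G) \<Longrightarrow> gmult G (ginv G g) g = gunit G (gsrc G g)"
    and inv_right: "g \<in> points (arrows G) \<Longrightarrow> gmult G g (ginv G g) = gunit G (gtgt G g)"
    and src_etale: "local_diffeomorphism (arrows G) M (gsrc G)"
    and tgt_etale: "local_diffeomorphism (arrows G) M (gtgt G)"
    and mult_etale: "local_diffeomorphism (composable_pairs G) (arrows G) (\<lambda>(g, h). gmult G g h)"
    and unit_etale: "local_diffeomorphism M (arrows G) (gunit G)"
    and inv_etale: "local_diffeomorphism (arrows G) (arrows G) (ginv G)"

definition etale_groupoid_morphism ::
    "'m manifold \<Rightarrow> ('m, 'g) groupoid \<Rightarrow> ('m, 'h) groupoid \<Rightarrow> ('g \<Rightarrow> 'h) \<Rightarrow> bool"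
  where "etale_groupoid_morphism M G H \<theta> \<longleftrightarrow>
    smooth_map (arrows G) (arrows H) \<theta> \<and>
    (\<forall>g \<in> points (arrows G). gsrc H (\<theta> g) = gsrc G g \<and> gtgt H (\<theta> g) = gtgt G g) \<and>
    (\<forall>(g, h) \<in> composable G. \<theta> (gmult G g h) = gmult H (\<theta> g) (\<theta> h)) \<and>
    (\<forall>x \<in> points M. \<theta> (gunit G x) = gunit H x)"

section \<open>Tensor products\<close>

text \<open>
  A multiset of pairs stands for the formal sum of the corresponding elementary tensors. The tensor
  product of the abelian group with carrier \<open>X\<close>, addition \<open>add\<close> and zero \<open>z\<close> with itself is the
  quotient of the formal sums by the least congruence which makes the tensor sign biadditive and
  identifies the elementary tensors related by \<open>bal\<close>. The commutative monoid of classes is a group,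
  because \<open>x \<otimes> y + (- x) \<otimes> y = z \<otimes> y = 0\<close>.
\<close>

inductive tensor_cong ::
    "'x set \<Rightarrow> ('x \<Rightarrow> 'x \<Rightarrow> 'x) \<Rightarrow> 'x \<Rightarrow> (('x \<times> 'x) \<times> ('x \<times> 'x)) set \<Rightarrow>
     ('x \<times> 'x) multiset \<Rightarrow> ('x \<times> 'x) multiset \<Rightarrow> bool"
  for X add z bal
  where
    refl: "set_mset p \<subseteq> X \<times> X \<Longrightarrow> tensor_cong X add z bal p p"
  | sym: "tensor_cong X add z bal p q \<Longrightarrow> tensor_cong X add z bal q p"
  | trans: "tensor_cong X add z bal p q \<Longrightarrow> tensor_cong X add z bal q r \<Longrightarrow>
      tensor_cong X add z bal p r"
  | sum: "tensor_cong X add z bal p q \<Longrightarrow> tensor_cong X add z bal p' q' \<Longrightarrow>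
      tensor_cong X add z bal (p + p') (q + q')"
  | add_left: "x \<in> X \<Longrightarrow> x' \<in> X \<Longrightarrow> y \<in> X \<Longrightarrow>
      tensor_cong X add z bal {#(add x x', y)#} {#(x, y), (x', y)#}"
  | add_right: "x \<in> X \<Longrightarrow> y \<in> X \<Longrightarrow> y' \<in> X \<Longrightarrow>
      tensor_cong X add z bal {#(x, add y y')#} {#(x, y), (x, y')#}"
  | zero_left: "y \<in> X \<Longrightarrow> tensor_cong X add z bal {#(z, y)#} {#}"
  | zero_right: "x \<in> X \<Longrightarrow> tensor_cong X add z bal {#(x, z)#} {#}"
  | balanced: "(u, v) \<in> bal \<Longrightarrow> tensor_cong X add z bal {#u#} {#v#}"

section \<open>Hopf algebroids over the compactly supported smooth functions\<close>

text \<open>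
  The total algebra is a type of class \<^class>\<open>ring\<close> (no identity is required) with a scalar
  multiplication; \<open>incl\<close> embeds the base ring \<^term>\<open>Cc_infinity M\<close>, and its values at
  other functions are irrelevant. The values of \<open>comult\<close> are tensors, that is, classes of formal sums.
\<close>

record ('k, 'm, 'a) hopf_structure =
  scale :: "'k \<Rightarrow> 'a \<Rightarrow> 'a"
  incl :: "('m \<Rightarrow> 'k) \<Rightarrow> 'a"
  comult :: "'a \<Rightarrow> ('a \<times> 'a) multiset set"
  counit :: "'a \<Rightarrow> 'm \<Rightarrow> 'k"
  antipode :: "'a \<Rightarrow> 'a"

text \<open>
  \<open>tensor M A p\<close> is the class of the formal sum \<open>p\<close> in the tensor product of \<open>A\<close> with itself with
  respect to the two left actions of the base ring. Compatibility with the scalars of the ground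
  field need not be imposed on it: if \<open>r\<close> acts as identity on \<open>a\<close> and \<open>b\<close>, then
  \<open>ca \<otimes> b = (cr)a \<otimes> b = a \<otimes> (cr)b = a \<otimes> cb\<close>.
\<close>

definition tensor ::
    "'m manifold \<Rightarrow> ('k::real_or_complex, 'm, 'a::ring) hopf_structure \<Rightarrow>
     ('a \<times> 'a) multiset \<Rightarrow> ('a \<times> 'a) multiset set"
  where "tensor M A p =
    {q. tensor_cong UNIV (+) 0
          {((incl A f * a, b), (a, incl A f * b)) |f a b. f \<in> Cc_infinity M} p q}"

text \<open>
  An identity involving \<open>\<Delta>(a)\<close> is stated for every representation \<open>\<Delta>(a) = \<Sum> x\<^sub>i \<otimes> y\<^sub>i\<close>, encoded by
  \<^term>\<open>comult A a = tensor M A p\<close>. All operations applied to such representations are compatible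
  with the defining relations of the tensor product (for the product in \<open>comult_mult\<close> this uses
  \<open>comult_right_actions\<close>; for \<open>antipode_left\<close> one passes from left to right actions on the
  first factor by the antipode).
\<close>

locale hopf_algebroid =
  fixes M :: "'m manifold" and A :: "('k::real_or_complex, 'm, 'a::ring) hopf_structure"
  assumes vector_space: "vector_space (scale A)"
    and scale_mult_left: "scale A c a * b = scale A c (a * b)"
    and scale_mult_right: "a * scale A c b = scale A c (a * b)"
    \<comment> \<open>the base ring is a subalgebra, containing local identities of the total algebra\<close>
    and incl_inj: "inj_on (incl A) (Cc_infinity M)"
    and incl_add: "f \<in> Cc_infinity M \<Longrightarrow> g \<in> Cc_infinity M \<Longrightarrow>
      incl A (\<lambda>x. f x + g x) = incl A f + incl A g"
    and incl_scale: "f \<in> Cc_infinity M \<Longrightarrow> incl A (\<lambda>x. c * f x) = scale A c (incl A f)"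
    and incl_mult: "f \<in> Cc_infinity M \<Longrightarrow> g \<in> Cc_infinity M \<Longrightarrow>
      incl A (\<lambda>x. f x * g x) = incl A f * incl A g"
    and local_identities: "finite F \<Longrightarrow>
      \<exists>f \<in> Cc_infinity M. \<forall>a\<in>F. incl A f * a = a \<and> a * incl A f = a"
    \<comment> \<open>the structure maps are linear over the ground field\<close>
    and comult_tensor: "\<exists>p. comult A a = tensor M A p"
    and comult_add: "comult A a = tensor M A p \<Longrightarrow> comult A b = tensor M A q \<Longrightarrow>
      comult A (a + b) = tensor M A (p + q)"
    and comult_scale: "comult A a = tensor M A p \<Longrightarrow>
      comult A (scale A c a) = tensor M A {#(scale A c x, y). (x, y) \<in># p#}"
    and counit_closed: "counit A a \<in> Cc_infinity M"
    and counit_add: "counit A (a + b) = (\<lambda>x. counit A a x + counit A b x)"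
    and counit_scale: "counit A (scale A c a) = (\<lambda>x. c * counit A a x)"
    and antipode_add: "antipode A (a + b) = antipode A a + antipode A b"
    and antipode_scale: "antipode A (scale A c a) = scale A c (antipode A a)"
    \<comment> \<open>comultiplication and counit are left linear over the base ring and form a coalgebra\<close>
    and comult_left: "f \<in> Cc_infinity M \<Longrightarrow> comult A a = tensor M A p \<Longrightarrow>
      comult A (incl A f * a) = tensor M A {#(incl A f * x, y). (x, y) \<in># p#}"
    and counit_left: "f \<in> Cc_infinity M \<Longrightarrow> counit A (incl A f * a) = (\<lambda>x. f x * counit A a x)"
    and counit_law_right: "comult A a = tensor M A p \<Longrightarrow>
      (\<Sum>(x, y)\<in>#p. incl A (counit A y) * x) = a"
    and counit_law_left: "comult A a = tensor M A p \<Longrightarrow>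
      (\<Sum>(x, y)\<in>#p. incl A (counit A x) * y) = a"
    \<comment> \<open>on the base ring, comultiplication is inverse to \<open>r \<otimes> r' \<mapsto> r r'\<close>\<close>
    and counit_incl: "f \<in> Cc_infinity M \<Longrightarrow> counit A (incl A f) = f"
    and comult_incl: "f \<in> Cc_infinity M \<Longrightarrow> g \<in> Cc_infinity M \<Longrightarrow>
      comult A (incl A f * incl A g) = tensor M A {#(incl A f, incl A g)#}"
    and comult_right_actions: "f \<in> Cc_infinity M \<Longrightarrow> comult A a = tensor M A p \<Longrightarrow>
      tensor M A {#(x * incl A f, y). (x, y) \<in># p#} = tensor M A {#(x, y * incl A f). (x, y) \<in># p#}"
    \<comment> \<open>multiplicativity of the comultiplication\<close>
    and comult_mult: "comult A a = tensor M A p \<Longrightarrow> comult A b = tensor M A q \<Longrightarrow>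
      comult A (a * b) = tensor M A (\<Sum>(x, y)\<in>#p. {#(x * x', y * y'). (x', y') \<in># q#})"
    \<comment> \<open>antipode\<close>
    and antipode_incl: "f \<in> Cc_infinity M \<Longrightarrow> antipode A (incl A f) = incl A f"
    and antipode_antipode: "antipode A (antipode A a) = a"
    and antipode_mult: "antipode A (a * b) = antipode A b * antipode A a"
    and antipode_left: "comult A a = tensor M A p \<Longrightarrow>
      (\<Sum>(x, y)\<in>#p. antipode A x * y) = incl A (counit A (antipode A a))"

locale hopf_algebroid_hom =
  source: hopf_algebroid M A + target: hopf_algebroid M B
  for M :: "'m manifold"
    and A :: "('k::real_or_complex, 'm, 'a::ring) hopf_structure"
    and B :: "('k, 'm, 'b::ring) hopf_structure" +
  fixes \<alpha> :: "'a \<Rightarrow> 'b"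
  assumes hom_add: "\<alpha> (a + b) = \<alpha> a + \<alpha> b"
    and hom_scale: "\<alpha> (scale A c a) = scale B c (\<alpha> a)"
    and hom_mult: "\<alpha> (a * b) = \<alpha> a * \<alpha> b"
    and hom_incl: "f \<in> Cc_infinity M \<Longrightarrow> \<alpha> (incl A f) = incl B f"
    and hom_counit: "counit B (\<alpha> a) = counit A a"
    and hom_comult: "comult A a = tensor M A p \<Longrightarrow>
      comult B (\<alpha> a) = tensor M B {#(\<alpha> x, \<alpha> y). (x, y) \<in># p#}"
    and hom_antipode: "antipode B (\<alpha> a) = \<alpha> (antipode A a)"

definition weakly_grouplike ::
    "'m manifold \<Rightarrow> ('k::real_or_complex, 'm, 'a::ring) hopf_structure \<Rightarrow> 'a \<Rightarrow> bool"
  where "weakly_grouplike M A a \<longleftrightarrow> (\<exists>a'. comult A a = tensor M A {#(a, a')#})"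

definition S_invariant_weakly_grouplike ::
    "'m manifold \<Rightarrow> ('k::real_or_complex, 'm, 'a::ring) hopf_structure \<Rightarrow> 'a set"
  where "S_invariant_weakly_grouplike M A =
    {a. \<exists>a'. comult A a = tensor M A {#(a, a')#} \<and>
             comult A (antipode A a) = tensor M A {#(antipode A a', antipode A a)#}}"

definition normalized_at ::
    "'m manifold \<Rightarrow> ('k::real_or_complex, 'm, 'a::ring) hopf_structure \<Rightarrow> 'a \<Rightarrow> 'm \<Rightarrow> bool"
  where "normalized_at M A a y \<longleftrightarrow> same_germ M y (counit A a) (\<lambda>_. 1)"

section \<open>The spectral sheaf\<close>

definition null_at ::
    "'m manifold \<Rightarrow> ('k::real_or_complex, 'm, 'a::ring) hopf_structure \<Rightarrow> 'm \<Rightarrow> 'a set"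
  where "null_at M A y = {a. \<exists>f \<in> Cc_infinity M. same_germ M y f (\<lambda>_. 1) \<and> incl A f * a = 0}"

definition stalk_class ::
    "'m manifold \<Rightarrow> ('k::real_or_complex, 'm, 'a::ring) hopf_structure \<Rightarrow> 'm \<Rightarrow> 'a \<Rightarrow> 'a set"
  where "stalk_class M A y a = a +o null_at M A y"

text \<open>
  The stalk of \<open>A\<close> at \<open>y\<close> is the set of all classes \<^term>\<open>stalk_class M A y a\<close>. Since every germ in
  the local ring at \<open>y\<close> comes from a compactly supported function \<open>f\<close> and acts by
  \<open>f\<^sub>y a\<^sub>y = (f a)\<^sub>y\<close>, tensors over the local ring are balanced with respect to such \<open>f\<close>.
\<close>

definition stalk_tensor ::
    "'m manifold \<Rightarrow> ('k::real_or_complex, 'm, 'a::ring) hopf_structure \<Rightarrow> 'm \<Rightarrow>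
     ('a set \<times> 'a set) multiset \<Rightarrow> ('a set \<times> 'a set) multiset set"
  where "stalk_tensor M A y p =
    {q. tensor_cong (range (stalk_class M A y)) (+) (null_at M A y)
          {((stalk_class M A y (incl A f * a), stalk_class M A y b),
            (stalk_class M A y a, stalk_class M A y (incl A f * b))) |f a b. f \<in> Cc_infinity M} p q}"

definition stalk_comult ::
    "'m manifold \<Rightarrow> ('k::real_or_complex, 'm, 'a::ring) hopf_structure \<Rightarrow> 'm \<Rightarrow>
     'a set \<Rightarrow> ('a set \<times> 'a set) multiset set"
  where "stalk_comult M A y \<zeta> =
    (THE t. \<exists>a p. \<zeta> = stalk_class M A y a \<and> comult A a = tensor M A p \<and>
       t = stalk_tensor M A y {#(stalk_class M A y u, stalk_class M A y v). (u, v) \<in># p#})"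

definition stalk_counit ::
    "'m manifold \<Rightarrow> ('k::real_or_complex, 'm, 'a::ring) hopf_structure \<Rightarrow> 'm \<Rightarrow> 'a set \<Rightarrow> ('m \<Rightarrow> 'k) set"
  where "stalk_counit M A y \<zeta> =
    (THE \<gamma>. \<exists>a. \<zeta> = stalk_class M A y a \<and> \<gamma> = germ M y (counit A a))"

definition stalk_grouplike ::
    "'m manifold \<Rightarrow> ('k::real_or_complex, 'm, 'a::ring) hopf_structure \<Rightarrow> 'm \<Rightarrow> 'a set set"
  where "stalk_grouplike M A y =
    {\<zeta> \<in> range (stalk_class M A y).
       stalk_comult M A y \<zeta> = stalk_tensor M A y {#(\<zeta>, \<zeta>)#} \<and>
       stalk_counit M A y \<zeta> = germ M y (\<lambda>_. 1)}"

definition sheet ::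
    "'m manifold \<Rightarrow> ('k::real_or_complex, 'm, 'a::ring) hopf_structure \<Rightarrow> 'a \<Rightarrow> 'm set \<Rightarrow> ('m \<times> 'a set) set"
  where "sheet M A a W = (\<lambda>y. (y, stalk_class M A y a)) ` W"

text \<open>The projection of the spectral sheaf to \<open>M\<close> is \<^const>\<open>fst\<close>.\<close>

definition spectral_sheaf ::
    "'m manifold \<Rightarrow> ('k::real_or_complex, 'm, 'a::ring) hopf_structure \<Rightarrow> ('m \<times> 'a set) manifold"
  where "spectral_sheaf M A =
    \<lparr>mtop = subtopology
       (topology_generated_by {sheet M A a W |a W. weakly_grouplike M A a \<and> openin (mtop M) W \<and>
          (\<forall>y\<in>W. normalized_at M A a y)})
       (SIGMA y : points M. stalk_grouplike M A y),
     mdim = mdim M,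
     atlas = {(sheet M A a W, \<phi> \<circ> fst) |a W U \<phi>. weakly_grouplike M A a \<and> openin (mtop M) W \<and>
       (\<forall>y\<in>W. normalized_at M A a y) \<and> W \<subseteq> U \<and> (U, \<phi>) \<in> atlas M}\<rparr>"

definition spectral_sheaf_map ::
    "'m manifold \<Rightarrow> ('k::real_or_complex, 'm, 'a::ring) hopf_structure \<Rightarrow>
     ('k, 'm, 'b::ring) hopf_structure \<Rightarrow> ('a \<Rightarrow> 'b) \<Rightarrow> 'm \<times> 'a set \<Rightarrow> 'm \<times> 'b set"
  where "spectral_sheaf_map M A B \<alpha> =
    (\<lambda>(y, \<zeta>). (y, THE \<eta>. \<exists>a. \<zeta> = stalk_class M A y a \<and> \<eta> = stalk_class M B y (\<alpha> a)))"

section \<open>The spectral etale Lie groupoid\<close>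

text \<open>
  \<open>is_transport M A W a V \<tau>\<close> states that \<open>V\<close> and \<open>\<tau> = \<tau>\<^bsub>W,a\<^esub>\<close> are the open set and the diffeomorphism
  \<open>V \<rightarrow> W\<close> induced by \<open>a\<close>; \<open>f \<circ> \<tau>\<close> is extended by \<open>0\<close>, and \<open>\<tau>\<close> is made unique as a function on the
  underlying type by requiring it to be \<^const>\<open>undefined\<close> outside \<open>V\<close>.
\<close>

definition is_transport ::
    "'m manifold \<Rightarrow> ('k::real_or_complex, 'm, 'a::ring) hopf_structure \<Rightarrow>
     'm set \<Rightarrow> 'a \<Rightarrow> 'm set \<Rightarrow> ('m \<Rightarrow> 'm) \<Rightarrow> bool"
  where "is_transport M A W a V \<tau> \<longleftrightarrow>
    openin (mtop M) V \<and> \<tau> \<in> extensional V \<and>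
    diffeomorphism (open_submanifold M V) (open_submanifold M W) \<tau> \<and>
    (\<forall>f \<in> Cc_infinity_on M W.
       counit A (antipode A (incl A f * a)) = (\<lambda>x. if x \<in> V then f (\<tau> x) else 0)) \<and>
    (\<lambda>f. counit A (antipode A (incl A f * a))) ` Cc_infinity_on M W = Cc_infinity_on M V"

definition transport_inv ::
    "'m manifold \<Rightarrow> ('k::real_or_complex, 'm, 'a::ring) hopf_structure \<Rightarrow> 'm set \<Rightarrow> 'a \<Rightarrow> 'm \<Rightarrow> 'm"
  where "transport_inv M A W a =
    (case THE (V, \<tau>). is_transport M A W a V \<tau> of (V, \<tau>) \<Rightarrow> inv_into V \<tau>)"

definition spectral_arrow_set ::
    "'m manifold \<Rightarrow> ('k::real_or_complex, 'm, 'a::ring) hopf_structure \<Rightarrow> ('m \<times> 'a set) set"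
  where "spectral_arrow_set M A =
    {(y, stalk_class M A y a) |y a.
       y \<in> points M \<and> a \<in> S_invariant_weakly_grouplike M A \<and> normalized_at M A a y}"

definition represents ::
    "'m manifold \<Rightarrow> ('k::real_or_complex, 'm, 'a::ring) hopf_structure \<Rightarrow> 'a \<Rightarrow> 'm \<times> 'a set \<Rightarrow> bool"
  where "represents M A a g \<longleftrightarrow>
    a \<in> S_invariant_weakly_grouplike M A \<and> normalized_at M A a (fst g) \<and>
    snd g = stalk_class M A (fst g) a"

definition spectral_src ::
    "'m manifold \<Rightarrow> ('k::real_or_complex, 'm, 'a::ring) hopf_structure \<Rightarrow> 'm \<times> 'a set \<Rightarrow> 'm"
  where "spectral_src M A g =
    (THE x. \<exists>a W. represents M A a g \<and> openin (mtop M) W \<and> fst g \<in> W \<and>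
       (\<forall>y\<in>W. normalized_at M A a y) \<and> x = transport_inv M A W a (fst g))"

definition spectral_mult ::
    "'m manifold \<Rightarrow> ('k::real_or_complex, 'm, 'a::ring) hopf_structure \<Rightarrow>
     'm \<times> 'a set \<Rightarrow> 'm \<times> 'a set \<Rightarrow> 'm \<times> 'a set"
  where "spectral_mult M A h g =
    (THE k. \<exists>b a. represents M A b h \<and> represents M A a g \<and>
       k = (fst h, stalk_class M A (fst h) (b * a)))"

definition spectral_unit ::
    "'m manifold \<Rightarrow> ('k::real_or_complex, 'm, 'a::ring) hopf_structure \<Rightarrow> 'm \<Rightarrow> 'm \<times> 'a set"
  where "spectral_unit M A y =
    (THE g. \<exists>f \<in> Cc_infinity M. same_germ M y f (\<lambda>_. 1) \<and> g = (y, stalk_class M A y (incl A f)))"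

definition spectral_inv ::
    "'m manifold \<Rightarrow> ('k::real_or_complex, 'm, 'a::ring) hopf_structure \<Rightarrow> 'm \<times> 'a set \<Rightarrow> 'm \<times> 'a set"
  where "spectral_inv M A g =
    (THE k. \<exists>a. represents M A a g \<and>
       k = (spectral_src M A g, stalk_class M A (spectral_src M A g) (antipode A a)))"

definition spectral_groupoid ::
    "'m manifold \<Rightarrow> ('k::real_or_complex, 'm, 'a::ring) hopf_structure \<Rightarrow> ('m, 'm \<times> 'a set) groupoid"
  where "spectral_groupoid M A =
    \<lparr>arrows = open_submanifold (spectral_sheaf M A) (spectral_arrow_set M A),
     gsrc = spectral_src M A,
     gtgt = fst,
     gmult = spectral_mult M A,
     gunit = spectral_unit M A,
     ginv = spectral_inv M A\<rparr>"

definition spectral_groupoid_map ::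
    "'m manifold \<Rightarrow> ('k::real_or_complex, 'm, 'a::ring) hopf_structure \<Rightarrow>
     ('k, 'm, 'b::ring) hopf_structure \<Rightarrow> ('a \<Rightarrow> 'b) \<Rightarrow> 'm \<times> 'a set \<Rightarrow> 'm \<times> 'b set"
  where "spectral_groupoid_map M A B \<alpha> =
    restrict (spectral_sheaf_map M A B \<alpha>) (points (arrows (spectral_groupoid M A)))"

end

theory Submission
  imports Defs
begin

text \<open>
  For an \<open>S\<close>-invariant weakly grouplike \<open>a\<close>, normalized on the open set \<open>W\<close>, the map
  \<open>T f = \<epsilon>(S(fa))\<close> is an injective homomorphism from the functions compactly supported in \<open>W\<close> to the
  base ring, and its image is an ideal. Every nonzero character of the functions compactly supported
  in \<open>W\<close> is the evaluation at a point, so that \<open>T f = f \<circ> \<tau>\<close> for a map \<open>\<tau>\<close> from an open set \<open>V\<close> to \<open>W\<close>.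
  The two properties of \<open>T\<close> force \<open>\<tau>\<close> to be bijective and \<open>T\<close> to be onto the functions compactly
  supported in \<open>V\<close>; hence \<open>\<tau>\<close> is a diffeomorphism.

  The identities \<open>S(a)fa = T f\<close>, \<open>faS(a) = f\<close>, \<open>fa = a(T f)\<close>, valid for \<open>f\<close> supported in \<open>W\<close>, turn the
  groupoid axioms into computations with germs; for example \<open>S(ba)f(ba) = S(a)(T\<^sub>b f)a\<close> shows that the
  transport of a product is the composite of the transports. The target map is a local diffeomorphism
  by the construction of the spectral sheaf, the source map is locally the target map followed by the
  inverse of some \<open>\<tau>\<close>, and a continuous map between manifolds that lifts a local diffeomorphism through a
  local diffeomorphism is one itself. Hence for the remaining structure maps and for the maps induced by
  homomorphisms only continuity has to be checked.
\<close>

section \<open>Differential calculus on Euclidean spaces\<close>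

text \<open>The counit law gives a = \<epsilon>(a)a', so the companion a' in \<Delta>(a) = a
  \<otimes> a' agrees with \<open>a\<close> only where \<epsilon>(a) = 1. All identities are
  therefore stated for functions f with f\<epsilon>(a) = f, and for these invariance makes S(fa)
  again invariant weakly grouplike. Injectivity of T rests on f = \<epsilon>(fa) = \<epsilon>(a(T
  f)), the ideal property on (T f)g = T(f\<epsilon>(ag)). A point of W missed by \<tau> would yield
  a nonzero function killed by T; two points of V with the same image could not be separated by
  functions (T f)g. The base ring need not have an identity and M is not assumed paracompact, so
  everything runs on compact supports, with local units glued by f + g - fg. Characters give \<tau>
  as a bare map of points. Its smoothness is detected by pulling back coordinate functions cut off
  by bumps; these are scalar-valued, and real smoothness is recovered because the reals are closed
  in the field. The source of an arrow is determined by T on functions supported arbitrarily close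
  to y. Hence it depends on the germ of \<open>a\<close> at y alone, which makes all the definite
  descriptions meaningful.\<close>

lemma Euclidean_space_eq: "Euclidean_space n = top_of_set {x. \<forall>i\<ge>n. x i = 0}"
  by (simp add: Euclidean_space_def euclidean_product_topology)

text \<open>Points are sequences, without a norm: boxes in the first n coordinates replace balls. A
  basic open set of the product topology contains such a box because the coordinates from n on are
  all zero.\<close>

lemma openin_Euclidean_space_box:
  assumes "openin (Euclidean_space n) U" "x \<in> U"
  obtains r where "r > 0"
    "\<And>y. y \<in> topspace (Euclidean_space n) \<Longrightarrow> (\<And>i. i < n \<Longrightarrow> \<bar>y i - x i\<bar> < r) \<Longrightarrow> y \<in> U"
proof -
  obtain T where T: "openin (powertop_real UNIV) T" "U = T \<inter> {x. \<forall>i\<ge>n. x i = 0}"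
    using assms(1) unfolding Euclidean_space_def openin_subtopology by blast
  then have "x \<in> T" using assms by auto
  have "\<exists>X. x \<in> Pi\<^sub>E UNIV X \<and> (\<forall>i. openin euclideanreal (X i)) \<and>
      finite {i. X i \<noteq> topspace euclideanreal} \<and> Pi\<^sub>E UNIV X \<subseteq> T"
    by (rule product_topology_open_contains_basis[OF T(1) \<open>x \<in> T\<close>])
  then obtain B where B: "x \<in> Pi\<^sub>E UNIV B" "\<forall>i. open (B i)" "Pi\<^sub>E UNIV B \<subseteq> T"
    unfolding open_openin[symmetric] by blast
  have "\<exists>r>0. \<forall>t. \<bar>t - x i\<bar> < r \<longrightarrow> t \<in> B i" for i
    using B(1) B(2)[rule_format, of i] unfolding open_dist by (auto simp: dist_real_def PiE_iff)
  then obtain r where r: "\<And>i. r i > 0" "\<And>i t. \<bar>t - x i\<bar> < r i \<Longrightarrow> t \<in> B i" by metis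
  \<comment> \<open>The \<open>insert 1\<close> keeps the minimum defined for n = 0.\<close>
  define e where "e = Min (insert 1 (r ` {..<n}))"
  have e: "e > 0" "\<And>i. i < n \<Longrightarrow> e \<le> r i" unfolding e_def using r(1) by auto
  have "y \<in> U" if y: "y \<in> topspace (Euclidean_space n)" "\<And>i. i < n \<Longrightarrow> \<bar>y i - x i\<bar> < e" for y
  proof -
    have "y i \<in> B i" for i
    proof (cases "i < n")
      case True then show ?thesis using y(2) e(2) r(2) by force
    next
      case False then show ?thesis using y(1) assms(2) T(2) r(1)[of i] r(2)[of 0 i]
        by (auto simp: topspace_Euclidean_space)
    qed
    then have "y \<in> T" using B(3) by auto
    then show ?thesis using T(2) y(1) by (auto simp: topspace_Euclidean_space)
  qed
  with e(1) show thesis using that by blast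
qed

lemma open_subset_Euclidean:
  "openin (Euclidean_space n) U \<Longrightarrow> x \<in> U \<Longrightarrow> i \<ge> n \<Longrightarrow> x i = 0"
  using openin_subset[of "Euclidean_space n" U] by (auto simp: topspace_Euclidean_space)

text \<open>Gives access to the library on \<open>continuous_on\<close>: an open set of the
  Euclidean space inherits the same topology from the whole type of sequences.\<close>

lemma continuous_map_Euclidean_iff:
  assumes "openin (Euclidean_space n) U"
  shows "continuous_map (subtopology (Euclidean_space n) U) euclidean f \<longleftrightarrow> continuous_on U f"
proof -
  have "U \<subseteq> {x. \<forall>i\<ge>n. x i = 0}"
    using openin_subset[OF assms] by (auto simp: topspace_Euclidean_space)
  then show ?thesis
    by (simp add: Euclidean_space_eq subtopology_subtopology Int_absorb1)
qed

text \<open>A partial derivative sees \<open>f\<close> only on a line through x. This line stays in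
  U near x, so the derivative depends on the values of \<open>f\<close> on U alone.\<close>

lemma eventually_update_mem:
  assumes "openin (Euclidean_space n) U" "x \<in> U" "i < n"
  shows "\<forall>\<^sub>F t in nhds (x i). x(i := t) \<in> U"
proof -
  obtain r where r: "r > 0"
    "\<And>y. y \<in> topspace (Euclidean_space n) \<Longrightarrow> (\<And>i. i < n \<Longrightarrow> \<bar>y i - x i\<bar> < r) \<Longrightarrow> y \<in> U"
    using openin_Euclidean_space_box[OF assms(1,2)] by blast
  have "x(i := t) \<in> U" if "dist t (x i) < r" for t
    using that r(1) assms(3) open_subset_Euclidean[OF assms(1,2)]
    by (intro r(2)) (auto simp: topspace_Euclidean_space dist_real_def)
  then show ?thesis using r(1) unfolding eventually_nhds_metric by blast
qed

lemma has_vector_derivative_update_cong: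
  assumes "openin (Euclidean_space n) U" "x \<in> U" "i < n" "\<And>y. y \<in> U \<Longrightarrow> f y = g y"
  shows "((\<lambda>t. f (x(i := t))) has_vector_derivative D) (at (x i)) \<longleftrightarrow>
         ((\<lambda>t. g (x(i := t))) has_vector_derivative D) (at (x i))"
  using assms eventually_update_mem[OF assms(1-3)]
  by (intro has_vector_derivative_cong_ev) (auto elim: eventually_mono)

lemma Ck_on_continuous: "Ck_on n k U f \<Longrightarrow> openin (Euclidean_space n) U \<Longrightarrow> continuous_on U f"
  by (cases k) (auto simp: continuous_map_Euclidean_iff)

text \<open>\<open>Ck_on\<close> asserts the existence of a partial derivative separately for each
  index; here all of them form one family that can be named.\<close>

definition has_partials ::
    "nat \<Rightarrow> (nat \<Rightarrow> real) set \<Rightarrow> ((nat \<Rightarrow> real) \<Rightarrow> 'v::real_normed_vector) \<Rightarrow> (nat \<Rightarrow> (nat \<Rightarrow> real) \<Rightarrow> 'v) \<Rightarrow> bool"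
  where "has_partials n U f g \<longleftrightarrow>
    (\<forall>i<n. \<forall>x\<in>U. ((\<lambda>t. f (x(i := t))) has_vector_derivative g i x) (at (x i)))"

lemma has_partialsD: "has_partials n U f g \<Longrightarrow> i < n \<Longrightarrow> x \<in> U \<Longrightarrow>
    ((\<lambda>t. f (x(i := t))) has_vector_derivative g i x) (at (x i))"
  by (simp add: has_partials_def)

lemma Ck_on_SucI:
  assumes "openin (Euclidean_space n) U" "continuous_on U f" "has_partials n U f g"
    "\<And>i. i < n \<Longrightarrow> Ck_on n k U (g i)"
  shows "Ck_on n (Suc k) U f"
  unfolding Ck_on.simps(2) continuous_map_Euclidean_iff[OF assms(1)]
proof (intro conjI allI impI)
  fix i assume "i < n"
  then show "\<exists>g. (\<forall>x\<in>U. ((\<lambda>t. f (x(i := t))) has_vector_derivative g x) (at (x i))) \<and> Ck_on n k U g"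
    using assms(3,4) unfolding has_partials_def by (intro exI[of _ "g i"]) simp
qed (rule assms(2))

lemma Ck_on_SucE:
  assumes "Ck_on n (Suc k) U f"
  obtains g where "has_partials n U f g" "\<And>i. i < n \<Longrightarrow> Ck_on n k U (g i)"
proof -
  have "\<exists>g. i < n \<longrightarrow>
     (\<forall>x\<in>U. ((\<lambda>t. f (x(i := t))) has_vector_derivative g x) (at (x i))) \<and> Ck_on n k U g" for i
    using assms by auto
  then have "\<exists>g. \<forall>i. i < n \<longrightarrow>
     (\<forall>x\<in>U. ((\<lambda>t. f (x(i := t))) has_vector_derivative g i x) (at (x i))) \<and> Ck_on n k U (g i)"
    by (intro choice allI)
  then show thesis using that unfolding has_partials_def by blast
qed

lemma Ck_on_cong:
  assumes U: "openin (Euclidean_space n) U" and f: "Ck_on n k U f" and eq: "\<And>x. x \<in> U \<Longrightarrow> f x = g x"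
  shows "Ck_on n k U g"
proof -
  have c: "continuous_on U g"
    using Ck_on_continuous[OF f U] eq by (simp cong: continuous_on_cong)
  show ?thesis
  proof (cases k)
    case 0
    then show ?thesis using c by (simp add: continuous_map_Euclidean_iff[OF U])
  next
    case (Suc l)
    obtain f' where f': "has_partials n U f f'" "\<And>i. i < n \<Longrightarrow> Ck_on n l U (f' i)"
      using f unfolding Suc by (rule Ck_on_SucE) blast
    show ?thesis unfolding Suc
      using has_vector_derivative_update_cong[OF U, where f = f and g = g] f' eq
      by (intro Ck_on_SucI[OF U c, where g = f']) (simp_all add: has_partials_def del: fun_upd_apply)
  qed
qed

lemma Ck_on_subset:
  assumes U: "openin (Euclidean_space n) U" and V: "openin (Euclidean_space n) V" "V \<subseteq> U"
  shows "Ck_on n k U f \<Longrightarrow> Ck_on n k V f"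
proof (induction k arbitrary: f)
  case 0
  then show ?case using U V by (simp add: continuous_map_Euclidean_iff continuous_on_subset)
next
  case (Suc k)
  obtain f' where f': "has_partials n U f f'" "\<And>i. i < n \<Longrightarrow> Ck_on n k U (f' i)"
      using Suc.prems by (rule Ck_on_SucE) blast
  show ?case
    using f' Suc.IH V(2) continuous_on_subset[OF Ck_on_continuous[OF Suc.prems U] V(2)]
    by (intro Ck_on_SucI[OF V(1), where g = f']) (auto simp: has_partials_def simp del: fun_upd_apply)
qed

lemma Ck_on_Suc_D:
  assumes U: "openin (Euclidean_space n) U"
  shows "Ck_on n (Suc k) U f \<Longrightarrow> Ck_on n k U f"
proof (induction k arbitrary: f)
  case (Suc k)
  obtain f' where f': "has_partials n U f f'" "\<And>i. i < n \<Longrightarrow> Ck_on n (Suc k) U (f' i)"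
      using Suc.prems by (rule Ck_on_SucE) blast
  show ?case
    using f' Suc.IH Ck_on_continuous[OF Suc.prems U]
    by (intro Ck_on_SucI[OF U, where g = f']) (auto simp del: Ck_on.simps)
qed simp

declare Ck_on.simps(2) [simp del]

lemma Ck_on_local:
  assumes U: "openin (Euclidean_space n) U"
  shows "(\<And>x. x \<in> U \<Longrightarrow> \<exists>V. openin (Euclidean_space n) V \<and> x \<in> V \<and> Ck_on n k V f) \<Longrightarrow> Ck_on n k U f"
proof (induction k arbitrary: f)
  have cont: "continuous_on U f"
    if *: "\<And>x. x \<in> U \<Longrightarrow> \<exists>V. openin (Euclidean_space n) V \<and> x \<in> V \<and> continuous_on V f" for f :: "_ \<Rightarrow> 'a"
  proof -
    obtain V where V: "\<And>x. x \<in> U \<Longrightarrow> openin (Euclidean_space n) (V x) \<and> x \<in> V x \<and> continuous_on (V x) f"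
      using * by metis
    have "continuous_map (subtopology (Euclidean_space n) U) euclidean f"
    proof (rule pasting_lemma[where I = U and T = "\<lambda>x. V x \<inter> U" and f = "\<lambda>_. f"])
      fix i assume i: "i \<in> U"
      show "openin (subtopology (Euclidean_space n) U) (V i \<inter> U)"
        using V[OF i] by (auto simp: openin_subtopology)
      have "openin (Euclidean_space n) (V i \<inter> U)" using V[OF i] U by auto
      then show "continuous_map (subtopology (subtopology (Euclidean_space n) U) (V i \<inter> U)) euclidean f"
        using continuous_on_subset[of "V i" f "V i \<inter> U"] V[OF i]
        by (simp add: subtopology_subtopology continuous_map_Euclidean_iff Int_absorb1)
    qed (use V in auto)
    then show ?thesis using U by (simp add: continuous_map_Euclidean_iff)
  qed
  case 0
  then have "\<exists>V. openin (Euclidean_space n) V \<and> x \<in> V \<and> continuous_on V f" if "x \<in> U" for x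
    using 0 that continuous_map_Euclidean_iff by (metis Ck_on.simps(1))
  then show ?case using cont[of f] U by (simp add: continuous_map_Euclidean_iff)
next
  case (Suc k)
  have cont: "continuous_on U f"
  proof -
    have "Ck_on n k U f"
    proof (rule Suc.IH)
      fix x assume "x \<in> U"
      then obtain V where "openin (Euclidean_space n) V" "x \<in> V" "Ck_on n (Suc k) V f" using Suc.prems by auto
      then show "\<exists>V. openin (Euclidean_space n) V \<and> x \<in> V \<and> Ck_on n k V f"
        by (intro exI[of _ V]) (simp add: Ck_on_Suc_D)
    qed
    then show ?thesis using U by (rule Ck_on_continuous)
  qed
  define g where "g i x = vector_derivative (\<lambda>t. f (x(i := t))) (at (x i))" for i x
  have loc: "\<exists>V. openin (Euclidean_space n) V \<and> x \<in> V \<and> Ck_on n k V (g i) \<and>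
      ((\<lambda>t. f (x(i := t))) has_vector_derivative g i x) (at (x i))" if x: "x \<in> U" and i: "i < n" for x i
  proof -
    obtain V where V: "openin (Euclidean_space n) V" "x \<in> V" "Ck_on n (Suc k) V f"
      using Suc.prems[OF x] by blast
    obtain h where h: "has_partials n V f h" "\<And>i. i < n \<Longrightarrow> Ck_on n k V (h i)"
      by (rule Ck_on_SucE[OF V(3)]) blast
    have "g i y = h i y" if "y \<in> V" for y
      unfolding g_def using has_partialsD[OF h(1) i that] by (rule vector_derivative_at)
    then show ?thesis using V(1,2) has_partialsD[OF h(1) i] Ck_on_cong[OF V(1) h(2)[OF i]]
      by (intro exI[of _ V]) auto
  qed
  show ?case
  proof (rule Ck_on_SucI[OF U cont, where g = g])
    show "has_partials n U f g"
      using loc unfolding has_partials_def by blast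
    show "Ck_on n k U (g i)" if "i < n" for i
      using loc that by (intro Suc.IH) blast
  qed
qed

section \<open>Closure properties of the classes of differentiable functions\<close>

lemma Ck_on_const: "openin (Euclidean_space n) U \<Longrightarrow> Ck_on n k U (\<lambda>_. c)"
proof (induction k arbitrary: c)
  case 0 then show ?case by simp
next
  case (Suc k)
  then show ?case by (intro Ck_on_SucI[where g = "\<lambda>_ _. 0"]) (auto simp: has_partials_def intro: has_vector_derivative_const)
qed

lemma continuous_on_coordinate: "continuous_on U (\<lambda>x::nat \<Rightarrow> real. x j)"
  by (rule continuous_on_product_then_coordinatewise[OF continuous_on_id])

lemma Ck_on_coordinate:
  assumes U: "openin (Euclidean_space n) U" shows "Ck_on n k U (\<lambda>x. x j)"
proof (cases k)
  case 0 then show ?thesis using U by (simp add: continuous_map_Euclidean_iff continuous_on_coordinate)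
next
  case (Suc l)
  have "((\<lambda>t. (x(i := t)) j) has_vector_derivative (if i = j then 1 else 0)) (at (x i))"
    for i and x :: "nat \<Rightarrow> real"
    by (cases "i = j") (auto intro: has_vector_derivative_const has_vector_derivative_id[unfolded id_def])
  then show ?thesis unfolding Suc
    by (intro Ck_on_SucI[OF U, where g = "\<lambda>i _. if i = j then 1 else 0"])
      (auto simp: continuous_on_coordinate has_partials_def simp del: fun_upd_apply intro: Ck_on_const[OF U])
qed

lemma Ck_on_add:
  assumes U: "openin (Euclidean_space n) U"
  shows "Ck_on n k U f \<Longrightarrow> Ck_on n k U g \<Longrightarrow> Ck_on n k U (\<lambda>x. f x + g x)"
proof (induction k arbitrary: f g)
  case 0 then show ?case using U by (simp add: continuous_map_Euclidean_iff continuous_on_add)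
next
  case (Suc k)
  obtain f' where f': "has_partials n U f f'" "\<And>i. i < n \<Longrightarrow> Ck_on n k U (f' i)"
      by (rule Ck_on_SucE[OF Suc.prems(1)]) blast
  obtain g' where g': "has_partials n U g g'" "\<And>i. i < n \<Longrightarrow> Ck_on n k U (g' i)"
      by (rule Ck_on_SucE[OF Suc.prems(2)]) blast
  show ?case
    using f' g' Suc.IH Ck_on_continuous[OF Suc.prems(1) U] Ck_on_continuous[OF Suc.prems(2) U]
    by (intro Ck_on_SucI[OF U, where g = "\<lambda>i x. f' i x + g' i x"])
      (auto simp: has_partials_def simp del: fun_upd_apply intro: has_vector_derivative_add continuous_on_add)
qed

lemma Ck_on_sum:
  assumes U: "openin (Euclidean_space n) U"
  shows "(\<And>j. j \<in> J \<Longrightarrow> Ck_on n k U (f j)) \<Longrightarrow> Ck_on n k U (\<lambda>x. \<Sum>j\<in>J. f j x)"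
  by (induction J rule: infinite_finite_induct) (auto intro: Ck_on_add[OF U] Ck_on_const[OF U])

text \<open>One Leibniz rule covers the product of an algebra and the scalar multiplication.\<close>

lemma Ck_on_bilinear:
  assumes U: "openin (Euclidean_space n) U" and B: "bounded_bilinear B"
  shows "Ck_on n k U f \<Longrightarrow> Ck_on n k U g \<Longrightarrow> Ck_on n k U (\<lambda>x. B (f x) (g x))"
proof (induction k arbitrary: f g)
  case 0 then show ?case using U by (simp add: continuous_map_Euclidean_iff bounded_bilinear.continuous_on[OF B])
next
  case (Suc k)
  obtain f' where f': "has_partials n U f f'" "\<And>i. i < n \<Longrightarrow> Ck_on n k U (f' i)"
      by (rule Ck_on_SucE[OF Suc.prems(1)]) blast
  obtain g' where g': "has_partials n U g g'" "\<And>i. i < n \<Longrightarrow> Ck_on n k U (g' i)"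
      by (rule Ck_on_SucE[OF Suc.prems(2)]) blast
  show ?case
  proof (rule Ck_on_SucI[OF U, where g = "\<lambda>i x. B (f x) (g' i x) + B (f' i x) (g x)"])
    show "continuous_on U (\<lambda>x. B (f x) (g x))"
      using Ck_on_continuous[OF Suc.prems(1) U] Ck_on_continuous[OF Suc.prems(2) U]
      by (rule bounded_bilinear.continuous_on[OF B])
    show "has_partials n U (\<lambda>x. B (f x) (g x)) (\<lambda>i x. B (f x) (g' i x) + B (f' i x) (g x))"
      unfolding has_partials_def
    proof (intro allI impI ballI)
      fix i x assume ix: "i < n" "x \<in> U"
      show "((\<lambda>t. B (f (x(i := t))) (g (x(i := t)))) has_vector_derivative
          B (f x) (g' i x) + B (f' i x) (g x)) (at (x i))"
        using bounded_bilinear.has_vector_derivative[OF B has_partialsD[OF f'(1) ix] has_partialsD[OF g'(1) ix]]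
        by simp
    qed
    show "Ck_on n k U (\<lambda>x. B (f x) (g' i x) + B (f' i x) (g x))" if "i < n" for i
      using that f'(2) g'(2) Ck_on_Suc_D[OF U Suc.prems(1)] Ck_on_Suc_D[OF U Suc.prems(2)]
      by (intro Ck_on_add[OF U] Suc.IH) simp_all
  qed
qed

lemmas Ck_on_mult = Ck_on_bilinear[OF _ bounded_bilinear_mult]
lemmas Ck_on_scaleR = Ck_on_bilinear[OF _ bounded_bilinear_scaleR]

lemma Ck_on_bounded_linear:
  assumes U: "openin (Euclidean_space n) U" and L: "bounded_linear L"
  shows "Ck_on n k U f \<Longrightarrow> Ck_on n k U (\<lambda>x. L (f x))"
proof (induction k arbitrary: f)
  case 0 then show ?case using U by (simp add: continuous_map_Euclidean_iff bounded_linear.continuous_on[OF L])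
next
  case (Suc k)
  obtain f' where f': "has_partials n U f f'" "\<And>i. i < n \<Longrightarrow> Ck_on n k U (f' i)"
      by (rule Ck_on_SucE[OF Suc.prems(1)]) blast
  show ?case
    using f' Suc.IH Ck_on_continuous[OF Suc.prems(1) U]
    by (intro Ck_on_SucI[OF U, where g = "\<lambda>i x. L (f' i x)"])
      (auto simp: has_partials_def simp del: fun_upd_apply intro: bounded_linear.has_vector_derivative[OF L] bounded_linear.continuous_on[OF L])
qed

lemma has_vector_derivative_inverse:
  fixes f :: "real \<Rightarrow> 'v::real_normed_div_algebra"
  assumes "(f has_vector_derivative D) (at x)" "f x \<noteq> 0"
  shows "((\<lambda>t. inverse (f t)) has_vector_derivative - (inverse (f x) * D * inverse (f x))) (at x)"
  using Deriv.has_derivative_inverse[OF assms(2) assms(1)[unfolded has_vector_derivative_def]]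
  by (simp add: has_vector_derivative_def)

text \<open>The derivative of 1/f contains 1/f again. The induction keeps \<open>f\<close> fixed,
  since its hypothesis is used for 1/f itself.\<close>

lemma Ck_on_inverse:
  fixes f :: "_ \<Rightarrow> 'v::real_normed_div_algebra"
  assumes U: "openin (Euclidean_space n) U"
  shows "Ck_on n k U f \<Longrightarrow> (\<And>x. x \<in> U \<Longrightarrow> f x \<noteq> 0) \<Longrightarrow> Ck_on n k U (\<lambda>x. inverse (f x))"
proof (induction k)
  case 0 then show ?case using U by (simp add: continuous_map_Euclidean_iff continuous_on_inverse)
next
  case (Suc k)
  obtain f' where f': "has_partials n U f f'" "\<And>i. i < n \<Longrightarrow> Ck_on n k U (f' i)"
      by (rule Ck_on_SucE[OF Suc.prems(1)]) blast
  have inv: "Ck_on n k U (\<lambda>x. inverse (f x))" using Suc.IH Suc.prems(2) Ck_on_Suc_D[OF U Suc.prems(1)] by simp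
  show ?case
  proof (rule Ck_on_SucI[OF U, where g = "\<lambda>i x. - (inverse (f x) * f' i x * inverse (f x))"])
    show "continuous_on U (\<lambda>x. inverse (f x))"
      using Suc.prems(2) Ck_on_continuous[OF Suc.prems(1) U] by (intro continuous_on_inverse) auto
    show "has_partials n U (\<lambda>x. inverse (f x)) (\<lambda>i x. - (inverse (f x) * f' i x * inverse (f x)))"
      unfolding has_partials_def
      using has_vector_derivative_inverse[OF has_partialsD[OF f'(1)]] Suc.prems(2) by simp
    show "Ck_on n k U (\<lambda>x. - (inverse (f x) * f' i x * inverse (f x)))" if "i < n" for i
      using that f'(2) inv
      by (intro Ck_on_bounded_linear[OF U bounded_linear_minus[OF bounded_linear_ident]] Ck_on_mult[OF U]) auto
  qed
qed

text \<open>The increment of \<open>f\<close> along the curve is telescoped over the points \<open>p k t\<close>, which have their first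
  \<open>k\<close> coordinates at time \<open>t\<close> and the others at time \<open>t0\<close>.\<close>

lemma has_vector_derivative_along_curve:
  fixes f :: "(nat \<Rightarrow> real) \<Rightarrow> 'v::real_normed_vector"
  assumes V: "openin (Euclidean_space m) V"
    and f: "has_partials m V f D" "\<And>j. j < m \<Longrightarrow> continuous_on V (D j)"
    and \<gamma>: "\<gamma> t0 \<in> V" "\<And>t. \<gamma> t \<in> topspace (Euclidean_space m)"
      "\<And>j. j < m \<Longrightarrow> ((\<lambda>t. \<gamma> t j) has_vector_derivative d j) (at t0)"
  shows "((\<lambda>t. f (\<gamma> t)) has_vector_derivative (\<Sum>j<m. d j *\<^sub>R D j (\<gamma> t0))) (at t0)"
proof -
  define p where "p k t = (\<lambda>i. if i < k then \<gamma> t i else \<gamma> t0 i)" for k :: nat and t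
  have pk: "p k t = (p k t)(k := \<gamma> t0 k)" "p (Suc k) t = (p k t)(k := \<gamma> t k)" for k t
    by (auto simp: p_def fun_eq_iff less_Suc_eq)
  have tends: "((\<lambda>t. \<gamma> t j) \<longlongrightarrow> \<gamma> t0 j) (at t0)" if "j < m" for j
    using \<gamma>(3)[OF that] has_vector_derivative_continuous continuous_within by blast
  have "((\<lambda>t. f (p k t)) has_vector_derivative (\<Sum>j<k. d j *\<^sub>R D j (\<gamma> t0))) (at t0)" if "k \<le> m" for k
    using that
  proof (induction k)
    case 0
    then show ?case by (simp add: p_def has_vector_derivative_const)
  next
    case (Suc k)
    then have k: "k < m" by simp
    define Q where "Q t = (if \<gamma> t k = \<gamma> t0 k then D k (\<gamma> t0)
        else (f (p (Suc k) t) - f (p k t)) /\<^sub>R (\<gamma> t k - \<gamma> t0 k))" for t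
    have fQ: "f (p (Suc k) t) = f (p k t) + (\<gamma> t k - \<gamma> t0 k) *\<^sub>R Q t" for t
      using pk[of k t] by (auto simp: Q_def)
    have Q: "(Q \<longlongrightarrow> D k (\<gamma> t0)) (at t0)"
    proof (rule tendstoI)
      fix e :: real assume e: "e > 0"
      define B where "B = V \<inter> D k -` ball (D k (\<gamma> t0)) (e / 4)"
      have "openin (top_of_set V) B"
        unfolding B_def using continuous_openin_preimage_gen[OF f(2)[OF k] open_ball] .
      moreover have "top_of_set V = subtopology (Euclidean_space m) V"
        using openin_subset[OF V]
        by (simp add: Euclidean_space_eq subtopology_subtopology Int_absorb1)
      ultimately have "openin (Euclidean_space m) B"
        using V openin_trans_full by metis
      moreover have "\<gamma> t0 \<in> B" using \<gamma>(1) e by (simp add: B_def)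
      ultimately obtain r where r: "r > 0"
        "\<And>y. y \<in> topspace (Euclidean_space m) \<Longrightarrow> (\<And>i. i < m \<Longrightarrow> \<bar>y i - \<gamma> t0 i\<bar> < r) \<Longrightarrow> y \<in> B"
        using openin_Euclidean_space_box by blast
      have "\<forall>\<^sub>F t in at t0. \<forall>j\<in>{..<m}. dist (\<gamma> t j) (\<gamma> t0 j) < r"
        using tends r(1) by (intro eventually_ball_finite ballI tendstoD) auto
      then show "\<forall>\<^sub>F t in at t0. dist (Q t) (D k (\<gamma> t0)) < e"
      proof (rule eventually_mono)
        fix t assume t: "\<forall>j\<in>{..<m}. dist (\<gamma> t j) (\<gamma> t0 j) < r"
        let ?S = "closed_segment (\<gamma> t0 k) (\<gamma> t k)"
        have inB: "(p k t)(k := s) \<in> B" if s: "s \<in> ?S" for s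
        proof (rule r(2))
          show "(p k t)(k := s) \<in> topspace (Euclidean_space m)"
            using \<gamma>(2) k by (auto simp: topspace_Euclidean_space p_def)
          have "dist s (\<gamma> t0 k) < r"
            using dist_in_closed_segment[OF s] t k by (metis dist_commute lessThan_iff order_le_less_trans)
          then show "\<bar>((p k t)(k := s)) i - \<gamma> t0 i\<bar> < r" if "i < m" for i
            using t that r(1) by (auto simp: p_def dist_real_def)
        qed
        have close: "dist (D k (\<gamma> t0)) (D k ((p k t)(k := s))) < e / 4" if "s \<in> ?S" for s
          using inB[OF that] by (simp add: B_def del: fun_upd_apply)
        have pkk: "p k t = (p k t)(k := \<gamma> t0 k)" by (rule pk)
        \<comment> \<open>The mean value inequality on the segment: there \<open>D k\<close> varies
          by at most e/2, since both values are within e/4 of the value at \<gamma> t0.\<close>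
        have "norm (f ((p k t)(k := \<gamma> t k)) - f ((p k t)(k := \<gamma> t0 k)) -
            (\<gamma> t k - \<gamma> t0 k) *\<^sub>R D k ((p k t)(k := \<gamma> t0 k)))
            \<le> norm (\<gamma> t k - \<gamma> t0 k) * (e / 2)"
        proof (rule vector_differentiable_bound_linearization[where S = ?S and f = "\<lambda>s. f ((p k t)(k := s))"])
          show "((\<lambda>s. f ((p k t)(k := s))) has_vector_derivative D k ((p k t)(k := s))) (at s within ?S)"
            if "s \<in> ?S" for s
          proof (rule has_vector_derivative_at_within)
            have "(p k t)(k := s) \<in> V" using inB[OF that] by (simp add: B_def)
            from has_partialsD[OF f(1) k this]
            show "((\<lambda>s. f ((p k t)(k := s))) has_vector_derivative D k ((p k t)(k := s))) (at s)" by simp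
          qed
          show "norm (D k ((p k t)(k := s)) - D k ((p k t)(k := \<gamma> t0 k))) \<le> e / 2" if "s \<in> ?S" for s
            using close[OF that] close[of "\<gamma> t0 k"] dist_triangle_half_r[of "D k (\<gamma> t0)" "D k ((p k t)(k := s))" "e/2"]
            by (auto simp: dist_norm[symmetric] intro!: less_imp_le simp del: fun_upd_apply)
        qed auto
        then have le: "norm (f (p (Suc k) t) - f (p k t) - (\<gamma> t k - \<gamma> t0 k) *\<^sub>R D k (p k t))
            \<le> norm (\<gamma> t k - \<gamma> t0 k) * (e / 2)"
          by (simp flip: pk)
        have "dist (Q t) (D k (p k t)) \<le> e / 2"
        proof (cases "\<gamma> t k = \<gamma> t0 k")
          case True
          then show ?thesis using close[of "\<gamma> t0 k"] e by (simp add: Q_def flip: pkk)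
        next
          case False
          then have "Q t - D k (p k t) =
              (f (p (Suc k) t) - f (p k t) - (\<gamma> t k - \<gamma> t0 k) *\<^sub>R D k (p k t)) /\<^sub>R (\<gamma> t k - \<gamma> t0 k)"
            by (simp add: Q_def scaleR_diff_right)
          with le False show ?thesis by (simp only: dist_norm norm_scaleR) (simp add: divide_simps mult.commute)
        qed
        moreover have "dist (D k (\<gamma> t0)) (D k (p k t)) < e / 4"
          using close[of "\<gamma> t0 k"] by (simp flip: pkk)
        ultimately show "dist (Q t) (D k (\<gamma> t0)) < e"
          using dist_triangle2[of "Q t" "D k (\<gamma> t0)" "D k (p k t)"] e by linarith
      qed
    qed
    have "((\<lambda>t. (\<gamma> t k - \<gamma> t0 k) *\<^sub>R Q t) has_vector_derivative d k *\<^sub>R D k (\<gamma> t0)) (at t0)"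
    proof -
      have lin: "((\<lambda>t. (\<gamma> t k - \<gamma> t0 k) / (t - t0)) \<longlongrightarrow> d k) (at t0)"
        using \<gamma>(3)[OF k] unfolding has_real_derivative_iff_has_vector_derivative[symmetric] has_field_derivative_iff .
      have "((\<lambda>t. (\<gamma> t k - \<gamma> t0 k) *\<^sub>R Q t) has_derivative (\<lambda>h. h *\<^sub>R (d k *\<^sub>R D k (\<gamma> t0)))) (at t0)"
        unfolding has_derivative_at2
      proof (intro conjI bounded_linear_scaleR_left)
        have "((\<lambda>t. ((\<gamma> t k - \<gamma> t0 k) / (t - t0)) *\<^sub>R Q t - d k *\<^sub>R D k (\<gamma> t0)) \<longlongrightarrow> 0) (at t0)"
          by (rule tendsto_eq_intros lin Q refl | simp)+
        then have "((\<lambda>t. norm (((\<gamma> t k - \<gamma> t0 k) / (t - t0)) *\<^sub>R Q t - d k *\<^sub>R D k (\<gamma> t0))) \<longlongrightarrow> 0) (at t0)"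
          by (rule tendsto_norm_zero)
        moreover have "\<forall>\<^sub>F t in at t0. norm (((\<gamma> t k - \<gamma> t0 k) / (t - t0)) *\<^sub>R Q t - d k *\<^sub>R D k (\<gamma> t0)) =
          norm ((1 / norm (t - t0)) *\<^sub>R ((\<gamma> t k - \<gamma> t0 k) *\<^sub>R Q t - ((\<gamma> t0 k - \<gamma> t0 k) *\<^sub>R Q t0 + (t - t0) *\<^sub>R d k *\<^sub>R D k (\<gamma> t0))))"
        proof -
          have "norm (((\<gamma> t k - \<gamma> t0 k) / (t - t0)) *\<^sub>R Q t - d k *\<^sub>R D k (\<gamma> t0)) =
            norm ((1 / norm (t - t0)) *\<^sub>R ((\<gamma> t k - \<gamma> t0 k) *\<^sub>R Q t - ((\<gamma> t0 k - \<gamma> t0 k) *\<^sub>R Q t0 + (t - t0) *\<^sub>R d k *\<^sub>R D k (\<gamma> t0))))"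
            if "t \<noteq> t0" for t
          proof -
            have "((\<gamma> t k - \<gamma> t0 k) / (t - t0)) *\<^sub>R Q t - d k *\<^sub>R D k (\<gamma> t0) =
              (1 / (t - t0)) *\<^sub>R ((\<gamma> t k - \<gamma> t0 k) *\<^sub>R Q t - ((\<gamma> t0 k - \<gamma> t0 k) *\<^sub>R Q t0 + (t - t0) *\<^sub>R d k *\<^sub>R D k (\<gamma> t0)))"
              using that by (simp add: scaleR_diff_right)
            then show ?thesis by simp
          qed
          then show ?thesis by (auto simp: eventually_at_filter)
        qed
        ultimately show "((\<lambda>t. (1 / norm (t - t0)) *\<^sub>R ((\<gamma> t k - \<gamma> t0 k) *\<^sub>R Q t -
           ((\<gamma> t0 k - \<gamma> t0 k) *\<^sub>R Q t0 + (t - t0) *\<^sub>R d k *\<^sub>R D k (\<gamma> t0)))) \<longlongrightarrow> 0) (at t0)"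
          by (rule tendsto_norm_zero_cancel[OF Lim_transform_eventually])
      qed
      then show ?thesis by (simp add: has_vector_derivative_def)
    qed
    then show ?case
      using Suc by (simp add: fQ has_vector_derivative_add)
  qed
  from this[of m] have "((\<lambda>t. f (p m t)) has_vector_derivative (\<Sum>j<m. d j *\<^sub>R D j (\<gamma> t0))) (at t0)"
    by simp
  moreover have "p m t = \<gamma> t" for t
    using \<gamma>(2)[of t] \<gamma>(2)[of t0] by (auto simp: p_def topspace_Euclidean_space)
  ultimately show ?thesis by simp
qed

text \<open>Only the coordinates below m are controlled by assumption. The others vanish because F
  takes its values in an open subset of the Euclidean space.\<close>

lemma smooth_between_continuous:
  assumes U: "openin (Euclidean_space n) U" and V: "openin (Euclidean_space m) V"
    and F: "\<And>x. x \<in> U \<Longrightarrow> F x \<in> V" "\<And>j. j < m \<Longrightarrow> continuous_on U (\<lambda>x. F x j)"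
  shows "continuous_on U F"
proof (rule continuous_on_coordinatewise_then_product)
  fix j show "continuous_on U (\<lambda>x. F x j)"
  proof (cases "j < m")
    case False
    then have "F x j = 0" if "x \<in> U" for x using open_subset_Euclidean[OF V F(1)[OF that]] by simp
    then show ?thesis by (simp cong: continuous_on_cong)
  qed (use F in auto)
qed

lemma Ck_on_compose:
  fixes f :: "(nat \<Rightarrow> real) \<Rightarrow> 'v::real_normed_vector"
  assumes U: "openin (Euclidean_space n) U" and V: "openin (Euclidean_space m) V"
    and F: "\<And>x. x \<in> U \<Longrightarrow> F x \<in> V"
  shows "Ck_on m k V f \<Longrightarrow> (\<And>j. j < m \<Longrightarrow> Ck_on n k U (\<lambda>x. F x j)) \<Longrightarrow> Ck_on n k U (\<lambda>x. f (F x))"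
proof (induction k arbitrary: f)
  case 0
  then have "continuous_on V f" "continuous_on U F"
    using smooth_between_continuous[OF U V F] U V by (auto simp: continuous_map_Euclidean_iff)
  then show ?case using U F by (auto simp: continuous_map_Euclidean_iff intro!: continuous_on_compose2[of V f U F])
next
  case (Suc k)
  obtain D where D: "has_partials m V f D" "\<And>j. j < m \<Longrightarrow> Ck_on m k V (D j)"
    using Suc.prems(1) by (rule Ck_on_SucE) blast
  have "\<exists>E. has_partials n U (\<lambda>x. F x j) E \<and> (\<forall>i<n. Ck_on n k U (E i))" if "j < m" for j
    using Suc.prems(2)[OF that] by (rule Ck_on_SucE) blast
  then have "\<exists>E. \<forall>j. j < m \<longrightarrow> has_partials n U (\<lambda>x. F x j) (E j) \<and> (\<forall>i<n. Ck_on n k U (E j i))"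
    by (intro choice) blast
  then obtain E where E: "\<And>j. j < m \<Longrightarrow> has_partials n U (\<lambda>x. F x j) (E j)"
      "\<And>j i. j < m \<Longrightarrow> i < n \<Longrightarrow> Ck_on n k U (E j i)" by blast
  have contF: "continuous_on U F"
    using Ck_on_continuous[OF Suc.prems(2) U] by (intro smooth_between_continuous[OF U V F]) auto
  show ?case
  proof (rule Ck_on_SucI[OF U, where g = "\<lambda>i x. \<Sum>j<m. E j i x *\<^sub>R D j (F x)"])
    show "continuous_on U (\<lambda>x. f (F x))"
      using Ck_on_continuous[OF Suc.prems(1) V] contF F by (auto intro!: continuous_on_compose2[of V f U F])
    show "has_partials n U (\<lambda>x. f (F x)) (\<lambda>i x. \<Sum>j<m. E j i x *\<^sub>R D j (F x))"
      unfolding has_partials_def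
    proof (intro allI impI ballI)
      fix i x assume i: "i < n" and x: "x \<in> U"
      \<comment> \<open>The chain rule for curves needs a curve that stays in the Euclidean space
        for all t. The line through x may leave U; there the curve is given the value at x.\<close>
      define \<gamma> where "\<gamma> t = (if x(i := t) \<in> U then F (x(i := t)) else F x)" for t
      have ev: "\<forall>\<^sub>F t in nhds (x i). x(i := t) \<in> U" using eventually_update_mem[OF U x i] .
      have "((\<lambda>t. f (\<gamma> t)) has_vector_derivative (\<Sum>j<m. E j i x *\<^sub>R D j (\<gamma> (x i)))) (at (x i))"
      proof (rule has_vector_derivative_along_curve[OF V D(1)])
        show "continuous_on V (D j)" if "j < m" for j using D(2)[OF that] V by (rule Ck_on_continuous)
        show "\<gamma> (x i) \<in> V" using x F by (simp add: \<gamma>_def)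
        show "\<gamma> t \<in> topspace (Euclidean_space m)" for t
          using x F openin_subset[OF V] by (auto simp: \<gamma>_def)
        show "((\<lambda>t. \<gamma> t j) has_vector_derivative E j i x) (at (x i))" if "j < m" for j
        proof -
          have "((\<lambda>t. F (x(i := t)) j) has_vector_derivative E j i x) (at (x i))"
            using has_partialsD[OF E(1)[OF that] i x] .
          moreover have "\<forall>\<^sub>F t in nhds (x i). t \<in> UNIV \<longrightarrow> F (x(i := t)) j = \<gamma> t j"
            using ev by (rule eventually_mono) (simp add: \<gamma>_def)
          ultimately show ?thesis
            using x by (subst (asm) has_vector_derivative_cong_ev) (auto simp: \<gamma>_def)
        qed
      qed
      moreover have "\<forall>\<^sub>F t in nhds (x i). t \<in> UNIV \<longrightarrow> f (\<gamma> t) = f (F (x(i := t)))"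
        using ev by (rule eventually_mono) (simp add: \<gamma>_def)
      ultimately show "((\<lambda>t. f (F (x(i := t)))) has_vector_derivative (\<Sum>j<m. E j i x *\<^sub>R D j (F x))) (at (x i))"
        using x by (subst (asm) has_vector_derivative_cong_ev) (auto simp: \<gamma>_def)
    qed
    show "Ck_on n k U (\<lambda>x. \<Sum>j<m. E j i x *\<^sub>R D j (F x))" if "i < n" for i
      using E(2) that D(2) Suc.IH Ck_on_Suc_D[OF U Suc.prems(2)]
      by (intro Ck_on_sum[OF U] Ck_on_scaleR[OF U]) simp_all
  qed
qed

text \<open>For h in a set S closed under differentiation, the derivative of h \<circ> f involves h'
  \<circ> f with h' in S, so the induction runs over all members of S at once. It serves for
  \<open>range flat\<close>.\<close>

lemma Ck_on_compose_real:
  fixes f :: "(nat \<Rightarrow> real) \<Rightarrow> real"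
  assumes U: "openin (Euclidean_space n) U"
    and S: "\<And>h. h \<in> S \<Longrightarrow> \<exists>h'\<in>S. \<forall>t. (h has_real_derivative h' t) (at t)"
  shows "h \<in> S \<Longrightarrow> Ck_on n k U f \<Longrightarrow> Ck_on n k U (\<lambda>x. h (f x))"
proof (induction k arbitrary: h)
  have cont: "continuous_on T h" if "h \<in> S" for h T
    using S[OF that] by (meson DERIV_isCont continuous_at_imp_continuous_on)
  {
    case 0
    then show ?case using U cont[of h UNIV] by (auto simp: continuous_map_Euclidean_iff intro: continuous_on_compose2)
  next
    case (Suc k)
    obtain h' where h': "h' \<in> S" "\<And>t. (h has_real_derivative h' t) (at t)" using S[OF Suc.prems(1)] by blast
    obtain f' where f': "has_partials n U f f'" "\<And>i. i < n \<Longrightarrow> Ck_on n k U (f' i)"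
      using Suc.prems(2) by (rule Ck_on_SucE) blast
    show ?case
    proof (rule Ck_on_SucI[OF U, where g = "\<lambda>i x. f' i x * h' (f x)"])
      show "continuous_on U (\<lambda>x. h (f x))"
        using Ck_on_continuous[OF Suc.prems(2) U] cont[OF Suc.prems(1), of UNIV] by (auto intro: continuous_on_compose2)
      show "has_partials n U (\<lambda>x. h (f x)) (\<lambda>i x. f' i x * h' (f x))"
        unfolding has_partials_def
      proof (intro allI impI ballI)
        fix i x assume "i < n" "x \<in> U"
        then have "((\<lambda>t. f (x(i := t))) has_real_derivative f' i x) (at (x i))"
          using has_partialsD[OF f'(1)] by (simp add: has_real_derivative_iff_has_vector_derivative)
        from DERIV_chain2[OF _ this, of h "h' (f x)"] h'(2)
        show "((\<lambda>t. h (f (x(i := t)))) has_vector_derivative f' i x * h' (f x)) (at (x i))"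
          by (simp add: has_real_derivative_iff_has_vector_derivative mult.commute)
      qed
      show "Ck_on n k U (\<lambda>x. f' i x * h' (f x))" if "i < n" for i
        using f'(2)[OF that] Suc.IH[OF h'(1)] Ck_on_Suc_D[OF U Suc.prems(2)] by (intro Ck_on_mult[OF U]) simp_all
    qed
  }
qed

section \<open>Smooth maps and local diffeomorphisms\<close>

lemma smooth_on_cong:
  "openin (Euclidean_space n) U \<Longrightarrow> smooth_on n U f \<Longrightarrow> (\<And>x. x \<in> U \<Longrightarrow> f x = g x) \<Longrightarrow> smooth_on n U g"
  unfolding smooth_on_def using Ck_on_cong by blast

lemma smooth_on_subset:
  "openin (Euclidean_space n) U \<Longrightarrow> smooth_on n U f \<Longrightarrow> openin (Euclidean_space n) V \<Longrightarrow> V \<subseteq> U \<Longrightarrow> smooth_on n V f"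
  unfolding smooth_on_def using Ck_on_subset by blast

lemma smooth_on_local:
  assumes "openin (Euclidean_space n) U"
    "\<And>x. x \<in> U \<Longrightarrow> \<exists>V. openin (Euclidean_space n) V \<and> x \<in> V \<and> smooth_on n V f"
  shows "smooth_on n U f"
  unfolding smooth_on_def
proof
  fix k show "Ck_on n k U f"
  proof (rule Ck_on_local[OF assms(1)])
    fix x assume "x \<in> U"
    then obtain V where "openin (Euclidean_space n) V" "x \<in> V" "smooth_on n V f" using assms(2) by auto
    then show "\<exists>V. openin (Euclidean_space n) V \<and> x \<in> V \<and> Ck_on n k V f"
      by (intro exI[of _ V]) (simp add: smooth_on_def)
  qed
qed

lemma smooth_on_compose:
  assumes "openin (Euclidean_space n) U" "openin (Euclidean_space m) V"
    "\<And>x. x \<in> U \<Longrightarrow> F x \<in> V" "smooth_on m V f" "smooth_between n m U F"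
  shows "smooth_on n U (\<lambda>x. f (F x))"
  unfolding smooth_on_def
proof
  fix k show "Ck_on n k U (\<lambda>x. f (F x))"
    using assms(4,5) by (rule_tac Ck_on_compose[OF assms(1,2), where F = F and f = f, OF assms(3)])
      (simp_all add: smooth_on_def smooth_between_def)
qed

lemma smooth_between_cong:
  "openin (Euclidean_space n) U \<Longrightarrow> smooth_between n m U F \<Longrightarrow> (\<And>x. x \<in> U \<Longrightarrow> F x = G x) \<Longrightarrow>
    smooth_between n m U G"
  unfolding smooth_between_def by (metis (no_types, lifting) smooth_on_cong)

lemma smooth_between_subset:
  "openin (Euclidean_space n) U \<Longrightarrow> smooth_between n m U F \<Longrightarrow> openin (Euclidean_space n) V \<Longrightarrow> V \<subseteq> U \<Longrightarrow>
    smooth_between n m V F"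
  unfolding smooth_between_def by (metis (no_types, lifting) smooth_on_subset)

lemma smooth_between_local:
  assumes "openin (Euclidean_space n) U"
    "\<And>x. x \<in> U \<Longrightarrow> \<exists>V. openin (Euclidean_space n) V \<and> x \<in> V \<and> smooth_between n m V F"
  shows "smooth_between n m U F"
  unfolding smooth_between_def
proof (intro allI impI)
  fix j assume j: "j < m"
  show "smooth_on n U (\<lambda>x. F x j)"
  proof (rule smooth_on_local[OF assms(1)])
    fix x assume "x \<in> U"
    then obtain V where "openin (Euclidean_space n) V" "x \<in> V" "smooth_between n m V F" using assms(2) by auto
    then show "\<exists>V. openin (Euclidean_space n) V \<and> x \<in> V \<and> smooth_on n V (\<lambda>x. F x j)"
      using j by (intro exI[of _ V]) (simp add: smooth_between_def)
  qed
qed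

lemma smooth_between_compose:
  assumes "openin (Euclidean_space n) U" "openin (Euclidean_space m) V"
    "\<And>x. x \<in> U \<Longrightarrow> F x \<in> V" "smooth_between m l V G" "smooth_between n m U F"
  shows "smooth_between n l U (\<lambda>x. G (F x))"
  unfolding smooth_between_def
proof (intro allI impI)
  fix j assume "j < l"
  then have "smooth_on m V (\<lambda>x. G x j)" using assms(4) by (simp add: smooth_between_def)
  then show "smooth_on n U (\<lambda>x. G (F x) j)"
    using assms(3) by (rule_tac smooth_on_compose[OF assms(1,2) _ _ assms(5)]) auto
qed

lemma smooth_between_id: "openin (Euclidean_space n) U \<Longrightarrow> smooth_between n n U (\<lambda>x. x)"
  by (simp add: smooth_between_def smooth_on_def Ck_on_coordinate)

section \<open>Charts\<close>

lemma chart: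
  assumes "smooth_manifold X" "(U, \<phi>) \<in> atlas X"
  shows chart_open: "openin (mtop X) U"
    and chart_image_open: "openin (Euclidean_space (mdim X)) (\<phi> ` U)"
    and chart_homeo: "homeomorphic_map (subtopology (mtop X) U) (subtopology (Euclidean_space (mdim X)) (\<phi> ` U)) \<phi>"
  using assms by (auto simp: smooth_manifold_def)

lemma atlas_cover: "smooth_manifold X \<Longrightarrow> x \<in> points X \<Longrightarrow> \<exists>U \<phi>. (U, \<phi>) \<in> atlas X \<and> x \<in> U"
  unfolding smooth_manifold_def by blast

lemma chart_transition:
  assumes "smooth_manifold X" "(U, \<phi>) \<in> atlas X" "(V, \<psi>) \<in> atlas X"
  shows "smooth_between (mdim X) (mdim X) (\<phi> ` (U \<inter> V)) (\<psi> \<circ> inv_into U \<phi>)"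
proof -
  have "\<forall>(U, \<phi>) \<in> atlas X. \<forall>(V, \<psi>) \<in> atlas X.
       smooth_between (mdim X) (mdim X) (\<phi> ` (U \<inter> V)) (\<psi> \<circ> inv_into U \<phi>)"
    using assms(1) by (simp add: smooth_manifold_def)
  from bspec[OF this assms(2)] show ?thesis using assms(3) by auto
qed

lemma chart_inj: "smooth_manifold X \<Longrightarrow> (U, \<phi>) \<in> atlas X \<Longrightarrow> inj_on \<phi> U"
  using homeomorphic_imp_injective_map[OF chart_homeo] chart_open[of X U \<phi>]
  by (metis Int_absorb1 openin_subset topspace_subtopology)

lemma chart_subset_open:
  assumes "smooth_manifold X" "(U, \<phi>) \<in> atlas X" "openin (mtop X) W" "W \<subseteq> U"
  shows "openin (Euclidean_space (mdim X)) (\<phi> ` W)"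
proof -
  have "openin (subtopology (mtop X) U) W"
    using assms by (metis chart_open openin_open_subtopology)
  then have "openin (subtopology (Euclidean_space (mdim X)) (\<phi> ` U)) (\<phi> ` W)"
    using homeomorphic_imp_open_map[OF chart_homeo[OF assms(1,2)]] unfolding open_map_def by blast
  then show ?thesis
    using openin_trans_full chart_image_open[OF assms(1,2)] by blast
qed

lemma chart_continuous:
  "smooth_manifold X \<Longrightarrow> (U, \<phi>) \<in> atlas X \<Longrightarrow>
    continuous_map (subtopology (mtop X) U) (Euclidean_space (mdim X)) \<phi>"
  using homeomorphic_imp_continuous_map[OF chart_homeo] continuous_map_into_fulltopology by blast

lemma chart_inv_continuous:
  assumes "smooth_manifold X" "(U, \<phi>) \<in> atlas X"
  shows "continuous_map (subtopology (Euclidean_space (mdim X)) (\<phi> ` U)) (mtop X) (inv_into U \<phi>)"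
  unfolding continuous_map_def
proof (intro conjI allI impI)
  have U: "U \<subseteq> points X" using chart_open[OF assms] openin_subset by blast
  then show "inv_into U \<phi> \<in> topspace (subtopology (Euclidean_space (mdim X)) (\<phi> ` U)) \<rightarrow> points X"
    by (auto intro!: subsetD[OF U] inv_into_into)
  fix W assume W: "openin (mtop X) W"
  have "{x \<in> topspace (subtopology (Euclidean_space (mdim X)) (\<phi> ` U)). inv_into U \<phi> x \<in> W} = \<phi> ` (U \<inter> W)"
    using chart_inj[OF assms] openin_subset[OF chart_image_open[OF assms]] by (auto simp: inv_into_f_f)
  moreover have "openin (Euclidean_space (mdim X)) (\<phi> ` (U \<inter> W))"
    using W chart_open[OF assms] by (intro chart_subset_open[OF assms]) auto
  ultimately show "openin (subtopology (Euclidean_space (mdim X)) (\<phi> ` U))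
      {x \<in> topspace (subtopology (Euclidean_space (mdim X)) (\<phi> ` U)). inv_into U \<phi> x \<in> W}"
    by (metis Int_lower1 chart_image_open[OF assms] image_mono openin_open_subtopology)
qed

text \<open>\<open>smooth_map\<close> tests all pairs of charts; here one pair near x is enough,
  which is easier to establish and to compose. Mapping N into one chart domain of Y builds in what
  continuity requires. That the choice of the pair does not matter is the content of
  \<open>smooth_at_charts\<close>.\<close>

definition smooth_at :: "'p manifold \<Rightarrow> 'q manifold \<Rightarrow> ('p \<Rightarrow> 'q) \<Rightarrow> 'p \<Rightarrow> bool"
  where "smooth_at X Y f x \<longleftrightarrow> (\<exists>N U \<phi> V \<psi>. openin (mtop X) N \<and> x \<in> N \<and> N \<subseteq> U \<and>
    (U, \<phi>) \<in> atlas X \<and> (V, \<psi>) \<in> atlas Y \<and> f ` N \<subseteq> V \<and>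
    smooth_between (mdim X) (mdim Y) (\<phi> ` N) (\<psi> \<circ> f \<circ> inv_into U \<phi>))"

lemma smooth_at_cong:
  assumes X: "smooth_manifold X" and f: "smooth_at X Y f x"
    and N: "openin (mtop X) N" "x \<in> N" "\<And>z. z \<in> N \<Longrightarrow> f z = g z"
  shows "smooth_at X Y g x"
proof -
  obtain N' U \<phi> V \<psi> where *: "openin (mtop X) N'" "x \<in> N'" "N' \<subseteq> U" "(U, \<phi>) \<in> atlas X" "(V, \<psi>) \<in> atlas Y"
    "f ` N' \<subseteq> V" "smooth_between (mdim X) (mdim Y) (\<phi> ` N') (\<psi> \<circ> f \<circ> inv_into U \<phi>)"
    using f unfolding smooth_at_def by blast
  have o: "openin (Euclidean_space (mdim X)) (\<phi> ` N')" "openin (Euclidean_space (mdim X)) (\<phi> ` (N \<inter> N'))"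
    using chart_subset_open[OF X *(4)] * N by auto
  have s: "smooth_between (mdim X) (mdim Y) (\<phi> ` (N \<inter> N')) (\<psi> \<circ> f \<circ> inv_into U \<phi>)"
    using smooth_between_subset[OF o(1) *(7) o(2)] by blast
  have eq: "f (inv_into U \<phi> z) = g (inv_into U \<phi> z)" if "z \<in> \<phi> ` (N \<inter> N')" for z
    using that N(3) *(3) chart_inj[OF X *(4)] by (auto simp: inv_into_f_f subset_iff)
  have "smooth_between (mdim X) (mdim Y) (\<phi> ` (N \<inter> N')) (\<psi> \<circ> g \<circ> inv_into U \<phi>)"
    by (rule smooth_between_cong[OF o(2) s]) (simp add: eq)
  moreover have "g ` (N \<inter> N') \<subseteq> V" using N(3) *(6) by force
  ultimately show ?thesis
    unfolding smooth_at_def using N * by (intro exI[of _ "N \<inter> N'"] exI[of _ U] exI[of _ \<phi>] exI[of _ V] exI[of _ \<psi>]) auto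
qed

text \<open>Near x the map is a chart, followed by the coordinate expression, followed by an inverse
  chart, and each of the three is continuous.\<close>

lemma smooth_at_continuous_near:
  assumes X: "smooth_manifold X" and Y: "smooth_manifold Y" and f: "smooth_at X Y f x"
  shows "\<exists>N. openin (mtop X) N \<and> x \<in> N \<and> continuous_map (subtopology (mtop X) N) (mtop Y) f"
proof -
  obtain N U \<phi> V \<psi> where *: "openin (mtop X) N" "x \<in> N" "N \<subseteq> U" "(U, \<phi>) \<in> atlas X" "(V, \<psi>) \<in> atlas Y"
    "f ` N \<subseteq> V" "smooth_between (mdim X) (mdim Y) (\<phi> ` N) (\<psi> \<circ> f \<circ> inv_into U \<phi>)"
    using f unfolding smooth_at_def by blast
  let ?E = "Euclidean_space (mdim X)" and ?F = "Euclidean_space (mdim Y)"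
  have o: "openin ?E (\<phi> ` N)" using chart_subset_open[OF X *(4)] * by auto
  have inv: "inv_into U \<phi> (\<phi> z) = z" if "z \<in> U" for z using chart_inj[OF X *(4)] that by simp
  let ?h = "\<psi> \<circ> f \<circ> inv_into U \<phi>"
  have into: "?h z \<in> \<psi> ` V" if "z \<in> \<phi> ` N" for z using that inv * by (auto simp: image_subset_iff subset_iff)
  have "continuous_on (\<phi> ` N) ?h"
  proof (rule smooth_between_continuous[OF o chart_image_open[OF Y *(5)] into])
    fix j assume "j < mdim Y"
    then have "Ck_on (mdim X) 0 (\<phi> ` N) (\<lambda>x. ?h x j)"
      using *(7) unfolding smooth_between_def smooth_on_def by blast
    then show "continuous_on (\<phi> ` N) (\<lambda>x. ?h x j)" using o by (rule Ck_on_continuous)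
  qed
  then have "continuous_map (subtopology ?E (\<phi> ` N)) euclidean ?h" using o by (simp add: continuous_map_Euclidean_iff)
  moreover have "?h \<in> topspace (subtopology ?E (\<phi> ` N)) \<rightarrow> \<psi> ` V" using into by auto
  moreover have sub: "subtopology ?F (\<psi> ` V) = top_of_set (\<psi> ` V)"
    using openin_subset[OF chart_image_open[OF Y *(5)]]
    by (simp add: Euclidean_space_eq subtopology_subtopology Int_absorb1)
  ultimately have h: "continuous_map (subtopology ?E (\<phi> ` N)) (subtopology ?F (\<psi> ` V)) ?h"
    by (simp add: continuous_map_in_subtopology image_subset_iff_funcset)
  have "continuous_map (subtopology (mtop X) N) ?E \<phi>"
    using chart_continuous[OF X *(4)] *(3) continuous_map_from_subtopology_mono by blast
  then have p: "continuous_map (subtopology (mtop X) N) (subtopology ?E (\<phi> ` N)) \<phi>"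
    by (auto simp: continuous_map_in_subtopology)
  have "continuous_map (subtopology (mtop X) N) (mtop Y) (inv_into V \<psi> \<circ> ?h \<circ> \<phi>)"
    by (rule continuous_map_compose[OF p continuous_map_compose[OF h chart_inv_continuous[OF Y *(5)]]])
  moreover have "(inv_into V \<psi> \<circ> ?h \<circ> \<phi>) z = f z" if "z \<in> N" for z
    using that inv *(3,6) chart_inj[OF Y *(5)] by (auto simp: subset_iff image_subset_iff)
  ultimately have "continuous_map (subtopology (mtop X) N) (mtop Y) f"
    by (elim continuous_map_eq) auto
  then show ?thesis using * by blast
qed

lemma smooth_at_continuous:
  assumes X: "smooth_manifold X" and Y: "smooth_manifold Y" and U: "openin (mtop X) U"
    and f: "\<And>x. x \<in> U \<Longrightarrow> smooth_at X Y f x"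
  shows "continuous_map (subtopology (mtop X) U) (mtop Y) f"
proof -
  have "\<exists>N. x \<in> U \<longrightarrow> openin (mtop X) N \<and> x \<in> N \<and> continuous_map (subtopology (mtop X) N) (mtop Y) f" for x
    using smooth_at_continuous_near[OF X Y f] by blast
  then obtain N where N: "\<And>x. x \<in> U \<Longrightarrow> openin (mtop X) (N x) \<and> x \<in> N x \<and> continuous_map (subtopology (mtop X) (N x)) (mtop Y) f"
    by metis
  show ?thesis
  proof (rule pasting_lemma[where I = U and T = "\<lambda>x. N x \<inter> U" and f = "\<lambda>_. f"])
    fix i assume i: "i \<in> U"
    show "openin (subtopology (mtop X) U) (N i \<inter> U)" using N[OF i] by (auto simp: openin_subtopology)
    show "continuous_map (subtopology (subtopology (mtop X) U) (N i \<inter> U)) (mtop Y) f"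
      using N[OF i] unfolding subtopology_subtopology
      by (elim conjE continuous_map_from_subtopology_mono) auto
  qed (use N in auto)
qed

text \<open>The expression in the given charts is the known one between two chart transitions.
  Continuity of \<open>f\<close> shrinks the neighbourhood until its image lies in both chart
  domains of Y.\<close>

lemma smooth_at_charts:
  assumes X: "smooth_manifold X" and Y: "smooth_manifold Y" and f: "smooth_at X Y f x"
    and c: "(U, \<phi>) \<in> atlas X" "x \<in> U" "(V, \<psi>) \<in> atlas Y" "f x \<in> V"
  shows "\<exists>N. openin (mtop X) N \<and> x \<in> N \<and> N \<subseteq> U \<and> f ` N \<subseteq> V \<and>
    smooth_between (mdim X) (mdim Y) (\<phi> ` N) (\<psi> \<circ> f \<circ> inv_into U \<phi>)"
proof -
  obtain N0 U0 \<phi>0 V0 \<psi>0 where *: "openin (mtop X) N0" "x \<in> N0" "N0 \<subseteq> U0" "(U0, \<phi>0) \<in> atlas X" "(V0, \<psi>0) \<in> atlas Y"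
    "f ` N0 \<subseteq> V0" "smooth_between (mdim X) (mdim Y) (\<phi>0 ` N0) (\<psi>0 \<circ> f \<circ> inv_into U0 \<phi>0)"
    using f unfolding smooth_at_def by blast
  obtain N1 where N1: "openin (mtop X) N1" "x \<in> N1" "continuous_map (subtopology (mtop X) N1) (mtop Y) f"
    using smooth_at_continuous_near[OF X Y f] by blast
  define N2 where "N2 = {z \<in> points X \<inter> N1. f z \<in> V}"
  have "openin (subtopology (mtop X) N1) N2"
    unfolding N2_def using openin_continuous_map_preimage[OF N1(3) chart_open[OF Y c(3)]] by simp
  then have N2: "openin (mtop X) N2" using N1(1) openin_trans_full by blast
  have x2: "x \<in> N2" unfolding N2_def using N1 c(4) openin_subset by fastforce
  define N where "N = N0 \<inter> N2 \<inter> U"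
  have N: "openin (mtop X) N" "x \<in> N" "N \<subseteq> U" "N \<subseteq> U0" "N \<subseteq> N0"
    unfolding N_def using * N2 x2 chart_open[OF X c(1)] c by auto
  have fN: "f ` N \<subseteq> V \<inter> V0" unfolding N_def N2_def using *(6) by auto
  let ?E = "Euclidean_space (mdim X)" and ?F = "Euclidean_space (mdim Y)"
  note oU = chart_subset_open[OF X c(1)] and oU0 = chart_subset_open[OF X *(4)]
  note oV0 = chart_subset_open[OF Y *(5)]
  have i: "inv_into U \<phi> (\<phi> z) = z" if "z \<in> N" for z using chart_inj[OF X c(1)] that N by auto
  have i0: "inv_into U0 \<phi>0 (\<phi>0 z) = z" if "z \<in> N0" for z using chart_inj[OF X *(4)] that * by auto
  have j0: "inv_into V0 \<psi>0 (\<psi>0 z) = z" if "z \<in> V0" for z using chart_inj[OF Y *(5)] that by auto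
  have s1: "smooth_between (mdim X) (mdim X) (\<phi> ` N) (\<phi>0 \<circ> inv_into U \<phi>)"
    using smooth_between_subset[OF oU chart_transition[OF X c(1) *(4)]] N oU chart_open[OF X *(4)] chart_open[OF X c(1)]
    by (metis Int_greatest Int_lower1 image_mono openin_Int)
  have s2: "smooth_between (mdim X) (mdim Y) (\<phi> ` N) (\<lambda>z. (\<psi>0 \<circ> f \<circ> inv_into U0 \<phi>0) ((\<phi>0 \<circ> inv_into U \<phi>) z))"
    using N oU oU0 * i by (intro smooth_between_compose[OF _ _ _ *(7) s1]) (auto simp: subset_iff)
  have s3: "smooth_between (mdim X) (mdim Y) (\<phi> ` N)
      (\<lambda>z. (\<psi> \<circ> inv_into V0 \<psi>0) ((\<psi>0 \<circ> f \<circ> inv_into U0 \<phi>0) ((\<phi>0 \<circ> inv_into U \<phi>) z)))"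
  proof (rule smooth_between_compose[OF _ _ _ chart_transition[OF Y *(5) c(3)] s2])
    show "openin ?E (\<phi> ` N)" using oU N by simp
    show "openin ?F (\<psi>0 ` (V0 \<inter> V))" using oV0 chart_open[OF Y *(5)] chart_open[OF Y c(3)] by blast
    show "(\<psi>0 \<circ> f \<circ> inv_into U0 \<phi>0) ((\<phi>0 \<circ> inv_into U \<phi>) z) \<in> \<psi>0 ` (V0 \<inter> V)" if z: "z \<in> \<phi> ` N" for z
    proof -
      obtain w where w: "w \<in> N" "z = \<phi> w" using z by auto
      then have "w \<in> N0" "f w \<in> V0 \<inter> V" using N fN by auto
      then show ?thesis using w i i0 by auto
    qed
  qed
  have "smooth_between (mdim X) (mdim Y) (\<phi> ` N) (\<psi> \<circ> f \<circ> inv_into U \<phi>)"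
  proof (rule smooth_between_cong[OF _ s3])
    show "openin ?E (\<phi> ` N)" using oU N by simp
    fix z assume "z \<in> \<phi> ` N"
    then obtain w where w: "w \<in> N" "z = \<phi> w" by auto
    then have "w \<in> N0" "f w \<in> V0" using N fN by auto
    then show "(\<psi> \<circ> inv_into V0 \<psi>0) ((\<psi>0 \<circ> f \<circ> inv_into U0 \<phi>0) ((\<phi>0 \<circ> inv_into U \<phi>) z)) = (\<psi> \<circ> f \<circ> inv_into U \<phi>) z"
      using w i i0 j0 by simp
  qed
  then show ?thesis using N(1-3) fN by (intro exI[of _ N]) simp
qed

lemma smooth_at_point: "smooth_manifold X \<Longrightarrow> smooth_at X Y f x \<Longrightarrow> x \<in> points X"
  unfolding smooth_at_def using openin_subset by blast

lemma smooth_at_image_point: "smooth_manifold Y \<Longrightarrow> smooth_at X Y f x \<Longrightarrow> f x \<in> points Y"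
  unfolding smooth_at_def using chart_open openin_subset by blast

lemma smooth_at_compose:
  assumes X: "smooth_manifold X" and Y: "smooth_manifold Y" and Z: "smooth_manifold Z"
    and f: "smooth_at X Y f x" and g: "smooth_at Y Z g (f x)"
  shows "smooth_at X Z (\<lambda>x. g (f x)) x"
proof -
  obtain U \<phi> where c: "(U, \<phi>) \<in> atlas X" "x \<in> U" using atlas_cover[OF X smooth_at_point[OF X f]] by blast
  obtain V \<psi> where d: "(V, \<psi>) \<in> atlas Y" "f x \<in> V" using atlas_cover[OF Y smooth_at_image_point[OF Y f]] by blast
  obtain W \<theta> where e: "(W, \<theta>) \<in> atlas Z" "g (f x) \<in> W" using atlas_cover[OF Z smooth_at_image_point[OF Z g]] by blast
  obtain N1 where N1: "openin (mtop X) N1" "x \<in> N1" "N1 \<subseteq> U" "f ` N1 \<subseteq> V"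
    "smooth_between (mdim X) (mdim Y) (\<phi> ` N1) (\<psi> \<circ> f \<circ> inv_into U \<phi>)"
    using smooth_at_charts[OF X Y f c d] by blast
  obtain N2 where N2: "openin (mtop Y) N2" "f x \<in> N2" "N2 \<subseteq> V" "g ` N2 \<subseteq> W"
    "smooth_between (mdim Y) (mdim Z) (\<psi> ` N2) (\<theta> \<circ> g \<circ> inv_into V \<psi>)"
    using smooth_at_charts[OF Y Z g d e] by blast
  obtain N3 where N3: "openin (mtop X) N3" "x \<in> N3" "continuous_map (subtopology (mtop X) N3) (mtop Y) f"
    using smooth_at_continuous_near[OF X Y f] by blast
  define N where "N = N1 \<inter> {z \<in> points X \<inter> N3. f z \<in> N2}"
  have "openin (subtopology (mtop X) N3) {z \<in> points X \<inter> N3. f z \<in> N2}"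
    using openin_continuous_map_preimage[OF N3(3) N2(1)] by simp
  then have "openin (mtop X) N" unfolding N_def using N1(1) N3(1) openin_trans_full by blast
  moreover have "x \<in> N" unfolding N_def using N1 N2 N3 smooth_at_point[OF X f] by simp
  moreover have "N \<subseteq> N1" "f ` N \<subseteq> N2" unfolding N_def by auto
  ultimately have N: "openin (mtop X) N" "x \<in> N" "N \<subseteq> N1" "f ` N \<subseteq> N2" by auto
  have o: "openin (Euclidean_space (mdim X)) (\<phi> ` N)" "openin (Euclidean_space (mdim X)) (\<phi> ` N1)"
      "openin (Euclidean_space (mdim Y)) (\<psi> ` N2)"
    using chart_subset_open[OF X c(1)] chart_subset_open[OF Y d(1)] N N1 N2 by auto
  have i: "inv_into U \<phi> (\<phi> z) = z" if "z \<in> N" for z using chart_inj[OF X c(1)] that N N1 by auto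
  have j: "inv_into V \<psi> (\<psi> z) = z" if "z \<in> V" for z using chart_inj[OF Y d(1)] that by auto
  have s1: "smooth_between (mdim X) (mdim Y) (\<phi> ` N) (\<psi> \<circ> f \<circ> inv_into U \<phi>)"
    using smooth_between_subset[OF o(2) N1(5) o(1)] N by blast
  have s2: "smooth_between (mdim X) (mdim Z) (\<phi> ` N)
      (\<lambda>z. (\<theta> \<circ> g \<circ> inv_into V \<psi>) ((\<psi> \<circ> f \<circ> inv_into U \<phi>) z))"
    using i N by (intro smooth_between_compose[OF o(1) o(3) _ N2(5) s1]) auto
  have "smooth_between (mdim X) (mdim Z) (\<phi> ` N) (\<theta> \<circ> (\<lambda>x. g (f x)) \<circ> inv_into U \<phi>)"
  proof (rule smooth_between_cong[OF o(1) s2])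
    fix z assume "z \<in> \<phi> ` N"
    then obtain w where "w \<in> N" "z = \<phi> w" by auto
    moreover have "f w \<in> V" using \<open>w \<in> N\<close> N N2 by auto
    ultimately show "(\<theta> \<circ> g \<circ> inv_into V \<psi>) ((\<psi> \<circ> f \<circ> inv_into U \<phi>) z) = (\<theta> \<circ> (\<lambda>x. g (f x)) \<circ> inv_into U \<phi>) z"
      using i j by simp
  qed
  moreover have "(\<lambda>x. g (f x)) ` N \<subseteq> W" using N(4) N2(4) by (force simp: image_subset_iff)
  ultimately show ?thesis
    unfolding smooth_at_def using N N1 c e
    by (intro exI[of _ N] exI[of _ U] exI[of _ \<phi>] exI[of _ W] exI[of _ \<theta>]) auto
qed

lemma smooth_map_iff:
  assumes X: "smooth_manifold X" and Y: "smooth_manifold Y"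
  shows "smooth_map X Y f \<longleftrightarrow> (\<forall>x \<in> points X. smooth_at X Y f x)"
proof
  assume f: "smooth_map X Y f"
  then have cont: "continuous_map (mtop X) (mtop Y) f" by (simp add: smooth_map_def)
  show "\<forall>x \<in> points X. smooth_at X Y f x"
  proof
    fix x assume x: "x \<in> points X"
    then have "f x \<in> points Y" using cont by (auto simp: continuous_map_def)
    obtain U \<phi> where c: "(U, \<phi>) \<in> atlas X" "x \<in> U" using atlas_cover[OF X x] by blast
    obtain V \<psi> where d: "(V, \<psi>) \<in> atlas Y" "f x \<in> V" using atlas_cover[OF Y \<open>f x \<in> points Y\<close>] by blast
    have "U \<subseteq> points X" using openin_subset chart_open[OF X c(1)] by blast
    then have "U \<inter> f -` V = U \<inter> {z \<in> points X. f z \<in> V}" by auto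
    then have "openin (mtop X) (U \<inter> f -` V)"
      using openin_continuous_map_preimage[OF cont chart_open[OF Y d(1)]] chart_open[OF X c(1)] by auto
    moreover have "smooth_between (mdim X) (mdim Y) (\<phi> ` (U \<inter> f -` V)) (\<psi> \<circ> f \<circ> inv_into U \<phi>)"
      using f c d unfolding smooth_map_def by blast
    ultimately show "smooth_at X Y f x"
      unfolding smooth_at_def using c d
      by (intro exI[of _ "U \<inter> f -` V"] exI[of _ U] exI[of _ \<phi>] exI[of _ V] exI[of _ \<psi>]) auto
  qed
next
  assume f: "\<forall>x \<in> points X. smooth_at X Y f x"
  have cont: "continuous_map (mtop X) (mtop Y) f"
    using smooth_at_continuous[OF X Y openin_topspace] f by (simp add: subtopology_topspace)
  have "smooth_between (mdim X) (mdim Y) (\<phi> ` (U \<inter> f -` V)) (\<psi> \<circ> f \<circ> inv_into U \<phi>)"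
    if c: "(U, \<phi>) \<in> atlas X" and d: "(V, \<psi>) \<in> atlas Y" for U \<phi> V \<psi>
  proof (rule smooth_between_local)
    have U: "U \<subseteq> points X" using openin_subset chart_open[OF X c(1)] by blast
    then have "U \<inter> f -` V = U \<inter> {z \<in> points X. f z \<in> V}" by auto
    then have "openin (mtop X) (U \<inter> f -` V)"
      using openin_continuous_map_preimage[OF cont chart_open[OF Y d(1)]] chart_open[OF X c(1)] by auto
    then show "openin (Euclidean_space (mdim X)) (\<phi> ` (U \<inter> f -` V))"
      by (intro chart_subset_open[OF X c]) auto
    fix z assume "z \<in> \<phi> ` (U \<inter> f -` V)"
    then obtain x where x: "x \<in> U" "f x \<in> V" "z = \<phi> x" by auto
    obtain N where N: "openin (mtop X) N" "x \<in> N" "N \<subseteq> U" "f ` N \<subseteq> V"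
      "smooth_between (mdim X) (mdim Y) (\<phi> ` N) (\<psi> \<circ> f \<circ> inv_into U \<phi>)"
      using smooth_at_charts[where f = f and x = x, OF X Y _ c x(1) d x(2)] f U x(1) by blast
    then show "\<exists>N. openin (Euclidean_space (mdim X)) N \<and> z \<in> N \<and> smooth_between (mdim X) (mdim Y) N (\<psi> \<circ> f \<circ> inv_into U \<phi>)"
      using x chart_subset_open[OF X c] by blast
  qed
  then show "smooth_map X Y f" unfolding smooth_map_def using cont by blast
qed

text \<open>Open submanifolds, the spectral sheaf and the space of composable pairs all carry a smooth
  structure pulled back along an open continuous map that is injective on the chart domains.\<close>

lemma pullback_manifold:
  assumes Y: "smooth_manifold Y" and p: "continuous_map (mtop X) (mtop Y) p" "open_map (mtop X) (mtop Y) p"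
    and dim: "mdim X = mdim Y" and cover: "points X \<subseteq> (\<Union>(S, \<theta>)\<in>atlas X. S)"
    and atlas: "\<And>S \<theta>. (S, \<theta>) \<in> atlas X \<Longrightarrow> openin (mtop X) S \<and> inj_on p S \<and>
      (\<exists>U \<phi>. (U, \<phi>) \<in> atlas Y \<and> p ` S \<subseteq> U \<and> \<theta> = \<phi> \<circ> p)"
  shows pullback_smooth_manifold: "smooth_manifold X"
    and pullback_smooth_at: "x \<in> points X \<Longrightarrow> smooth_at X Y p x"
    and pullback_smooth_at_inv: "openin (mtop X) T \<Longrightarrow> inj_on p T \<Longrightarrow> y \<in> p ` T \<Longrightarrow> smooth_at Y X (inv_into T p) y"
proof -
  let ?E = "Euclidean_space (mdim Y)"
  have op: "openin (mtop Y) (p ` T)" if "openin (mtop X) T" for T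
    using p(2) that unfolding open_map_def by blast
  have inj: "inj_on \<theta> S" if S: "(S, \<theta>) \<in> atlas X" for S \<theta>
  proof -
    obtain U \<phi> where *: "inj_on p S" "(U, \<phi>) \<in> atlas Y" "p ` S \<subseteq> U" "\<theta> = \<phi> \<circ> p" using atlas[OF S] by blast
    show ?thesis unfolding *(4) using *(1) chart_inj[OF Y *(2)] *(3) by (meson comp_inj_on inj_on_subset)
  qed
  have img: "openin ?E (\<theta> ` T)" if S: "(S, \<theta>) \<in> atlas X" and T: "openin (mtop X) T" "T \<subseteq> S" for S \<theta> T
  proof -
    obtain U \<phi> where *: "(U, \<phi>) \<in> atlas Y" "p ` S \<subseteq> U" "\<theta> = \<phi> \<circ> p" using atlas[OF S] by blast
    have "openin ?E (\<phi> ` (p ` T))" using * T op by (intro chart_subset_open[OF Y *(1)]) auto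
    then show ?thesis by (simp add: *(3) image_comp)
  qed
  have A: "openin (mtop X) S \<and> openin (Euclidean_space (mdim X)) (\<theta> ` S) \<and>
      homeomorphic_map (subtopology (mtop X) S) (subtopology (Euclidean_space (mdim X)) (\<theta> ` S)) \<theta>"
    if S: "(S, \<theta>) \<in> atlas X" for S \<theta>
  proof -
    obtain U \<phi> where *: "openin (mtop X) S" "(U, \<phi>) \<in> atlas Y" "p ` S \<subseteq> U" "\<theta> = \<phi> \<circ> p"
      using atlas[OF S] by blast
    have sub: "S \<subseteq> points X" using * openin_subset by blast
    have oS: "openin ?E (\<theta> ` S)" using img[OF S] * by blast
    have "homeomorphic_map (subtopology (mtop X) S) (subtopology ?E (\<theta> ` S)) \<theta>"
    proof (rule bijective_open_imp_homeomorphic_map)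
      have "continuous_map (subtopology (mtop X) S) (mtop Y) p"
        using p(1) by (rule continuous_map_from_subtopology)
      then have "continuous_map (subtopology (mtop X) S) (subtopology (mtop Y) U) p"
        using *(3) by (auto simp: continuous_map_in_subtopology)
      then have "continuous_map (subtopology (mtop X) S) ?E \<theta>"
        unfolding *(4) using chart_continuous[OF Y *(2)] by (rule continuous_map_compose)
      then show "continuous_map (subtopology (mtop X) S) (subtopology ?E (\<theta> ` S)) \<theta>"
        by (auto simp: continuous_map_in_subtopology)
      show "open_map (subtopology (mtop X) S) (subtopology ?E (\<theta> ` S)) \<theta>"
        unfolding open_map_def
      proof (intro allI impI)
        fix T assume "openin (subtopology (mtop X) S) T"
        then have "openin (mtop X) T" "T \<subseteq> S" using openin_open_subtopology[OF *(1)] by auto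
        then show "openin (subtopology ?E (\<theta> ` S)) (\<theta> ` T)"
          using img[OF S] openin_open_subtopology[OF oS] by blast
      qed
      show "\<theta> ` topspace (subtopology (mtop X) S) = topspace (subtopology ?E (\<theta> ` S))"
        using sub openin_subset[OF oS] by (simp add: Int_absorb1 Int_absorb2)
      show "inj_on \<theta> (topspace (subtopology (mtop X) S))"
        using inj[OF S] by (auto intro: inj_on_subset)
    qed
    then show ?thesis
      using *(1) oS dim by simp
  qed
  have "S \<subseteq> points X" if "(S, \<theta>) \<in> atlas X" for S \<theta> using atlas[OF that] openin_subset by blast
  then have B: "(\<Union>(S, \<theta>)\<in>atlas X. S) = points X" using cover by auto
  have C: "smooth_between (mdim X) (mdim X) (\<theta> ` (S \<inter> S')) (\<theta>' \<circ> inv_into S \<theta>)"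
    if S: "(S, \<theta>) \<in> atlas X" and S': "(S', \<theta>') \<in> atlas X" for S \<theta> S' \<theta>'
  proof -
    obtain U \<phi> where *: "openin (mtop X) S" "(U, \<phi>) \<in> atlas Y" "p ` S \<subseteq> U" "\<theta> = \<phi> \<circ> p"
      using atlas[OF S] by blast
    obtain U' \<phi>' where **: "openin (mtop X) S'" "(U', \<phi>') \<in> atlas Y" "p ` S' \<subseteq> U'" "\<theta>' = \<phi>' \<circ> p"
      using atlas[OF S'] by blast
    have o: "openin ?E (\<theta> ` (S \<inter> S'))" using * ** by (intro img[OF S]) auto
    have o2: "openin ?E (\<phi> ` (U \<inter> U'))"
      using chart_open[OF Y *(2)] chart_open[OF Y **(2)] by (intro chart_subset_open[OF Y *(2)]) auto
    have s: "smooth_between (mdim Y) (mdim Y) (\<theta> ` (S \<inter> S')) (\<phi>' \<circ> inv_into U \<phi>)"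
    proof (rule smooth_between_subset[OF o2 chart_transition[OF Y *(2) **(2)] o])
      have "p ` (S \<inter> S') \<subseteq> U \<inter> U'" using * ** by blast
      then show "\<theta> ` (S \<inter> S') \<subseteq> \<phi> ` (U \<inter> U')" unfolding *(4) image_comp[symmetric] by (rule image_mono)
    qed
    have "smooth_between (mdim Y) (mdim Y) (\<theta> ` (S \<inter> S')) (\<theta>' \<circ> inv_into S \<theta>)"
    proof (rule smooth_between_cong[OF o s])
      fix z assume "z \<in> \<theta> ` (S \<inter> S')"
      then obtain w where w: "w \<in> S" "z = \<theta> w" by auto
      then have "inv_into S \<theta> z = w" "inv_into U \<phi> z = p w"
        using inv_into_f_f[OF inj[OF S] w(1)] chart_inj[OF Y *(2)] * by (auto simp: image_subset_iff)
      then show "(\<phi>' \<circ> inv_into U \<phi>) z = (\<theta>' \<circ> inv_into S \<theta>) z" using **(4) by simp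
    qed
    then show ?thesis by (simp add: dim)
  qed
  show X: "smooth_manifold X"
    unfolding smooth_manifold_def
  proof (intro conjI)
    show "\<forall>(S, \<theta>)\<in>atlas X. openin (mtop X) S \<and> openin (Euclidean_space (mdim X)) (\<theta> ` S) \<and>
      homeomorphic_map (subtopology (mtop X) S) (subtopology (Euclidean_space (mdim X)) (\<theta> ` S)) \<theta>"
      by (clarify) (rule A)
    show "\<forall>(S, \<theta>)\<in>atlas X. \<forall>(S', \<theta>')\<in>atlas X.
      smooth_between (mdim X) (mdim X) (\<theta> ` (S \<inter> S')) (\<theta>' \<circ> inv_into S \<theta>)"
      by (clarify) (rule C)
  qed (rule B)
  have ex: "\<exists>S \<theta>. (S, \<theta>) \<in> atlas X \<and> x \<in> S" if "x \<in> points X" for x using atlas_cover[OF X that] .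
  show "smooth_at X Y p x" if x: "x \<in> points X"
  proof -
    obtain S \<theta> where S: "(S, \<theta>) \<in> atlas X" "x \<in> S" using ex[OF x] by blast
    obtain U \<phi> where *: "openin (mtop X) S" "(U, \<phi>) \<in> atlas Y" "p ` S \<subseteq> U" "\<theta> = \<phi> \<circ> p"
      using atlas[OF S(1)] by blast
    have o: "openin ?E (\<theta> ` S)" using img[OF S(1)] * by blast
    \<comment> \<open>In the charts \<phi> \<circ> p and \<phi> the map p is the identity, and so is
      its local inverse below.\<close>
    have "smooth_between (mdim Y) (mdim Y) (\<theta> ` S) (\<phi> \<circ> p \<circ> inv_into S \<theta>)"
    proof (rule smooth_between_cong[OF o smooth_between_id[OF o]])
      fix z assume "z \<in> \<theta> ` S"
      then obtain w where w: "w \<in> S" "z = \<theta> w" by auto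
      then have "inv_into S \<theta> z = w" using inj[OF S(1)] by simp
      then show "z = (\<phi> \<circ> p \<circ> inv_into S \<theta>) z" using w *(4) by simp
    qed
    then show ?thesis unfolding smooth_at_def dim using S *
      by (intro exI[of _ S] exI[of _ S] exI[of _ \<theta>] exI[of _ U] exI[of _ \<phi>]) auto
  qed
  show "smooth_at Y X (inv_into T p) y" if T: "openin (mtop X) T" "inj_on p T" "y \<in> p ` T"
  proof -
    obtain x where x: "x \<in> T" "y = p x" using T by blast
    then have "x \<in> points X" using T openin_subset by blast
    then obtain S \<theta> where S: "(S, \<theta>) \<in> atlas X" "x \<in> S" using ex by blast
    obtain U \<phi> where *: "openin (mtop X) S" "(U, \<phi>) \<in> atlas Y" "p ` S \<subseteq> U" "\<theta> = \<phi> \<circ> p"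
      using atlas[OF S(1)] by blast
    define N where "N = p ` (S \<inter> T)"
    have N: "openin (mtop Y) N" "y \<in> N" "N \<subseteq> U" unfolding N_def using op * T x S by auto
    have o: "openin ?E (\<phi> ` N)" using chart_subset_open[OF Y *(2) N(1,3)] .
    have "smooth_between (mdim Y) (mdim Y) (\<phi> ` N) (\<theta> \<circ> inv_into T p \<circ> inv_into U \<phi>)"
    proof (rule smooth_between_cong[OF o smooth_between_id[OF o]])
      fix z assume "z \<in> \<phi> ` N"
      then obtain w where w: "w \<in> S" "w \<in> T" "z = \<phi> (p w)" by (auto simp: N_def)
      then have "inv_into U \<phi> z = p w" "inv_into T p (p w) = w"
        using chart_inj[OF Y *(2)] *(3) T(2) by (auto simp: image_subset_iff)
      then show "z = (\<theta> \<circ> inv_into T p \<circ> inv_into U \<phi>) z" using w *(4) by simp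
    qed
    moreover have "inv_into T p ` N \<subseteq> S" using T(2) by (auto simp: N_def)
    ultimately show ?thesis unfolding smooth_at_def dim using S * N
      by (intro exI[of _ N] exI[of _ U] exI[of _ \<phi>] exI[of _ S] exI[of _ \<theta>]) auto
  qed
qed

lemma points_open_submanifold: "U \<subseteq> points X \<Longrightarrow> points (open_submanifold X U) = U"
  by (simp add: open_submanifold_def Int_absorb1)

text \<open>The inclusion of an open set is continuous, open and injective, and the charts of the
  open submanifold are restrictions of charts of X; so this is a case of the pullback
  construction.\<close>

lemma
  assumes X: "smooth_manifold X" and U: "openin (mtop X) U"
  shows smooth_manifold_open_submanifold: "smooth_manifold (open_submanifold X U)"
    and smooth_at_inclusion: "x \<in> U \<Longrightarrow> smooth_at (open_submanifold X U) X (\<lambda>x. x) x"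
    and smooth_at_into_open_submanifold: "x \<in> U \<Longrightarrow> smooth_at X (open_submanifold X U) (\<lambda>x. x) x"
proof -
  let ?S = "open_submanifold X U"
  have sub: "U \<subseteq> points X" using U openin_subset by blast
  have p: "continuous_map (mtop ?S) (mtop X) (\<lambda>x. x)"
    by (simp add: open_submanifold_def continuous_map_from_subtopology)
  have o: "open_map (mtop ?S) (mtop X) (\<lambda>x. x)"
    using U by (auto simp: open_submanifold_def open_map_def openin_open_subtopology)
  have dim: "mdim ?S = mdim X" by (simp add: open_submanifold_def)
  have cover: "points ?S \<subseteq> (\<Union>(S, \<theta>)\<in>atlas ?S. S)"
  proof
    fix x assume "x \<in> points ?S"
    then have x: "x \<in> U" using points_open_submanifold[OF sub] by simp
    then obtain V \<phi> where "(V, \<phi>) \<in> atlas X" "x \<in> V" using atlas_cover[OF X] sub by blast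
    then show "x \<in> (\<Union>(S, \<theta>)\<in>atlas ?S. S)" using x by (force simp: open_submanifold_def)
  qed
  have at: "openin (mtop ?S) S \<and> inj_on (\<lambda>x. x) S \<and>
      (\<exists>U \<phi>. (U, \<phi>) \<in> atlas X \<and> (\<lambda>x. x) ` S \<subseteq> U \<and> \<theta> = \<phi> \<circ> (\<lambda>x. x))"
    if st: "(S, \<theta>) \<in> atlas ?S" for S \<theta>
  proof -
    obtain V where V: "(V, \<theta>) \<in> atlas X" "S = V \<inter> U" using st by (auto simp: open_submanifold_def)
    then have "openin (mtop ?S) S"
      using chart_open[OF X V(1)] U by (auto simp: open_submanifold_def openin_open_subtopology)
    then show ?thesis using V by (auto simp: o_def)
  qed
  note L = pullback_manifold[OF X p o dim cover at]
  show "smooth_manifold ?S" by (rule L(1))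
  show "smooth_at ?S X (\<lambda>x. x) x" if "x \<in> U" using L(2) that points_open_submanifold[OF sub] by simp
  show "smooth_at X ?S (\<lambda>x. x) x" if x: "x \<in> U"
  proof (rule smooth_at_cong[OF X _ U x])
    show "smooth_at X ?S (inv_into U (\<lambda>x. x)) x"
      using x U by (intro L(3)) (auto simp: open_submanifold_def openin_open_subtopology)
    show "inv_into U (\<lambda>x. x) z = z" if "z \<in> U" for z using inv_into_f_f[of "\<lambda>x. x" U z] that by simp
  qed
qed

lemma smooth_at_open_submanifold_iff:
  assumes X: "smooth_manifold X" and Y: "smooth_manifold Y" and U: "openin (mtop X) U" and V: "openin (mtop Y) V"
    and x: "x \<in> U" "f x \<in> V"
  shows "smooth_at (open_submanifold X U) (open_submanifold Y V) f x \<longleftrightarrow> smooth_at X Y f x"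
proof
  note sX = smooth_manifold_open_submanifold[OF X U] and sY = smooth_manifold_open_submanifold[OF Y V]
  assume f: "smooth_at (open_submanifold X U) (open_submanifold Y V) f x"
  from smooth_at_compose[OF sX sY Y f smooth_at_inclusion[OF Y V x(2)]]
  have "smooth_at (open_submanifold X U) Y f x" .
  from smooth_at_compose[OF X sX Y smooth_at_into_open_submanifold[OF X U x(1)] this]
  show "smooth_at X Y f x" .
next
  note sX = smooth_manifold_open_submanifold[OF X U] and sY = smooth_manifold_open_submanifold[OF Y V]
  assume f: "smooth_at X Y f x"
  from smooth_at_compose[OF X Y sY f smooth_at_into_open_submanifold[OF Y V x(2)]]
  have "smooth_at X (open_submanifold Y V) f x" .
  from smooth_at_compose[OF sX X sY smooth_at_inclusion[OF X U x(1)] this]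
  show "smooth_at (open_submanifold X U) (open_submanifold Y V) f x" .
qed

text \<open>Trades the submanifolds in \<open>diffeomorphism\<close> for smoothness at points of the
  ambient manifolds, where maps can be composed and restricted without changing the carrier.\<close>

lemma diffeomorphism_open_submanifold_iff:
  assumes X: "smooth_manifold X" and Y: "smooth_manifold Y" and U: "openin (mtop X) U" and V: "openin (mtop Y) V"
  shows "diffeomorphism (open_submanifold X U) (open_submanifold Y V) f \<longleftrightarrow>
    bij_betw f U V \<and> (\<forall>x\<in>U. smooth_at X Y f x) \<and> (\<forall>y\<in>V. smooth_at Y X (inv_into U f) y)"
proof -
  note sX = smooth_manifold_open_submanifold[OF X U] and sY = smooth_manifold_open_submanifold[OF Y V]
  have pU: "points (open_submanifold X U) = U" and pV: "points (open_submanifold Y V) = V"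
    using points_open_submanifold[OF openin_subset[OF U]] points_open_submanifold[OF openin_subset[OF V]] by simp_all
  have "smooth_at (open_submanifold X U) (open_submanifold Y V) f x \<longleftrightarrow> smooth_at X Y f x"
    if "bij_betw f U V" "x \<in> U" for x
    using bij_betwE[OF that(1)] that(2) by (intro smooth_at_open_submanifold_iff[OF X Y U V that(2)]) simp
  moreover have "smooth_at (open_submanifold Y V) (open_submanifold X U) (inv_into U f) y \<longleftrightarrow> smooth_at Y X (inv_into U f) y"
    if "bij_betw f U V" "y \<in> V" for y
    using bij_betwE[OF bij_betw_inv_into[OF that(1)]] that(2)
    by (intro smooth_at_open_submanifold_iff[OF Y X V U that(2)]) simp
  ultimately show ?thesis
    unfolding diffeomorphism_def smooth_map_iff[OF sX sY] smooth_map_iff[OF sY sX] pU pV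
    by (cases "bij_betw f U V") simp_all
qed

text \<open>What \<open>local_diffeomorphism\<close> asks of one neighbourhood, freed of
  \<open>open_submanifold\<close>. Composition, inversion and cancellation are proved for such
  pieces.\<close>

definition etale_on :: "'p manifold \<Rightarrow> 'q manifold \<Rightarrow> ('p \<Rightarrow> 'q) \<Rightarrow> 'p set \<Rightarrow> bool"
  where "etale_on X Y f U \<longleftrightarrow> openin (mtop X) U \<and> inj_on f U \<and> openin (mtop Y) (f ` U) \<and>
    (\<forall>x\<in>U. smooth_at X Y f x) \<and> (\<forall>y\<in>f ` U. smooth_at Y X (inv_into U f) y)"

lemma local_diffeomorphism_iff:
  assumes X: "smooth_manifold X" and Y: "smooth_manifold Y"
  shows "local_diffeomorphism X Y f \<longleftrightarrow> (\<forall>x \<in> points X. \<exists>U. x \<in> U \<and> etale_on X Y f U)"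
proof -
  have "openin (mtop X) U \<and> openin (mtop Y) (f ` U) \<and>
      diffeomorphism (open_submanifold X U) (open_submanifold Y (f ` U)) f \<longleftrightarrow> etale_on X Y f U" for U
    using diffeomorphism_open_submanifold_iff[OF X Y, of U "f ` U" f]
    unfolding etale_on_def bij_betw_def by blast
  then show ?thesis unfolding local_diffeomorphism_def by (metis (no_types, lifting))
qed

lemma etale_on_continuous:
  assumes "smooth_manifold X" "smooth_manifold Y" "etale_on X Y f U"
  shows "continuous_map (subtopology (mtop X) U) (mtop Y) f"
  using smooth_at_continuous[OF assms(1,2)] assms(3) unfolding etale_on_def by blast

lemma etale_on_open_image:
  assumes X: "smooth_manifold X" and Y: "smooth_manifold Y" and f: "etale_on X Y f U"
    and V: "openin (mtop X) V" "V \<subseteq> U"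
  shows "openin (mtop Y) (f ` V)"
proof -
  have inj: "inj_on f U" and o: "openin (mtop Y) (f ` U)" using f by (auto simp: etale_on_def)
  have c: "continuous_map (subtopology (mtop Y) (f ` U)) (mtop X) (inv_into U f)"
    using f unfolding etale_on_def by (intro smooth_at_continuous[OF Y X o]) blast
  have "{y \<in> topspace (subtopology (mtop Y) (f ` U)). inv_into U f y \<in> V} = f ` V"
    using V(2) inj openin_subset[OF o] by auto
  then have "openin (subtopology (mtop Y) (f ` U)) (f ` V)"
    using openin_continuous_map_preimage[OF c V(1)] by simp
  then show ?thesis using o openin_trans_full by blast
qed

lemma etale_on_subset:
  assumes X: "smooth_manifold X" and Y: "smooth_manifold Y" and f: "etale_on X Y f U"
    and V: "openin (mtop X) V" "V \<subseteq> U"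
  shows "etale_on X Y f V"
  unfolding etale_on_def
proof (intro conjI ballI)
  have inj: "inj_on f U" using f by (auto simp: etale_on_def)
  show "openin (mtop X) V" by fact
  show "inj_on f V" using inj V(2) by (rule inj_on_subset)
  show o: "openin (mtop Y) (f ` V)" by (rule etale_on_open_image[OF assms])
  show "smooth_at X Y f x" if "x \<in> V" for x using f that V(2) by (auto simp: etale_on_def)
  show "smooth_at Y X (inv_into V f) y" if "y \<in> f ` V" for y
  proof (rule smooth_at_cong[OF Y _ o that])
    show "smooth_at Y X (inv_into U f) y" using f that V(2) by (auto simp: etale_on_def)
    fix z assume "z \<in> f ` V"
    then show "inv_into U f z = inv_into V f z"
      using inj \<open>inj_on f V\<close> V(2) by (auto simp: subset_iff)
  qed
qed

lemma etale_on_cong: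
  assumes X: "smooth_manifold X" and f: "etale_on X Y f U" and eq: "\<And>x. x \<in> U \<Longrightarrow> f x = g x"
  shows "etale_on X Y g U"
proof -
  have "g ` U = f ` U" using eq by force
  moreover have "inj_on g U" using f eq by (auto simp: etale_on_def inj_on_def)
  moreover have "inv_into U g = inv_into U f" using eq by (auto simp: inv_into_def fun_eq_iff intro!: arg_cong[of _ _ Eps])
  moreover have "smooth_at X Y g x" if "x \<in> U" for x
    using f that eq by (intro smooth_at_cong[OF X, of _ f x U g]) (auto simp: etale_on_def)
  ultimately show ?thesis using f by (simp add: etale_on_def)
qed

lemma etale_on_compose:
  assumes X: "smooth_manifold X" and Y: "smooth_manifold Y" and Z: "smooth_manifold Z"
    and f: "etale_on X Y f U" and g: "etale_on Y Z g V" and sub: "f ` U \<subseteq> V"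
  shows "etale_on X Z (\<lambda>x. g (f x)) U"
  unfolding etale_on_def
proof (intro conjI ballI)
  have fi: "inj_on f U" "openin (mtop Y) (f ` U)" using f by (auto simp: etale_on_def)
  have g': "etale_on Y Z g (f ` U)" using etale_on_subset[OF Y Z g fi(2) sub] .
  then have gi: "inj_on g (f ` U)" by (simp add: etale_on_def)
  show "openin (mtop X) U" using f by (simp add: etale_on_def)
  show i: "inj_on (\<lambda>x. g (f x)) U" using comp_inj_on[OF fi(1) gi] by (simp add: o_def)
  show o: "openin (mtop Z) ((\<lambda>x. g (f x)) ` U)" using g' by (simp add: etale_on_def image_image)
  show "smooth_at X Z (\<lambda>x. g (f x)) x" if "x \<in> U" for x
    using f g' that by (intro smooth_at_compose[OF X Y Z, of f x g]) (auto simp: etale_on_def)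
  show "smooth_at Z X (inv_into U (\<lambda>x. g (f x))) y" if y: "y \<in> (\<lambda>x. g (f x)) ` U" for y
  proof (rule smooth_at_cong[OF Z _ o y])
    have "inv_into (f ` U) g y \<in> f ` U" using y by (intro inv_into_into) auto
    then show "smooth_at Z X (\<lambda>z. inv_into U f (inv_into (f ` U) g z)) y"
      using f g' y by (intro smooth_at_compose[OF Z Y X, of "inv_into (f ` U) g" y "inv_into U f"]) (auto simp: etale_on_def)
    fix z assume "z \<in> (\<lambda>x. g (f x)) ` U"
    then obtain w where "w \<in> U" "z = g (f w)" by auto
    then show "inv_into U f (inv_into (f ` U) g z) = inv_into U (\<lambda>x. g (f x)) z"
      using fi gi inv_into_f_f[OF i, of w] by simp
  qed
qed

lemma etale_on_inv:
  assumes X: "smooth_manifold X" and Y: "smooth_manifold Y" and f: "etale_on X Y f U"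
  shows "etale_on Y X (inv_into U f) (f ` U)"
  unfolding etale_on_def
proof (intro conjI ballI)
  have fi: "inj_on f U" "openin (mtop Y) (f ` U)" using f by (auto simp: etale_on_def)
  have im: "inv_into U f ` (f ` U) = U" using fi by force
  have iU: "openin (mtop X) U" using f by (simp add: etale_on_def)
  show "openin (mtop Y) (f ` U)" by fact
  show "inj_on (inv_into U f) (f ` U)" by (simp add: inj_on_inv_into)
  show "openin (mtop X) (inv_into U f ` (f ` U))" using iU im by simp
  show "smooth_at Y X (inv_into U f) y" if "y \<in> f ` U" for y using f that by (auto simp: etale_on_def)
  show "smooth_at X Y (inv_into (f ` U) (inv_into U f)) x" if "x \<in> inv_into U f ` (f ` U)" for x
  proof (rule smooth_at_cong[OF X _ iU])
    show "x \<in> U" using that im by simp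
    then show "smooth_at X Y f x" using f by (simp add: etale_on_def)
    fix z assume "z \<in> U"
    then show "f z = inv_into (f ` U) (inv_into U f) z"
      by (intro inv_into_f_eq[symmetric] inj_on_inv_into) (use fi in auto)
  qed
qed

text \<open>On U the map is p followed by the inverse of q on V.\<close>

lemma etale_on_cancel:
  assumes X: "smooth_manifold X" and Y: "smooth_manifold Y" and Z: "smooth_manifold Z"
    and p: "etale_on X Y p U" and q: "etale_on Z Y q V" and f: "f ` U \<subseteq> V" "\<And>x. x \<in> U \<Longrightarrow> q (f x) = p x"
  shows "etale_on X Z f U"
proof (rule etale_on_cong[OF X])
  have qi: "inj_on q V" using q by (simp add: etale_on_def)
  show "etale_on X Z (\<lambda>x. inv_into V q (p x)) U"
    by (rule etale_on_compose[OF X Y Z p etale_on_inv[OF Z Y q]]) (use f in force)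
  show "inv_into V q (p x) = f x" if "x \<in> U" for x
    using f that qi by (intro inv_into_f_eq) auto
qed

lemma local_diffeomorphism_compose:
  assumes X: "smooth_manifold X" and Y: "smooth_manifold Y" and Z: "smooth_manifold Z"
    and f: "local_diffeomorphism X Y f" and g: "local_diffeomorphism Y Z g"
  shows "local_diffeomorphism X Z (\<lambda>x. g (f x))"
  unfolding local_diffeomorphism_iff[OF X Z]
proof
  fix x assume "x \<in> points X"
  then obtain U where U: "x \<in> U" "etale_on X Y f U" using f unfolding local_diffeomorphism_iff[OF X Y] by blast
  have oU: "openin (mtop X) U" using U by (simp add: etale_on_def)
  have "f x \<in> points Y" using U by (intro smooth_at_image_point[OF Y, of X]) (simp add: etale_on_def)
  then obtain V where V: "f x \<in> V" "etale_on Y Z g V" using g unfolding local_diffeomorphism_iff[OF Y Z] by blast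
  then have oV: "openin (mtop Y) V" by (simp add: etale_on_def)
  define W where "W = {z \<in> topspace (subtopology (mtop X) U). f z \<in> V}"
  have "openin (subtopology (mtop X) U) W"
    unfolding W_def by (rule openin_continuous_map_preimage[OF etale_on_continuous[OF X Y U(2)] oV])
  then have W: "openin (mtop X) W" "W \<subseteq> U" using oU openin_open_subtopology by blast+
  have "x \<in> W" using U V openin_subset[OF oU] by (auto simp: W_def)
  moreover have "etale_on X Z (\<lambda>x. g (f x)) W"
    by (rule etale_on_compose[OF X Y Z etale_on_subset[OF X Y U(2) W] V(2)]) (auto simp: W_def)
  ultimately show "\<exists>W. x \<in> W \<and> etale_on X Z (\<lambda>x. g (f x)) W" by blast
qed

text \<open>Continuity makes \<open>f\<close> stay, near x, in one piece V on which q is injective;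
  this is all that the cancellation on pieces requires.\<close>

lemma local_diffeomorphism_cancel:
  assumes X: "smooth_manifold X" and Y: "smooth_manifold Y" and Z: "smooth_manifold Z"
    and p: "local_diffeomorphism X Y p" and q: "local_diffeomorphism Z Y q"
    and f: "continuous_map (mtop X) (mtop Z) f" "\<And>x. x \<in> points X \<Longrightarrow> q (f x) = p x"
  shows "local_diffeomorphism X Z f"
  unfolding local_diffeomorphism_iff[OF X Z]
proof
  fix x assume x: "x \<in> points X"
  then obtain U where U: "x \<in> U" "etale_on X Y p U" using p unfolding local_diffeomorphism_iff[OF X Y] by blast
  have oU: "openin (mtop X) U" using U by (simp add: etale_on_def)
  have "f x \<in> points Z" using f(1) x by (auto simp: continuous_map_def)
  then obtain V where V: "f x \<in> V" "etale_on Z Y q V" using q unfolding local_diffeomorphism_iff[OF Z Y] by blast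
  then have oV: "openin (mtop Z) V" by (simp add: etale_on_def)
  define W where "W = U \<inter> {z \<in> points X. f z \<in> V}"
  have W: "openin (mtop X) W" "W \<subseteq> U"
    unfolding W_def using openin_continuous_map_preimage[OF f(1) oV] oU by auto
  have "x \<in> W" using U V x by (simp add: W_def)
  moreover have "etale_on X Z f W"
  proof (rule etale_on_cancel[OF X Y Z etale_on_subset[OF X Y U(2) W] V(2)])
    show "f ` W \<subseteq> V" by (auto simp: W_def)
    show "q (f x) = p x" if "x \<in> W" for x using that f(2) by (simp add: W_def)
  qed
  ultimately show "\<exists>W. x \<in> W \<and> etale_on X Z f W" by blast
qed

lemma local_diffeomorphism_smooth_map:
  assumes X: "smooth_manifold X" and Y: "smooth_manifold Y" and f: "local_diffeomorphism X Y f"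
  shows "smooth_map X Y f"
  using f unfolding smooth_map_iff[OF X Y] local_diffeomorphism_iff[OF X Y] etale_on_def by blast

lemma local_diffeomorphism_continuous:
  assumes "smooth_manifold X" "smooth_manifold Y" "local_diffeomorphism X Y f"
  shows "continuous_map (mtop X) (mtop Y) f"
  using local_diffeomorphism_smooth_map[OF assms] by (simp add: smooth_map_def)

lemma pullback_local_diffeomorphism:
  assumes Y: "smooth_manifold Y" and p: "continuous_map (mtop X) (mtop Y) p" "open_map (mtop X) (mtop Y) p"
    and dim: "mdim X = mdim Y" and cover: "points X \<subseteq> (\<Union>(S, \<theta>)\<in>atlas X. S)"
    and atlas: "\<And>S \<theta>. (S, \<theta>) \<in> atlas X \<Longrightarrow> openin (mtop X) S \<and> inj_on p S \<and>
      (\<exists>U \<phi>. (U, \<phi>) \<in> atlas Y \<and> p ` S \<subseteq> U \<and> \<theta> = \<phi> \<circ> p)"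
  shows "local_diffeomorphism X Y p"
proof -
  have X: "smooth_manifold X" by (rule pullback_smooth_manifold[OF Y p dim cover atlas])
  show ?thesis
    unfolding local_diffeomorphism_iff[OF X Y]
  proof
    fix x assume x: "x \<in> points X"
    then obtain S \<theta> where S: "(S, \<theta>) \<in> atlas X" "x \<in> S" using cover by auto
    have S': "openin (mtop X) S" "inj_on p S" using atlas[OF S(1)] by auto
    have "etale_on X Y p S"
      unfolding etale_on_def
    proof (intro conjI ballI S')
      show "openin (mtop Y) (p ` S)" using p(2) S' by (simp add: open_map_def)
      show "smooth_at X Y p x" if "x \<in> S" for x using that openin_subset[OF S'(1)]
        by (intro pullback_smooth_at[OF Y p dim cover atlas]) auto
      show "smooth_at Y X (inv_into S p) y" if "y \<in> p ` S" for y using S' that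
        by (intro pullback_smooth_at_inv[OF Y p dim cover atlas]) auto
    qed
    then show "\<exists>U. x \<in> U \<and> etale_on X Y p U" using S by blast
  qed
qed

section \<open>Smooth functions with compact support\<close>

text \<open>Smoothness of \<open>exp (- 1 / t)\<close> at \<open>0\<close> follows because these functions are closed under
  differentiation.\<close>

definition flat :: "real poly \<Rightarrow> real \<Rightarrow> real"
  where "flat p t = (if t > 0 then poly p (inverse t) * exp (- inverse t) else 0)"

lemma poly_times_exp_tendsto_0: "((\<lambda>u::real. poly p u * exp (- u)) \<longlongrightarrow> 0) at_top"
proof -
  have "((\<lambda>u::real. \<Sum>i\<le>degree p. coeff p i * (u ^ i / exp u)) \<longlongrightarrow> (\<Sum>i\<le>degree p. coeff p i * 0)) at_top"
    by (intro tendsto_sum tendsto_mult tendsto_const tendsto_power_div_exp_0)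
  then show ?thesis by (simp add: poly_altdef sum_distrib_right exp_minus divide_inverse mult.assoc)
qed

text \<open>For t > 0 the derivative of p(u) exp(-u) with u = 1/t is u^2 (p(u) - p'(u)) exp(-u);
  \<open>monom 1 2\<close> is the factor u^2.\<close>

lemma flat_derivative: "(flat p has_real_derivative flat (monom 1 2 * (p - pderiv p)) t) (at t)"
proof -
  consider "t > 0" | "t < 0" | "t = 0" by linarith
  then show ?thesis
  proof cases
    case 1
    have "((\<lambda>t. poly p (inverse t) * exp (- inverse t)) has_real_derivative
        flat (monom 1 2 * (p - pderiv p)) t) (at t)"
      using 1 by (auto simp: flat_def poly_monom power2_eq_square field_simps
        intro!: derivative_eq_intros DERIV_chain2[OF poly_DERIV])
    moreover have "\<forall>\<^sub>F s in nhds t. s > 0" using 1 by (intro eventually_nhds_in_open[of "{0<..}", simplified]) auto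
    then have "\<forall>\<^sub>F s in nhds t. flat p s = poly p (inverse s) * exp (- inverse s)"
      by (rule eventually_mono) (simp add: flat_def)
    ultimately show ?thesis by (subst DERIV_cong_ev[OF HOL.refl _ HOL.refl])
  next
    case 2
    then have "\<forall>\<^sub>F s in nhds t. s < 0" by (intro eventually_nhds_in_open[of "{..<0}", simplified]) auto
    then have "\<forall>\<^sub>F s in nhds t. flat p s = 0"
      by (rule eventually_mono) (simp add: flat_def)
    then show ?thesis using 2 by (subst DERIV_cong_ev[OF HOL.refl _ HOL.refl]) (auto simp: flat_def)
  next
    case 3
    \<comment> \<open>The right difference quotient at 0 is u p(u) exp(-u) with u = 1/s, and
      \<open>pCons 0 p\<close> is the polynomial u p(u).\<close>
    have "((\<lambda>s. poly (pCons 0 p) (inverse s) * exp (- inverse s)) \<longlongrightarrow> 0) (at_right 0)"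
      by (rule filterlim_compose[OF poly_times_exp_tendsto_0 filterlim_inverse_at_top_right])
    then have "((\<lambda>s. (flat p s - flat p 0) / (s - 0)) \<longlongrightarrow> 0) (at_right 0)"
      by (rule Lim_transform_eventually)
        (auto simp: flat_def eventually_at_filter divide_inverse intro!: always_eventually)
    moreover have "((\<lambda>s. (flat p s - flat p 0) / (s - 0)) \<longlongrightarrow> 0) (at_left 0)"
      by (rule Lim_transform_eventually[OF tendsto_const])
        (auto simp: flat_def eventually_at_filter intro!: always_eventually)
    ultimately have "((\<lambda>s. (flat p s - flat p 0) / (s - 0)) \<longlongrightarrow> 0) (at 0)"
      by (simp add: filterlim_split_at)
    then show ?thesis unfolding 3 has_field_derivative_iff by (simp add: flat_def)
  qed
qed

text \<open>\<open>flat 1\<close> is exp(-1/t), continued by 0. The denominator is positive since t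
  and 1 - t are never both at most 0.\<close>

definition smooth_step :: "real \<Rightarrow> real"
  where "smooth_step t = flat 1 t * inverse (flat 1 t + flat 1 (1 - t))"

lemma smooth_step_eq: "t \<le> 0 \<Longrightarrow> smooth_step t = 0" "t \<ge> 1 \<Longrightarrow> smooth_step t = 1"
  by (auto simp: smooth_step_def flat_def)

lemma Ck_on_step:
  assumes U: "openin (Euclidean_space n) U" and u: "Ck_on n k U u"
  shows "Ck_on n k U (\<lambda>x. smooth_step (u x))"
proof -
  have S: "\<exists>h'\<in>range flat. \<forall>t. (h has_real_derivative h' t) (at t)" if "h \<in> range flat" for h
    using that flat_derivative by blast
  have fl: "Ck_on n k U (\<lambda>x. flat 1 (v x))" if "Ck_on n k U v" for v
    using Ck_on_compose_real[OF U S _ that] by blast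
  have "Ck_on n k U (\<lambda>x. 1 + (- 1) * u x)"
    by (intro Ck_on_add[OF U] Ck_on_mult[OF U] Ck_on_const[OF U] u)
  then have v: "Ck_on n k U (\<lambda>x. flat 1 (1 - u x))" using fl by fastforce
  have "flat 1 s \<ge> 0" for s by (simp add: flat_def)
  moreover have "flat 1 s > 0 \<or> flat 1 (1 - s) > 0" for s by (auto simp: flat_def)
  ultimately have "flat 1 s + flat 1 (1 - s) \<noteq> 0" for s by (metis add_nonneg_eq_0_iff less_irrefl)
  then show ?thesis
    unfolding smooth_step_def by (intro Ck_on_mult[OF U] Ck_on_inverse[OF U] Ck_on_add[OF U] fl u v)
qed

lemma Ck_on_prod:
  fixes f :: "'j \<Rightarrow> (nat \<Rightarrow> real) \<Rightarrow> 'v::{real_normed_algebra, comm_ring_1}"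
  assumes U: "openin (Euclidean_space n) U"
  shows "(\<And>j. j \<in> J \<Longrightarrow> Ck_on n k U (f j)) \<Longrightarrow> Ck_on n k U (\<lambda>x. \<Prod>j\<in>J. f j x)"
  by (induction J rule: infinite_finite_induct) (auto intro: Ck_on_mult[OF U] Ck_on_const[OF U])

text \<open>A product of one-dimensional plateaus: with u = (x i - y i)/r, the constant 2 makes the
  i-th factor 1 for \<bar>u\<bar> \<le> 1 and 0 for \<bar>u\<bar> \<ge> 2.\<close>

definition box_bump :: "nat \<Rightarrow> (nat \<Rightarrow> real) \<Rightarrow> real \<Rightarrow> (nat \<Rightarrow> real) \<Rightarrow> real"
  where "box_bump n y r x = (\<Prod>i<n. smooth_step (2 - (x i - y i) / r) * smooth_step (2 + (x i - y i) / r))"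

lemma box_bump_eq_1:
  assumes "r > 0" "\<And>i. i < n \<Longrightarrow> \<bar>x i - y i\<bar> < r"
  shows "box_bump n y r x = 1"
  unfolding box_bump_def
proof (intro prod.neutral ballI)
  fix i assume "i \<in> {..<n}"
  then have "\<bar>(x i - y i) / r\<bar> < 1" using assms by simp
  then show "smooth_step (2 - (x i - y i) / r) * smooth_step (2 + (x i - y i) / r) = 1"
    by (subst (1 2) smooth_step_eq(2)) linarith+
qed

lemma box_bump_nonzero:
  assumes "r > 0" "box_bump n y r x \<noteq> 0" "i < n"
  shows "\<bar>x i - y i\<bar> \<le> 2 * r"
proof (rule ccontr)
  assume "\<not> ?thesis"
  then have "(x i - y i) / r \<ge> 2 \<or> (x i - y i) / r \<le> - 2" using assms(1) by (auto simp: field_simps abs_if split: if_splits)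
  then have "smooth_step (2 - (x i - y i) / r) * smooth_step (2 + (x i - y i) / r) = 0" using smooth_step_eq(1) by auto
  then show False using assms(2,3) unfolding box_bump_def by auto
qed

lemma smooth_on_box_bump:
  assumes U: "openin (Euclidean_space n) U"
  shows "smooth_on n U (box_bump n y r)"
  unfolding smooth_on_def
proof
  fix k
  have a: "Ck_on n k U (\<lambda>x. 2 + (- inverse r) * (x i + (- y i)))" for i
    by (intro Ck_on_mult[OF U] Ck_on_add[OF U] Ck_on_const[OF U] Ck_on_coordinate[OF U])
  have b: "Ck_on n k U (\<lambda>x. 2 + inverse r * (x i + (- y i)))" for i
    by (intro Ck_on_mult[OF U] Ck_on_add[OF U] Ck_on_const[OF U] Ck_on_coordinate[OF U])
  have "Ck_on n k U (\<lambda>x. \<Prod>i<n. smooth_step (2 + (- inverse r) * (x i + (- y i))) * smooth_step (2 + inverse r * (x i + (- y i))))"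
    by (rule Ck_on_prod[OF U]) (rule Ck_on_mult[OF U Ck_on_step[OF U a] Ck_on_step[OF U b]])
  then show "Ck_on n k U (box_bump n y r)"
    unfolding box_bump_def by (simp add: divide_inverse mult.commute)
qed

lemma Ck_on_of_real:
  "openin (Euclidean_space n) U \<Longrightarrow> Ck_on n k U u \<Longrightarrow> Ck_on n k U (\<lambda>x. of_real (u x) :: 'v::real_normed_algebra_1)"
  by (rule Ck_on_bounded_linear[OF _ bounded_linear_of_real])

text \<open>Difference quotients of a real function stay in the isometric image of the reals, which
  is complete and therefore closed, so their limit is real. This allows reading off real coordinates
  from functions with values in the ground field.\<close>

lemma has_vector_derivative_of_real_cancel:
  fixes D :: "'v::real_normed_algebra_1"
  assumes "((\<lambda>t. of_real (u t)) has_vector_derivative D) (at x)"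
  obtains d where "D = of_real d" "(u has_vector_derivative d) (at x)"
proof -
  have lim: "((\<lambda>t. of_real ((u t - u x) / (t - x)) :: 'v) \<longlongrightarrow> D) (at x)"
  proof -
    have "((\<lambda>t. (1 / norm (t - x)) *\<^sub>R (of_real (u t) - (of_real (u x) + (t - x) *\<^sub>R D))) \<longlongrightarrow> 0) (at x)"
      using assms unfolding has_vector_derivative_def has_derivative_at2 by blast
    then have "((\<lambda>t. norm ((1 / norm (t - x)) *\<^sub>R (of_real (u t) - (of_real (u x) + (t - x) *\<^sub>R D)))) \<longlongrightarrow> 0) (at x)"
      by (rule tendsto_norm_zero)
    moreover have "norm ((1 / norm (t - x)) *\<^sub>R (of_real (u t) - (of_real (u x) + (t - x) *\<^sub>R D))) =
        norm (of_real ((u t - u x) / (t - x)) - D)" if "t \<noteq> x" for t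
    proof -
      have "of_real (u t) - (of_real (u x) + (t - x) *\<^sub>R D) = of_real (u t - u x) - (t - x) *\<^sub>R D" by simp
      moreover have "(1 / (t - x)) *\<^sub>R (of_real (u t - u x) :: 'v) = of_real ((u t - u x) / (t - x))"
        by (simp add: of_real_def)
      ultimately have "of_real ((u t - u x) / (t - x)) - D = (1 / (t - x)) *\<^sub>R (of_real (u t) - (of_real (u x) + (t - x) *\<^sub>R D))"
        using that by (simp only: scaleR_diff_right) simp
      then show ?thesis by (simp only: norm_scaleR real_norm_def abs_divide abs_abs)
    qed
    ultimately have "((\<lambda>t. norm (of_real ((u t - u x) / (t - x)) - D)) \<longlongrightarrow> 0) (at x)"
      by (elim Lim_transform_eventually) (simp add: eventually_at_filter)
    then show ?thesis by (simp add: tendsto_norm_zero_iff LIM_zero_iff)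
  qed
  have "closed (range (of_real :: real \<Rightarrow> 'v))"
  proof (rule complete_imp_closed)
    show "complete (range (of_real :: real \<Rightarrow> 'v))"
      by (rule complete_isometric_image[of 1]) (auto simp: bounded_linear_of_real complete_UNIV)
  qed
  then have "D \<in> range of_real"
    by (rule Lim_in_closed_set[OF _ _ trivial_limit_at lim]) simp
  then obtain d where d: "D = of_real d" by blast
  have "((\<lambda>t. norm (of_real ((u t - u x) / (t - x)) - D)) \<longlongrightarrow> 0) (at x)"
    using lim LIM_zero tendsto_norm_zero by blast
  then have "((\<lambda>t. norm ((u t - u x) / (t - x) - d)) \<longlongrightarrow> 0) (at x)"
    by (simp only: d of_real_diff[symmetric] norm_of_real real_norm_def)
  then have "((\<lambda>t. (u t - u x) / (t - x)) \<longlongrightarrow> d) (at x)"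
    by (simp only: tendsto_norm_zero_iff LIM_zero_iff)
  then have "(u has_vector_derivative d) (at x)"
    unfolding has_real_derivative_iff_has_vector_derivative[symmetric] has_field_derivative_iff .
  with d show thesis using that by blast
qed

lemma Ck_on_of_real_cancel:
  assumes U: "openin (Euclidean_space n) U"
  shows "Ck_on n k U (\<lambda>x. of_real (u x) :: 'v::real_normed_algebra_1) \<Longrightarrow> Ck_on n k U u"
proof (induction k arbitrary: u)
  have cont: "continuous_on U u" if "continuous_on U (\<lambda>x. of_real (u x) :: 'v)" for u :: "(nat \<Rightarrow> real) \<Rightarrow> real"
    using that unfolding continuous_on_iff dist_norm of_real_diff[symmetric] norm_of_real real_norm_def .
  {
    case 0
    then show ?case using U cont by (simp add: continuous_map_Euclidean_iff)
  next
    case (Suc k)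
    obtain g :: "nat \<Rightarrow> (nat \<Rightarrow> real) \<Rightarrow> 'v" where g: "has_partials n U (\<lambda>x. of_real (u x)) g" "\<And>i. i < n \<Longrightarrow> Ck_on n k U (g i)"
      using Suc.prems by (rule Ck_on_SucE) blast
    have "\<exists>d. i < n \<and> x \<in> U \<longrightarrow> g i x = of_real d \<and> ((\<lambda>t. u (x(i := t))) has_vector_derivative d) (at (x i))" for i x
    proof (cases "i < n \<and> x \<in> U")
      case True
      then show ?thesis
        using has_vector_derivative_of_real_cancel[OF has_partialsD[OF g(1), of i x]] by blast
    qed auto
    then obtain d where d: "\<And>i x. i < n \<and> x \<in> U \<longrightarrow> g i x = of_real (d i x) \<and> ((\<lambda>t. u (x(i := t))) has_vector_derivative d i x) (at (x i))"
      by metis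
    show ?case
    proof (rule Ck_on_SucI[OF U, where g = d])
      show "continuous_on U u" using cont Ck_on_continuous[OF Suc.prems U] .
      show "has_partials n U u d" using d unfolding has_partials_def by blast
      show "Ck_on n k U (d i)" if "i < n" for i
        using Ck_on_cong[OF U g(2)[OF that], of "\<lambda>x. of_real (d i x)"] d that by (intro Suc.IH) blast
    qed
  }
qed

text \<open>The pointwise counterpart of \<open>smooth_function\<close>, in the style of
  \<open>smooth_at\<close>, so that sums, products, quotients and local modifications can be treated
  near a point.\<close>

definition smooth_fun_at :: "'p manifold \<Rightarrow> ('p \<Rightarrow> 'v::real_normed_vector) \<Rightarrow> 'p \<Rightarrow> bool"
  where "smooth_fun_at X f x \<longleftrightarrow> (\<exists>N U \<phi>. openin (mtop X) N \<and> x \<in> N \<and> N \<subseteq> U \<and>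
    (U, \<phi>) \<in> atlas X \<and> smooth_on (mdim X) (\<phi> ` N) (f \<circ> inv_into U \<phi>))"

lemma smooth_fun_at_charts:
  assumes X: "smooth_manifold X" and f: "smooth_fun_at X f x" and c: "(U, \<phi>) \<in> atlas X" "x \<in> U"
  obtains N where "openin (mtop X) N" "x \<in> N" "N \<subseteq> U" "smooth_on (mdim X) (\<phi> ` N) (f \<circ> inv_into U \<phi>)"
proof -
  obtain N0 U0 \<phi>0 where *: "openin (mtop X) N0" "x \<in> N0" "N0 \<subseteq> U0" "(U0, \<phi>0) \<in> atlas X"
    "smooth_on (mdim X) (\<phi>0 ` N0) (f \<circ> inv_into U0 \<phi>0)"
    using f unfolding smooth_fun_at_def by blast
  define N where "N = N0 \<inter> U"
  have N: "openin (mtop X) N" "x \<in> N" "N \<subseteq> U" "N \<subseteq> N0" "N \<subseteq> U0"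
    unfolding N_def using * chart_open[OF X c(1)] c by auto
  have o: "openin (Euclidean_space (mdim X)) (\<phi> ` N)" "openin (Euclidean_space (mdim X)) (\<phi>0 ` N0)"
      "openin (Euclidean_space (mdim X)) (\<phi> ` (U \<inter> U0))"
    using chart_subset_open[OF X c(1)] chart_subset_open[OF X *(4)] N * chart_open[OF X c(1)] chart_open[OF X *(4)]
    by auto
  have i: "inv_into U \<phi> (\<phi> z) = z" if "z \<in> N" for z using chart_inj[OF X c(1)] that N by auto
  have i0: "inv_into U0 \<phi>0 (\<phi>0 z) = z" if "z \<in> N" for z using chart_inj[OF X *(4)] that N by auto
  have s: "smooth_between (mdim X) (mdim X) (\<phi> ` N) (\<phi>0 \<circ> inv_into U \<phi>)"
    using N by (intro smooth_between_subset[OF o(3) chart_transition[OF X c(1) *(4)] o(1)]) auto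
  have "smooth_on (mdim X) (\<phi> ` N) (\<lambda>z. (f \<circ> inv_into U0 \<phi>0) ((\<phi>0 \<circ> inv_into U \<phi>) z))"
    using i N by (intro smooth_on_compose[OF o(1,2) _ *(5) s]) auto
  then have "smooth_on (mdim X) (\<phi> ` N) (f \<circ> inv_into U \<phi>)"
    by (rule smooth_on_cong[OF o(1)]) (use i i0 in auto)
  then show thesis using that N by blast
qed

lemma smooth_function_iff:
  assumes X: "smooth_manifold X"
  shows "smooth_function X f \<longleftrightarrow> (\<forall>x \<in> points X. smooth_fun_at X f x)"
proof
  assume f: "smooth_function X f"
  show "\<forall>x \<in> points X. smooth_fun_at X f x"
  proof
    fix x assume "x \<in> points X"
    then obtain U \<phi> where c: "(U, \<phi>) \<in> atlas X" "x \<in> U" using atlas_cover[OF X] by blast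
    moreover have "smooth_on (mdim X) (\<phi> ` U) (f \<circ> inv_into U \<phi>)" using f c unfolding smooth_function_def by blast
    ultimately show "smooth_fun_at X f x"
      unfolding smooth_fun_at_def using chart_open[OF X c(1)] by blast
  qed
next
  assume f: "\<forall>x \<in> points X. smooth_fun_at X f x"
  have "smooth_on (mdim X) (\<phi> ` U) (f \<circ> inv_into U \<phi>)" if c: "(U, \<phi>) \<in> atlas X" for U \<phi>
  proof (rule smooth_on_local[OF chart_image_open[OF X c]])
    fix z assume "z \<in> \<phi> ` U"
    then obtain x where x: "x \<in> U" "z = \<phi> x" by auto
    then have "smooth_fun_at X f x" using f openin_subset[OF chart_open[OF X c]] by blast
    then obtain N where "openin (mtop X) N" "x \<in> N" "N \<subseteq> U" "smooth_on (mdim X) (\<phi> ` N) (f \<circ> inv_into U \<phi>)"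
      using smooth_fun_at_charts[OF X _ c x(1)] by blast
    then show "\<exists>N. openin (Euclidean_space (mdim X)) N \<and> z \<in> N \<and> smooth_on (mdim X) N (f \<circ> inv_into U \<phi>)"
      using x chart_subset_open[OF X c] by blast
  qed
  then show "smooth_function X f" unfolding smooth_function_def by blast
qed

lemma smooth_fun_at_cong:
  assumes X: "smooth_manifold X" and f: "smooth_fun_at X f x"
    and N: "openin (mtop X) N" "x \<in> N" "\<And>z. z \<in> N \<Longrightarrow> f z = g z"
  shows "smooth_fun_at X g x"
proof -
  obtain N' U \<phi> where *: "openin (mtop X) N'" "x \<in> N'" "N' \<subseteq> U" "(U, \<phi>) \<in> atlas X"
    "smooth_on (mdim X) (\<phi> ` N') (f \<circ> inv_into U \<phi>)"
    using f unfolding smooth_fun_at_def by blast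
  have o: "openin (Euclidean_space (mdim X)) (\<phi> ` N')" "openin (Euclidean_space (mdim X)) (\<phi> ` (N \<inter> N'))"
    using chart_subset_open[OF X *(4)] * N by auto
  have s: "smooth_on (mdim X) (\<phi> ` (N \<inter> N')) (f \<circ> inv_into U \<phi>)"
    using smooth_on_subset[OF o(1) *(5) o(2)] by blast
  have "f (inv_into U \<phi> z) = g (inv_into U \<phi> z)" if "z \<in> \<phi> ` (N \<inter> N')" for z
    using that N(3) *(3) chart_inj[OF X *(4)] by (auto simp: inv_into_f_f subset_iff)
  then have "smooth_on (mdim X) (\<phi> ` (N \<inter> N')) (g \<circ> inv_into U \<phi>)"
    using smooth_on_cong[OF o(2) s] by (metis comp_apply)
  then show ?thesis
    unfolding smooth_fun_at_def using N * by (intro exI[of _ "N \<inter> N'"] exI[of _ U] exI[of _ \<phi>]) auto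
qed

text \<open>B may be any operation that preserves the classes \<open>Ck_on\<close>; the sum and the
  product are the two instances.\<close>

lemma smooth_fun_at_bilinear:
  assumes X: "smooth_manifold X" and f: "smooth_fun_at X f x" and g: "smooth_fun_at X g x"
    and B: "\<And>n k U f g. openin (Euclidean_space n) U \<Longrightarrow> Ck_on n k U f \<Longrightarrow> Ck_on n k U g \<Longrightarrow> Ck_on n k U (\<lambda>x. B (f x) (g x))"
  shows "smooth_fun_at X (\<lambda>z. B (f z) (g z)) x"
proof -
  obtain N U \<phi> where *: "openin (mtop X) N" "x \<in> N" "N \<subseteq> U" "(U, \<phi>) \<in> atlas X"
    "smooth_on (mdim X) (\<phi> ` N) (f \<circ> inv_into U \<phi>)"
    using f unfolding smooth_fun_at_def by blast
  obtain N' where N': "openin (mtop X) N'" "x \<in> N'" "N' \<subseteq> U" "smooth_on (mdim X) (\<phi> ` N') (g \<circ> inv_into U \<phi>)"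
    using smooth_fun_at_charts[OF X g *(4)] * by blast
  have o: "openin (Euclidean_space (mdim X)) (\<phi> ` N)" "openin (Euclidean_space (mdim X)) (\<phi> ` N')"
      "openin (Euclidean_space (mdim X)) (\<phi> ` (N \<inter> N'))"
    using chart_subset_open[OF X *(4)] * N' by auto
  have "smooth_on (mdim X) (\<phi> ` (N \<inter> N')) (f \<circ> inv_into U \<phi>)" "smooth_on (mdim X) (\<phi> ` (N \<inter> N')) (g \<circ> inv_into U \<phi>)"
    using smooth_on_subset[OF o(1) *(5) o(3)] smooth_on_subset[OF o(2) N'(4) o(3)] by blast+
  then have "smooth_on (mdim X) (\<phi> ` (N \<inter> N')) ((\<lambda>z. B (f z) (g z)) \<circ> inv_into U \<phi>)"
    using B[OF o(3)] unfolding smooth_on_def o_def by blast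
  then show ?thesis
    unfolding smooth_fun_at_def using N' * by (intro exI[of _ "N \<inter> N'"] exI[of _ U] exI[of _ \<phi>]) auto
qed

lemma smooth_fun_at_mult:
  fixes f :: "'p \<Rightarrow> 'v::real_normed_algebra"
  shows "smooth_manifold X \<Longrightarrow> smooth_fun_at X f x \<Longrightarrow> smooth_fun_at X g x \<Longrightarrow> smooth_fun_at X (\<lambda>z. f z * g z) x"
  by (rule smooth_fun_at_bilinear[where B = "(*)"]) (auto intro: Ck_on_mult)

lemma smooth_fun_at_add:
  "smooth_manifold X \<Longrightarrow> smooth_fun_at X f x \<Longrightarrow> smooth_fun_at X g x \<Longrightarrow> smooth_fun_at X (\<lambda>z. f z + g z) x"
  by (rule smooth_fun_at_bilinear[where B = "(+)"]) (auto intro: Ck_on_add)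

lemma smooth_fun_at_chart:
  assumes X: "smooth_manifold X" and c: "(U, \<phi>) \<in> atlas X" "x \<in> U" and b: "smooth_on (mdim X) (\<phi> ` U) b"
  shows "smooth_fun_at X (\<lambda>z. b (\<phi> z)) x"
proof -
  have "smooth_on (mdim X) (\<phi> ` U) ((\<lambda>z. b (\<phi> z)) \<circ> inv_into U \<phi>)"
    by (rule smooth_on_cong[OF chart_image_open[OF X c(1)] b]) (use chart_inj[OF X c(1)] in auto)
  then show ?thesis unfolding smooth_fun_at_def using c chart_open[OF X c(1)] by blast
qed

lemma smooth_fun_at_const:
  assumes X: "smooth_manifold X" and x: "x \<in> points X"
  shows "smooth_fun_at X (\<lambda>_. c) x"
proof -
  obtain U \<phi> where c: "(U, \<phi>) \<in> atlas X" "x \<in> U" using atlas_cover[OF X x] by blast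
  show ?thesis
    by (rule smooth_fun_at_chart[OF X c]) (simp add: smooth_on_def Ck_on_const chart_image_open[OF X c(1)])
qed

lemma smooth_fun_at_inverse:
  fixes h :: "'p \<Rightarrow> 'v::real_normed_div_algebra"
  assumes X: "smooth_manifold X" and h: "smooth_fun_at X h x" and N: "openin (mtop X) N" "x \<in> N" "\<And>z. z \<in> N \<Longrightarrow> h z \<noteq> 0"
  shows "smooth_fun_at X (\<lambda>z. inverse (h z)) x"
proof -
  obtain N' U \<phi> where *: "openin (mtop X) N'" "x \<in> N'" "N' \<subseteq> U" "(U, \<phi>) \<in> atlas X"
    "smooth_on (mdim X) (\<phi> ` N') (h \<circ> inv_into U \<phi>)"
    using h unfolding smooth_fun_at_def by blast
  have o: "openin (Euclidean_space (mdim X)) (\<phi> ` N')" "openin (Euclidean_space (mdim X)) (\<phi> ` (N \<inter> N'))"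
    using chart_subset_open[OF X *(4)] * N by auto
  have s: "smooth_on (mdim X) (\<phi> ` (N \<inter> N')) (h \<circ> inv_into U \<phi>)"
    using smooth_on_subset[OF o(1) *(5) o(2)] by blast
  have "h (inv_into U \<phi> z) \<noteq> 0" if "z \<in> \<phi> ` (N \<inter> N')" for z
    using that N(3) *(3) chart_inj[OF X *(4)] by (auto simp: inv_into_f_f subset_iff)
  then have "smooth_on (mdim X) (\<phi> ` (N \<inter> N')) ((\<lambda>z. inverse (h z)) \<circ> inv_into U \<phi>)"
    using s Ck_on_inverse[OF o(2)] unfolding smooth_on_def o_def by blast
  then show ?thesis
    unfolding smooth_fun_at_def using N * by (intro exI[of _ "N \<inter> N'"] exI[of _ U] exI[of _ \<phi>]) auto
qed

lemma smooth_fun_at_continuous_near: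
  assumes X: "smooth_manifold X" and f: "smooth_fun_at X f x"
  obtains N where "openin (mtop X) N" "x \<in> N" "continuous_map (subtopology (mtop X) N) euclidean f"
proof -
  obtain N U \<phi> where *: "openin (mtop X) N" "x \<in> N" "N \<subseteq> U" "(U, \<phi>) \<in> atlas X"
    "smooth_on (mdim X) (\<phi> ` N) (f \<circ> inv_into U \<phi>)"
    using f unfolding smooth_fun_at_def by blast
  let ?E = "Euclidean_space (mdim X)"
  have "Ck_on (mdim X) 0 (\<phi> ` N) (f \<circ> inv_into U \<phi>)" using *(5) unfolding smooth_on_def by blast
  then have c: "continuous_map (subtopology ?E (\<phi> ` N)) euclidean (f \<circ> inv_into U \<phi>)" by simp
  have "continuous_map (subtopology (mtop X) N) ?E \<phi>"
    using chart_continuous[OF X *(4)] *(3) continuous_map_from_subtopology_mono by blast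
  then have p: "continuous_map (subtopology (mtop X) N) (subtopology ?E (\<phi> ` N)) \<phi>"
    by (auto simp: continuous_map_in_subtopology)
  have "continuous_map (subtopology (mtop X) N) euclidean (f \<circ> inv_into U \<phi> \<circ> \<phi>)"
    by (rule continuous_map_compose[OF p c])
  then have "continuous_map (subtopology (mtop X) N) euclidean f"
    by (rule continuous_map_eq) (use chart_inj[OF X *(4)] *(3) in auto)
  then show thesis using that * by blast
qed

lemma smooth_function_continuous:
  assumes X: "smooth_manifold X" and f: "smooth_function X f"
  shows "continuous_map (mtop X) euclidean f"
proof -
  have "\<exists>N. x \<in> points X \<longrightarrow> openin (mtop X) N \<and> x \<in> N \<and> continuous_map (subtopology (mtop X) N) euclidean f" for x
    using f smooth_fun_at_continuous_near[OF X, of f x] unfolding smooth_function_iff[OF X] by metis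
  then obtain N where N: "\<And>x. x \<in> points X \<Longrightarrow> openin (mtop X) (N x) \<and> x \<in> N x \<and> continuous_map (subtopology (mtop X) (N x)) euclidean f"
    by metis
  show ?thesis
    by (rule pasting_lemma[where I = "points X" and T = N and f = "\<lambda>_. f"]) (use N in auto)
qed

section \<open>Supports and germs\<close>

lemma support_subset_points: "support X f \<subseteq> points X"
  by (simp add: support_def closure_of_subset_topspace)

lemma closedin_support: "closedin (mtop X) (support X f)"
  by (simp add: support_def)

lemma in_support: "x \<in> points X \<Longrightarrow> f x \<noteq> 0 \<Longrightarrow> x \<in> support X f"
  unfolding support_def by (rule subsetD[OF closure_of_subset]) auto

lemma zero_outside_support: "f \<in> Cc_infinity X \<Longrightarrow> x \<notin> support X f \<Longrightarrow> f x = 0"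
  by (cases "x \<in> points X") (auto simp: Cc_infinity_def dest: in_support)

lemma nonzero_in_support: "f \<in> Cc_infinity X \<Longrightarrow> f x \<noteq> 0 \<Longrightarrow> x \<in> support X f"
  using zero_outside_support by metis

lemma support_minimal:
  "closedin (mtop X) K \<Longrightarrow> (\<And>x. x \<in> points X \<Longrightarrow> f x \<noteq> 0 \<Longrightarrow> x \<in> K) \<Longrightarrow> support X f \<subseteq> K"
  unfolding support_def by (rule closure_of_minimal) auto

lemma Cc_infinity_on_points: "Cc_infinity_on X (points X) = Cc_infinity X"
  by (simp add: Cc_infinity_on_def support_subset_points)

lemma Cc_infinity_on_mono: "V \<subseteq> W \<Longrightarrow> f \<in> Cc_infinity_on X V \<Longrightarrow> f \<in> Cc_infinity_on X W"
  by (auto simp: Cc_infinity_on_def)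

lemma Cc_infinity_onD: "f \<in> Cc_infinity_on X V \<Longrightarrow> f \<in> Cc_infinity X"
  by (simp add: Cc_infinity_on_def)

lemma Cc_infinity_on_zero: "f \<in> Cc_infinity_on X V \<Longrightarrow> x \<notin> V \<Longrightarrow> f x = 0"
  using zero_outside_support[of f X x] by (auto simp: Cc_infinity_on_def)

lemma same_germ_sym: "same_germ X y f g \<Longrightarrow> same_germ X y g f"
  unfolding same_germ_def by metis

lemma same_germ_trans: "same_germ X y f g \<Longrightarrow> same_germ X y g h \<Longrightarrow> same_germ X y f h"
  unfolding same_germ_def by (metis (no_types, lifting) IntD1 IntD2 IntI openin_Int)

lemma same_germ_value: "same_germ X y f g \<Longrightarrow> f y = g y"
  unfolding same_germ_def by blast

lemma same_germ_point: "same_germ X y f g \<Longrightarrow> y \<in> points X"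
  unfolding same_germ_def using openin_subset by blast

lemma same_germ_map2:
  assumes "same_germ X y f f'" "same_germ X y g g'"
  shows "same_germ X y (\<lambda>x. B (f x) (g x)) (\<lambda>x. B (f' x) (g' x))"
proof -
  obtain U V where "openin (mtop X) U" "y \<in> U" "\<And>x. x \<in> U \<Longrightarrow> f x = f' x"
    "openin (mtop X) V" "y \<in> V" "\<And>x. x \<in> V \<Longrightarrow> g x = g' x"
    using assms unfolding same_germ_def by blast
  then show ?thesis unfolding same_germ_def by (intro exI[of _ "U \<inter> V"]) auto
qed

locale hausdorff_manifold =
  fixes X :: "'p manifold"
  assumes manifold: "smooth_manifold X" and Hausdorff: "Hausdorff_space (mtop X)"
begin

text \<open>The Hausdorff property enters here: the compact set K is closed, and hence contains the
  support as soon as it contains the points where the function is nonzero.\<close>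

lemma Cc_infinity_onI:
  assumes "\<And>x. x \<in> points X \<Longrightarrow> smooth_fun_at X f x" "compactin (mtop X) K" "K \<subseteq> V" "\<And>x. f x \<noteq> 0 \<Longrightarrow> x \<in> K"
  shows "f \<in> Cc_infinity_on X V"
proof -
  have K: "closedin (mtop X) K" using compactin_imp_closedin[OF Hausdorff assms(2)] .
  then have "support X f \<subseteq> K" using assms(4) by (intro support_minimal) auto
  moreover have "compactin (mtop X) (support X f)"
    using closed_compactin[OF assms(2) calculation closedin_support] .
  moreover have "f x = 0" if "x \<notin> points X" for x
    using assms(4) that compactin_subset_topspace[OF assms(2)] by blast
  ultimately show ?thesis
    using assms(1,3) unfolding Cc_infinity_on_def Cc_infinity_def smooth_function_iff[OF manifold] by auto
qed

lemma Cc_smooth: "f \<in> Cc_infinity X \<Longrightarrow> x \<in> points X \<Longrightarrow> smooth_fun_at X f x"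
  unfolding Cc_infinity_def smooth_function_iff[OF manifold] by blast

lemma Cc_nonzero_open:
  assumes "f \<in> Cc_infinity X" shows "openin (mtop X) {x. f x \<noteq> 0}"
proof -
  have c: "continuous_map (mtop X) euclidean f"
    using assms by (intro smooth_function_continuous[OF manifold]) (simp add: Cc_infinity_def)
  have "{x. f x \<noteq> 0} = {x \<in> points X. f x \<in> - {0}}" using assms by (auto simp: Cc_infinity_def)
  then show ?thesis using openin_continuous_map_preimage[OF c, of "- {0}"]
    by (simp add: open_Compl)
qed

lemma smooth_fun_at_zero_outside:
  assumes "f \<in> Cc_infinity X" "x \<in> points X" "x \<notin> support X f" "\<And>z. f z = 0 \<Longrightarrow> g z = 0"
  shows "smooth_fun_at X g x"
proof (rule smooth_fun_at_cong[OF manifold smooth_fun_at_const[OF manifold assms(2), of 0]])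
  show "openin (mtop X) (points X - support X f)" by (simp add: closedin_support openin_diff)
  show "x \<in> points X - support X f" using assms by simp
  show "0 = g z" if "z \<in> points X - support X f" for z
    using that assms(4)[of z] zero_outside_support[OF assms(1), of z] by simp
qed

text \<open>The factor u has to be smooth only on the support of \<open>f\<close>; elsewhere the
  product is locally 0. This admits quotients and coordinate functions as factors.\<close>

lemma Cc_cutoff:
  fixes f u :: "'p \<Rightarrow> 'v::real_normed_algebra"
  assumes f: "f \<in> Cc_infinity_on X V" and u: "\<And>x. x \<in> support X f \<Longrightarrow> smooth_fun_at X u x"
  shows "(\<lambda>x. f x * u x) \<in> Cc_infinity_on X V"
proof (rule Cc_infinity_onI)
  have fC: "f \<in> Cc_infinity X" using f by (rule Cc_infinity_onD)
  show "compactin (mtop X) (support X f)" "support X f \<subseteq> V" using f by (auto simp: Cc_infinity_on_def Cc_infinity_def)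
  show "x \<in> support X f" if "f x * u x \<noteq> 0" for x using nonzero_in_support[OF fC, of x] that by (cases "f x = 0") auto
  show "smooth_fun_at X (\<lambda>x. f x * u x) x" if "x \<in> points X" for x
  proof (cases "x \<in> support X f")
    case True then show ?thesis using smooth_fun_at_mult[OF manifold Cc_smooth[OF fC that] u] by blast
  next
    case False show ?thesis by (rule smooth_fun_at_zero_outside[OF fC that False]) simp
  qed
qed

lemma Cc_mult:
  fixes f g :: "'p \<Rightarrow> 'v::real_normed_field"
  shows "f \<in> Cc_infinity_on X V \<Longrightarrow> g \<in> Cc_infinity X \<Longrightarrow> (\<lambda>x. f x * g x) \<in> Cc_infinity_on X V"
  using support_subset_points[of X f] by (intro Cc_cutoff Cc_smooth) auto

lemma Cc_scale:
  fixes f :: "'p \<Rightarrow> 'v::real_normed_field"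
  shows "f \<in> Cc_infinity_on X V \<Longrightarrow> (\<lambda>x. c * f x) \<in> Cc_infinity_on X V"
  using support_subset_points[of X f]
  by (subst mult.commute) (intro Cc_cutoff smooth_fun_at_const[OF manifold], auto)

lemma Cc_add:
  assumes f: "f \<in> Cc_infinity_on X V" and g: "g \<in> Cc_infinity_on X V"
  shows "(\<lambda>x. f x + g x) \<in> Cc_infinity_on X V"
proof (rule Cc_infinity_onI)
  have C: "f \<in> Cc_infinity X" "g \<in> Cc_infinity X" using f g Cc_infinity_onD by blast+
  show "compactin (mtop X) (support X f \<union> support X g)" using C by (intro compactin_Un) (auto simp: Cc_infinity_def)
  show "support X f \<union> support X g \<subseteq> V" using f g by (auto simp: Cc_infinity_on_def)
  show "x \<in> support X f \<union> support X g" if "f x + g x \<noteq> 0" for x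
    using nonzero_in_support[OF C(1), of x] nonzero_in_support[OF C(2), of x] that
    by (cases "f x = 0") auto
  show "smooth_fun_at X (\<lambda>x. f x + g x) x" if "x \<in> points X" for x
    using smooth_fun_at_add[OF manifold] Cc_smooth[OF C(1) that] Cc_smooth[OF C(2) that] .
qed

lemma Cc_zero: "(\<lambda>_. 0) \<in> Cc_infinity_on X V"
  by (rule Cc_infinity_onI[of _ "{}"]) (auto intro: smooth_fun_at_const[OF manifold])

lemma Cc_diff:
  fixes f g :: "'p \<Rightarrow> 'v::real_normed_field"
  assumes "f \<in> Cc_infinity_on X V" "g \<in> Cc_infinity_on X V"
  shows "(\<lambda>x. f x - g x) \<in> Cc_infinity_on X V"
  using Cc_add[OF assms(1) Cc_scale[OF assms(2), of "- 1"]] by simp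

text \<open>A bump in coordinates is pulled back by a chart and continued by 0. The result is smooth
  outside the chart domain because the compact box is closed in the Hausdorff space.\<close>

lemma exists_bump:
  assumes S: "openin (mtop X) S" and y: "y \<in> S"
  shows "\<exists>f :: 'p \<Rightarrow> 'v::real_normed_algebra_1. f \<in> Cc_infinity_on X S \<and> same_germ X y f (\<lambda>_. 1)"
proof -
  have "y \<in> points X" using S y openin_subset by blast
  then obtain U \<phi> where c: "(U, \<phi>) \<in> atlas X" "y \<in> U" using atlas_cover[OF manifold] by blast
  define n where "n = mdim X"
  let ?E = "Euclidean_space n"
  have inj: "inj_on \<phi> U" using chart_inj[OF manifold c(1)] .
  have oU: "openin ?E (\<phi> ` U)" using chart_image_open[OF manifold c(1)] by (simp add: n_def)
  have "openin ?E (\<phi> ` (U \<inter> S))" unfolding n_def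
    using S chart_open[OF manifold c(1)] by (intro chart_subset_open[OF manifold c(1)]) auto
  then obtain e where e: "e > 0"
    "\<And>z. z \<in> topspace ?E \<Longrightarrow> (\<And>i. i < n \<Longrightarrow> \<bar>z i - \<phi> y i\<bar> < e) \<Longrightarrow> z \<in> \<phi> ` (U \<inter> S)"
    using openin_Euclidean_space_box[of n "\<phi> ` (U \<inter> S)" "\<phi> y"] c y by blast
  \<comment> \<open>The closed box of half-width 2r, outside which the bump vanishes, has to fit
    into the box of half-width e.\<close>
  define r where "r = e / 3"
  have r: "r > 0" "2 * r < e" using e by (auto simp: r_def)
  define K where "K = {z \<in> topspace ?E. \<forall>i<n. \<bar>z i - \<phi> y i\<bar> \<le> 2 * r}"
  have KU: "K \<subseteq> \<phi> ` (U \<inter> S)"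
  proof
    fix z assume "z \<in> K"
    then show "z \<in> \<phi> ` (U \<inter> S)" using r by (intro e(2)) (auto simp: K_def intro: order_le_less_trans)
  qed
  \<comment> \<open>Compactness by Tychonoff: the box is a product of closed intervals, with the
    factor {0} in the coordinates from n on.\<close>
  have "K = Pi\<^sub>E UNIV (\<lambda>i. if i < n then {\<phi> y i - 2 * r .. \<phi> y i + 2 * r} else {0})"
    (is "_ = Pi\<^sub>E UNIV ?J")
  proof -
    have "z i \<in> ?J i \<longleftrightarrow> (i < n \<longrightarrow> \<bar>z i - \<phi> y i\<bar> \<le> 2 * r) \<and> (i \<ge> n \<longrightarrow> z i = 0)" for z i
      by (auto simp: abs_le_iff)
    then have "z \<in> Pi\<^sub>E UNIV ?J \<longleftrightarrow> (\<forall>i. (i < n \<longrightarrow> \<bar>z i - \<phi> y i\<bar> \<le> 2 * r) \<and> (i \<ge> n \<longrightarrow> z i = 0))" for z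
      by (simp only: PiE_iff) simp
    then show ?thesis by (auto simp: K_def topspace_Euclidean_space)
  qed
  moreover have "compactin (powertop_real UNIV) (Pi\<^sub>E UNIV (\<lambda>i. if i < n then {\<phi> y i - 2 * r .. \<phi> y i + 2 * r} else {0}))"
    unfolding compactin_PiE by (intro disjI2 ballI) (simp add: compactin_euclidean_iff)
  ultimately have "compactin ?E K"
    using K_def by (auto simp: Euclidean_space_def compactin_subtopology topspace_Euclidean_space)
  then have "compactin (subtopology ?E (\<phi> ` U)) K" using KU by (auto simp: compactin_subtopology)
  then have cK: "compactin (mtop X) (inv_into U \<phi> ` K)"
    using image_compactin[OF _ chart_inv_continuous[OF manifold c(1)]] by (simp add: n_def)
  define f :: "'p \<Rightarrow> 'v" where "f x = (if x \<in> U then of_real (box_bump n (\<phi> y) r (\<phi> x)) else 0)" for x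
  have nz: "x \<in> inv_into U \<phi> ` K" if fx: "f x \<noteq> 0" for x
  proof -
    have x: "x \<in> U" "box_bump n (\<phi> y) r (\<phi> x) \<noteq> 0" using fx by (auto simp: f_def split: if_splits)
    have "\<phi> x \<in> topspace ?E" using x(1) openin_subset[OF oU] by blast
    then have "\<phi> x \<in> K" unfolding K_def using box_bump_nonzero[OF r(1) x(2)] by blast
    then show ?thesis using x(1) inj by (metis image_eqI inv_into_f_f)
  qed
  have "f \<in> Cc_infinity_on X S"
  proof (rule Cc_infinity_onI[OF _ cK _ nz])
    show "inv_into U \<phi> ` K \<subseteq> S" using KU inj by fastforce
    fix x assume x: "x \<in> points X"
    show "smooth_fun_at X f x"
    proof (cases "x \<in> U")
      case True
      show ?thesis
      proof (rule smooth_fun_at_cong[OF manifold _ chart_open[OF manifold c(1)] True])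
        have "smooth_on n (\<phi> ` U) (\<lambda>z. of_real (box_bump n (\<phi> y) r z) :: 'v)"
          using smooth_on_box_bump[OF oU] Ck_on_of_real[OF oU] unfolding smooth_on_def by blast
        then show "smooth_fun_at X (\<lambda>x. of_real (box_bump n (\<phi> y) r (\<phi> x)) :: 'v) x"
          by (intro smooth_fun_at_chart[OF manifold c(1) True]) (simp add: n_def)
      qed (simp add: f_def)
    next
      case False
      have "inv_into U \<phi> ` K \<subseteq> U" using KU inj by fastforce
      then have xK: "x \<in> points X - inv_into U \<phi> ` K" using False x by blast
      have oK: "openin (mtop X) (points X - inv_into U \<phi> ` K)"
        using compactin_imp_closedin[OF Hausdorff cK] by blast
      show ?thesis
        by (rule smooth_fun_at_cong[OF manifold smooth_fun_at_const[OF manifold x, of 0] oK xK]) (use nz in force)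
    qed
  qed
  moreover have "same_germ X y f (\<lambda>_. 1)"
  proof -
    let ?B = "{z. \<forall>i\<in>{..<n}. \<bar>z i - \<phi> y i\<bar> < r}"
    have "open ?B" unfolding Collect_ball_eq
      by (intro open_INT ballI finite_lessThan open_Collect_less continuous_intros continuous_on_coordinate)
    then have "openin ?E (topspace ?E \<inter> ?B)"
      unfolding Euclidean_space_eq by (auto simp: openin_open)
    moreover have "continuous_map (subtopology (mtop X) U) ?E \<phi>"
      using chart_continuous[OF manifold c(1)] by (simp add: n_def)
    ultimately have "openin (subtopology (mtop X) U) {x \<in> topspace (subtopology (mtop X) U). \<phi> x \<in> topspace ?E \<inter> ?B}"
      by (intro openin_continuous_map_preimage)
    then have "openin (mtop X) {x \<in> topspace (subtopology (mtop X) U). \<phi> x \<in> topspace ?E \<inter> ?B}" (is "openin _ ?N")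
      using chart_open[OF manifold c(1)] openin_trans_full by blast
    moreover have "y \<in> ?N"
      using c \<open>y \<in> points X\<close> r openin_subset[OF oU] by auto
    moreover have "f x = 1" if "x \<in> ?N" for x
      using that box_bump_eq_1[OF r(1), of n "\<phi> x" "\<phi> y"] by (simp add: f_def)
    ultimately show ?thesis unfolding same_germ_def by blast
  qed
  ultimately show ?thesis by blast
qed

text \<open>The function f + g - fg = 1 - (1 - f)(1 - g) is 1 wherever \<open>f\<close> or
  \<open>g\<close> is, so a finite cover of K glues to one function. The closure condition on I
  holds both for the functions supported in an open set and for the kernel of a character.\<close>

lemma compact_unit:
  fixes I :: "('p \<Rightarrow> 'v::real_normed_field) set"
  assumes K: "compactin (mtop X) K" and I: "(\<lambda>_. 0) \<in> I" "\<And>f g. f \<in> I \<Longrightarrow> g \<in> I \<Longrightarrow> (\<lambda>x. f x + g x - f x * g x) \<in> I"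
    and germs: "\<And>y. y \<in> K \<Longrightarrow> \<exists>f\<in>I. same_germ X y f (\<lambda>_. 1)"
  shows "\<exists>f\<in>I. \<exists>N. openin (mtop X) N \<and> K \<subseteq> N \<and> (\<forall>x\<in>N. f x = 1)"
proof -
  define \<U> where "\<U> = {N. openin (mtop X) N \<and> (\<exists>f\<in>I. \<forall>x\<in>N. f x = 1)}"
  have "K \<subseteq> \<Union>\<U>"
  proof
    fix y assume "y \<in> K"
    then obtain f N where "f \<in> I" "openin (mtop X) N" "y \<in> N" "\<forall>x\<in>N. f x = 1"
      using germs unfolding same_germ_def by blast
    then show "y \<in> \<Union>\<U>" unfolding \<U>_def by blast
  qed
  moreover have "\<forall>N\<in>\<U>. openin (mtop X) N" by (simp add: \<U>_def)
  ultimately obtain \<F> where F: "finite \<F>" "\<F> \<subseteq> \<U>" "K \<subseteq> \<Union>\<F>"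
    using K unfolding compactin_def by metis
  have "\<exists>f\<in>I. \<forall>x\<in>\<Union>\<F>. f x = 1" using F(1,2)
  proof (induction \<F>)
    case empty then show ?case using I(1) by auto
  next
    case (insert N \<F>)
    then obtain f where f: "f \<in> I" "\<forall>x\<in>\<Union>\<F>. f x = 1" by auto
    obtain g where g: "g \<in> I" "\<forall>x\<in>N. g x = 1" using insert.prems unfolding \<U>_def by blast
    show ?case using I(2)[OF f(1) g(1)] f(2) g(2) by (intro bexI[of _ "\<lambda>x. f x + g x - f x * g x"]) auto
  qed
  moreover have "openin (mtop X) (\<Union>\<F>)" using F(2) by (intro openin_Union) (auto simp: \<U>_def)
  ultimately show ?thesis using F(3) by blast
qed

lemma exists_bump_compact:
  assumes K: "compactin (mtop X) K" and S: "openin (mtop X) S" "K \<subseteq> S"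
  shows "\<exists>f :: 'p \<Rightarrow> 'v::real_normed_field. f \<in> Cc_infinity_on X S \<and>
    (\<exists>N. openin (mtop X) N \<and> K \<subseteq> N \<and> (\<forall>x\<in>N. f x = 1))"
proof -
  have "\<exists>f\<in>Cc_infinity_on X S. \<exists>N. openin (mtop X) N \<and> K \<subseteq> N \<and> (\<forall>x\<in>N. f x = (1::'v))"
  proof (rule compact_unit[OF K Cc_zero])
    show "(\<lambda>x. f x + g x - f x * g x) \<in> Cc_infinity_on X S"
      if "f \<in> Cc_infinity_on X S" "g \<in> Cc_infinity_on X S" for f g :: "'p \<Rightarrow> 'v"
      using that by (intro Cc_diff Cc_add Cc_mult Cc_infinity_onD)
    show "\<exists>f\<in>Cc_infinity_on X S. same_germ X y f (\<lambda>_. 1::'v)" if "y \<in> K" for y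
      using exists_bump[OF S(1), of y] that S(2) by blast
  qed
  then show ?thesis by blast
qed

text \<open>Takes the place of an identity element: h acts as identity on \<open>f\<close> and is 1
  on the whole support, including its boundary points.\<close>

lemma local_unit:
  fixes f :: "'p \<Rightarrow> 'v::real_normed_field"
  assumes S: "openin (mtop X) S" and f: "f \<in> Cc_infinity_on X S"
  shows "\<exists>h \<in> Cc_infinity_on X S. (\<forall>x. f x * h x = f x) \<and> (\<forall>x\<in>support X f. h x = 1)"
proof -
  have "compactin (mtop X) (support X f)" "support X f \<subseteq> S" using f by (auto simp: Cc_infinity_on_def Cc_infinity_def)
  then obtain h N where h: "h \<in> Cc_infinity_on X S" "support X f \<subseteq> N" "\<forall>x\<in>N. h x = (1::'v)"
    using exists_bump_compact[OF _ S, of "support X f"] by blast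
  have "f x * h x = f x" for x
    using h zero_outside_support[OF Cc_infinity_onD[OF f], of x] by (cases "x \<in> support X f") auto
  then show ?thesis using h by blast
qed

text \<open>If no point of the support of \<open>e\<close> were a common zero of the kernel, the kernel would contain a
  function that is \<open>1\<close> on this support, and \<open>e\<close> itself.\<close>

lemma character_is_evaluation:
  fixes \<kappa> :: "('p \<Rightarrow> 'v::real_normed_field) \<Rightarrow> 'v"
  assumes W: "openin (mtop X) W"
    and add: "\<And>f g. f \<in> Cc_infinity_on X W \<Longrightarrow> g \<in> Cc_infinity_on X W \<Longrightarrow> \<kappa> (\<lambda>x. f x + g x) = \<kappa> f + \<kappa> g"
    and scale: "\<And>c f. f \<in> Cc_infinity_on X W \<Longrightarrow> \<kappa> (\<lambda>x. c * f x) = c * \<kappa> f"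
    and mult: "\<And>f g. f \<in> Cc_infinity_on X W \<Longrightarrow> g \<in> Cc_infinity_on X W \<Longrightarrow> \<kappa> (\<lambda>x. f x * g x) = \<kappa> f * \<kappa> g"
    and nz: "f0 \<in> Cc_infinity_on X W" "\<kappa> f0 \<noteq> 0"
  shows "\<exists>y\<in>W. \<forall>f\<in>Cc_infinity_on X W. \<kappa> f = f y"
proof -
  \<comment> \<open>Rescaled to \<kappa> e = 1, so that f - (\<kappa> f)e lies in the kernel for
    every \<open>f\<close>.\<close>
  define e where "e = (\<lambda>x. inverse (\<kappa> f0) * f0 x)"
  have e: "e \<in> Cc_infinity_on X W" unfolding e_def using nz(1) by (rule Cc_scale)
  have e1: "\<kappa> e = 1" unfolding e_def using nz scale by simp
  have diff: "\<kappa> (\<lambda>x. f x - g x) = \<kappa> f - \<kappa> g" if "f \<in> Cc_infinity_on X W" "g \<in> Cc_infinity_on X W" for f g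
    using add[OF that(1) Cc_scale[OF that(2), of "- 1"]] scale[OF that(2), of "- 1"] by simp
  define I where "I = {f \<in> Cc_infinity_on X W. \<kappa> f = 0}"
  define K where "K = support X e"
  have K: "compactin (mtop X) K" "K \<subseteq> W" using e by (auto simp: K_def Cc_infinity_on_def Cc_infinity_def)
  have "\<exists>y\<in>K. \<forall>h\<in>I. h y = 0"
  proof (rule ccontr)
    assume H: "\<not> ?thesis"
    have "\<exists>f\<in>I. \<exists>N. openin (mtop X) N \<and> K \<subseteq> N \<and> (\<forall>x\<in>N. f x = 1)"
    proof (rule compact_unit[OF K(1)])
      have "\<kappa> (\<lambda>_. 0) = 0" using scale[OF e, of 0] by simp
      then show "(\<lambda>_. 0) \<in> I" using Cc_zero by (simp add: I_def)
      show "(\<lambda>x. f x + g x - f x * g x) \<in> I" if "f \<in> I" "g \<in> I" for f g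
      proof -
        have C: "f \<in> Cc_infinity_on X W" "g \<in> Cc_infinity_on X W" "\<kappa> f = 0" "\<kappa> g = 0"
          using that by (auto simp: I_def)
        note C' = Cc_add[OF C(1,2)] Cc_mult[OF C(1) Cc_infinity_onD[OF C(2)]]
        show ?thesis using diff[OF C'] add[OF C(1,2)] mult[OF C(1,2)] Cc_diff[OF C'] C(3,4) by (simp add: I_def)
      qed
      show "\<exists>f\<in>I. same_germ X y f (\<lambda>_. 1)" if y: "y \<in> K" for y
      proof -
        obtain h where h: "h \<in> I" "h y \<noteq> 0" using H y by blast
        have hC: "h \<in> Cc_infinity_on X W" using h by (simp add: I_def)
        have oh: "openin (mtop X) (W \<inter> {x. h x \<noteq> 0})" using W Cc_nonzero_open[OF Cc_infinity_onD[OF hC]] by blast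
        obtain \<rho> :: "'p \<Rightarrow> 'v" where \<rho>: "\<rho> \<in> Cc_infinity_on X (W \<inter> {x. h x \<noteq> 0})" "same_germ X y \<rho> (\<lambda>_. 1)"
          using exists_bump[OF oh, of y] K(2) y h(2) by blast
        define q where "q x = \<rho> x * inverse (h x)" for x
        have sub: "support X \<rho> \<subseteq> W \<inter> {x. h x \<noteq> 0}" using \<rho>(1) by (simp add: Cc_infinity_on_def)
        have "q \<in> Cc_infinity_on X (W \<inter> {x. h x \<noteq> 0})"
          unfolding q_def
        proof (rule Cc_cutoff[OF \<rho>(1)])
          fix x assume x: "x \<in> support X \<rho>"
          then have "smooth_fun_at X h x" using Cc_smooth[OF Cc_infinity_onD[OF hC]] support_subset_points[of X \<rho>] by blast
          then show "smooth_fun_at X (\<lambda>x. inverse (h x)) x"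
            by (rule smooth_fun_at_inverse[OF manifold _ oh]) (use x sub in auto)
        qed
        then have q: "q \<in> Cc_infinity_on X W" by (rule Cc_infinity_on_mono[rotated]) simp
        have "(\<lambda>x. h x * q x) = \<rho>"
        proof
          fix x show "h x * q x = \<rho> x"
            using zero_outside_support[OF Cc_infinity_onD[OF \<rho>(1)], of x] sub by (cases "x \<in> support X \<rho>") (auto simp: q_def)
        qed
        then have "\<kappa> \<rho> = 0" using mult[OF hC q] h by (simp add: I_def)
        moreover have "\<rho> \<in> Cc_infinity_on X W" using \<rho>(1) by (rule Cc_infinity_on_mono[rotated]) simp
        ultimately show ?thesis using \<rho>(2) by (auto simp: I_def)
      qed
    qed
    then obtain f where f: "f \<in> I" "\<forall>x\<in>K. f x = 1" by blast
    have "(\<lambda>x. f x * e x) = e"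
    proof
      fix x show "f x * e x = e x"
        using zero_outside_support[OF Cc_infinity_onD[OF e], of x] f(2) by (cases "x \<in> K") (auto simp: K_def)
    qed
    then show False using mult[of f e] e f(1) e1 by (simp add: I_def)
  qed
  then obtain y where y: "y \<in> K" "\<And>h. h \<in> I \<Longrightarrow> h y = 0" by blast
  have val: "f y = \<kappa> f * e y" if f: "f \<in> Cc_infinity_on X W" for f
  proof -
    have "(\<lambda>x. f x - \<kappa> f * e x) \<in> I"
      using Cc_diff[OF f Cc_scale[OF e]] diff[OF f Cc_scale[OF e]] scale[OF e] e1 by (simp add: I_def)
    from y(2)[OF this] show ?thesis by simp
  qed
  obtain \<rho> :: "'p \<Rightarrow> 'v" where \<rho>: "\<rho> \<in> Cc_infinity_on X W" "same_germ X y \<rho> (\<lambda>_. 1)"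
    using exists_bump[OF W, of y] y(1) K(2) by blast
  \<comment> \<open>The kernel vanishes at y, whence f(y) = (\<kappa> f)e(y). A bump at y shows that
    e(y) is nonzero, and e(y)^2 = e(y) then forces e(y) = 1.\<close>
  have "e y \<noteq> 0" using val[OF \<rho>(1)] same_germ_value[OF \<rho>(2)] by auto
  moreover have "e y * e y = e y"
    using val[OF Cc_mult[OF e Cc_infinity_onD[OF e]]] mult[OF e e] e1 by simp
  ultimately have "e y = 1" by simp
  then show ?thesis using val y(1) K(2) by auto
qed

lemma separating_function:
  assumes S: "openin (mtop X) S" and x: "x \<in> S" and y: "y \<in> points X" "x \<noteq> y"
  shows "\<exists>f :: 'p \<Rightarrow> 'v::real_normed_field. f \<in> Cc_infinity_on X S \<and> f x = 1 \<and> f y = 0"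
proof -
  have "openin (mtop X) (S - {y})"
    using S compactin_imp_closedin[OF Hausdorff] y(1) by (intro openin_diff) simp_all
  then obtain f :: "'p \<Rightarrow> 'v" where f: "f \<in> Cc_infinity_on X (S - {y})" "same_germ X x f (\<lambda>_. 1)"
    using exists_bump[of "S - {y}" x] x y by blast
  then show ?thesis
    using Cc_infinity_on_zero[OF f(1), of y] same_germ_value[OF f(2)] Cc_infinity_on_mono[OF _ f(1), of S] by auto
qed

text \<open>Coordinates multiplied by a bump \<rho> are test functions, and near x their pullbacks
  are the coordinates of \<sigma>. No continuity of \<sigma> is available beforehand: it is replaced
  by the open set of points near x where b \<circ> \<sigma> is nonzero, which \<sigma> maps into the
  region where \<rho> = 1.\<close>

lemma smooth_at_if_pullbacks_smooth:
  assumes W: "openin (mtop X) W" and V: "openin (mtop X) V" and \<sigma>: "\<And>x. x \<in> W \<Longrightarrow> \<sigma> x \<in> V"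
    and smooth: "\<And>(g :: 'p \<Rightarrow> 'v::real_normed_field) x. g \<in> Cc_infinity_on X V \<Longrightarrow> x \<in> W \<Longrightarrow> smooth_fun_at X (\<lambda>z. g (\<sigma> z)) x"
    and x: "x \<in> W"
  shows "smooth_at X X \<sigma> x"
proof -
  obtain U \<psi> where c: "(U, \<psi>) \<in> atlas X" "\<sigma> x \<in> U"
    using atlas_cover[OF manifold] \<sigma>[OF x] openin_subset[OF V] by blast
  define n where "n = mdim X"
  obtain U1 \<phi> where d: "(U1, \<phi>) \<in> atlas X" "x \<in> U1"
    using atlas_cover[OF manifold] x openin_subset[OF W] by blast
  have oVU: "openin (mtop X) (V \<inter> U)" using V chart_open[OF manifold c(1)] by blast
  obtain \<rho> :: "'p \<Rightarrow> 'v" where \<rho>: "\<rho> \<in> Cc_infinity_on X (V \<inter> U)" "same_germ X (\<sigma> x) \<rho> (\<lambda>_. 1)"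
    using exists_bump[OF oVU, of "\<sigma> x"] \<sigma>[OF x] c by blast
  obtain B where B: "openin (mtop X) B" "\<sigma> x \<in> B" "\<And>z. z \<in> B \<Longrightarrow> \<rho> z = 1"
    using \<rho>(2) unfolding same_germ_def by blast
  have oB: "openin (mtop X) (B \<inter> (V \<inter> U))" using B(1) oVU by blast
  obtain b :: "'p \<Rightarrow> 'v" where b: "b \<in> Cc_infinity_on X (B \<inter> (V \<inter> U))" "same_germ X (\<sigma> x) b (\<lambda>_. 1)"
    using exists_bump[OF oB, of "\<sigma> x"] B(2) \<sigma>[OF x] c by blast
  have "smooth_fun_at X (\<lambda>z. b (\<sigma> z)) x"
    using smooth[OF Cc_infinity_on_mono[OF _ b(1)] x] by blast
  then obtain N0 where N0: "openin (mtop X) N0" "x \<in> N0" "continuous_map (subtopology (mtop X) N0) euclidean (\<lambda>z. b (\<sigma> z))"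
    by (rule smooth_fun_at_continuous_near[OF manifold])
  define N1 where "N1 = W \<inter> {z \<in> topspace (subtopology (mtop X) N0). b (\<sigma> z) \<in> - {0}}"
  have "openin (subtopology (mtop X) N0) {z \<in> topspace (subtopology (mtop X) N0). b (\<sigma> z) \<in> - {0}}"
    using openin_continuous_map_preimage[OF N0(3), of "- {0}"] by (simp add: open_Compl)
  then have oN1: "openin (mtop X) N1" unfolding N1_def using N0(1) W openin_trans_full by blast
  have xN1: "x \<in> N1" unfolding N1_def using x N0 openin_subset[OF W] same_germ_value[OF b(2)] by auto
  have imN1: "\<sigma> z \<in> B \<inter> (V \<inter> U)" if "z \<in> N1" for z
    using that Cc_infinity_on_zero[OF b(1), of "\<sigma> z"] by (auto simp: N1_def)
  define g :: "nat \<Rightarrow> 'p \<Rightarrow> 'v" where "g j z = \<rho> z * of_real (\<psi> z j)" for j z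
  have g: "g j \<in> Cc_infinity_on X (V \<inter> U)" for j
    unfolding g_def
  proof (rule Cc_cutoff[OF \<rho>(1)])
    fix z assume "z \<in> support X \<rho>"
    then have z: "z \<in> U" using \<rho>(1) by (auto simp: Cc_infinity_on_def)
    have oU: "openin (Euclidean_space (mdim X)) (\<psi> ` U)" using chart_image_open[OF manifold c(1)] .
    show "smooth_fun_at X (\<lambda>x. of_real (\<psi> x j) :: 'v) z"
      by (rule smooth_fun_at_chart[OF manifold c(1) z])
        (simp add: smooth_on_def Ck_on_of_real[OF oU] Ck_on_coordinate[OF oU])
  qed
  have "smooth_fun_at X (\<lambda>z. of_real (\<psi> (\<sigma> z) j) :: 'v) x" for j
  proof (rule smooth_fun_at_cong[OF manifold _ oN1 xN1])
    show "smooth_fun_at X (\<lambda>z. g j (\<sigma> z)) x" using smooth[OF Cc_infinity_on_mono[OF _ g] x] by blast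
    show "g j (\<sigma> z) = of_real (\<psi> (\<sigma> z) j)" if "z \<in> N1" for z using imN1[OF that] B(3) by (simp add: g_def)
  qed
  then have "\<exists>N. openin (mtop X) N \<and> x \<in> N \<and> N \<subseteq> U1 \<and>
      smooth_on n (\<phi> ` N) ((\<lambda>z. of_real (\<psi> (\<sigma> z) j) :: 'v) \<circ> inv_into U1 \<phi>)" for j
    using smooth_fun_at_charts[OF manifold _ d] unfolding n_def by metis
  then obtain N where N: "\<And>j. openin (mtop X) (N j)" "\<And>j. x \<in> N j" "\<And>j. N j \<subseteq> U1"
      "\<And>j. smooth_on n (\<phi> ` N j) ((\<lambda>z. of_real (\<psi> (\<sigma> z) j) :: 'v) \<circ> inv_into U1 \<phi>)"
    by metis
  define D where "D = (N1 \<inter> U1) \<inter> (\<Inter>j\<in>{..<n}. N j)"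
  have D: "openin (mtop X) D" "x \<in> D" "D \<subseteq> U1" "D \<subseteq> N1" "\<And>j. j < n \<Longrightarrow> D \<subseteq> N j"
  proof -
    have o1: "openin (mtop X) (N1 \<inter> U1)" using oN1 chart_open[OF manifold d(1)] by blast
    \<comment> \<open>For n = 0 there is no set \<open>N j\<close> to intersect with, and
      \<open>D\<close> is just the intersection of \<open>N1\<close> and \<open>U1\<close>.\<close>
    have "openin (mtop X) (if n = 0 then N1 \<inter> U1 else (N1 \<inter> U1) \<inter> (\<Inter>j\<in>{..<n}. N j))"
      using o1 N(1) by (auto intro!: openin_Int openin_INT2)
    then show "openin (mtop X) D" unfolding D_def by (auto split: if_splits)
  qed (use xN1 d N(2) in \<open>auto simp: D_def\<close>)
  have oD: "openin (Euclidean_space n) (\<phi> ` D)" unfolding n_def using chart_subset_open[OF manifold d(1) D(1,3)] .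
  have "smooth_between n n (\<phi> ` D) (\<psi> \<circ> \<sigma> \<circ> inv_into U1 \<phi>)"
    unfolding smooth_between_def
  proof (intro allI impI)
    fix j assume j: "j < n"
    have oN: "openin (Euclidean_space n) (\<phi> ` N j)" unfolding n_def using chart_subset_open[OF manifold d(1) N(1,3)] .
    have "smooth_on n (\<phi> ` D) ((\<lambda>z. of_real (\<psi> (\<sigma> z) j) :: 'v) \<circ> inv_into U1 \<phi>)"
      using smooth_on_subset[OF oN N(4) oD] D(5)[OF j] by blast
    then show "smooth_on n (\<phi> ` D) (\<lambda>z. (\<psi> \<circ> \<sigma> \<circ> inv_into U1 \<phi>) z j)"
      unfolding smooth_on_def o_def by (intro allI Ck_on_of_real_cancel[OF oD, where 'v = 'v]) simp
  qed
  moreover have "\<sigma> ` D \<subseteq> U" using imN1 D(4) by blast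
  ultimately show ?thesis
    unfolding smooth_at_def n_def using D c d
    by (intro exI[of _ D] exI[of _ U1] exI[of _ \<phi>] exI[of _ U] exI[of _ \<psi>]) auto
qed

end

section \<open>The diffeomorphism induced by an invariant weakly grouplike element\<close>

locale hopf_algebroid_on_manifold =
  hausdorff_manifold M + hopf_algebroid M A
  for M :: "'m manifold" and A :: "('k::real_or_complex, 'm, 'a::ring) hopf_structure"
begin

abbreviation "\<iota> \<equiv> incl A"
abbreviation "S \<equiv> antipode A"
abbreviation "\<epsilon> \<equiv> counit A"

text \<open>The map T of the overview, defined for all f. It is linear in f throughout;
  multiplicativity and the other identities hold for f with \<open>unital_on f a\<close>.\<close>

definition transf :: "'a \<Rightarrow> ('m \<Rightarrow> 'k) \<Rightarrow> 'm \<Rightarrow> 'k"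
  where "transf a f = \<epsilon> (S (\<iota> f * a))"

lemma R_mult: "f \<in> Cc_infinity M \<Longrightarrow> g \<in> Cc_infinity M \<Longrightarrow> (\<lambda>x. f x * g x :: 'k) \<in> Cc_infinity M"
  using Cc_mult[of f "points M" g] by (simp add: Cc_infinity_on_points)

lemma R_zero: "(\<lambda>_. 0 :: 'k) \<in> Cc_infinity M"
  using Cc_zero[of "points M"] by (simp add: Cc_infinity_on_points)

lemma incl_zero: "\<iota> (\<lambda>_. 0) = 0"
  using incl_add[OF R_zero R_zero] by simp

lemma incl_commute: "f \<in> Cc_infinity M \<Longrightarrow> g \<in> Cc_infinity M \<Longrightarrow> \<iota> f * \<iota> g = \<iota> g * \<iota> f"
  using incl_mult[of f g] incl_mult[of g f] by (simp add: mult.commute)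

lemma incl_absorb:
  assumes "f \<in> Cc_infinity M" "g \<in> Cc_infinity M" "\<And>x. f x * g x = f x"
  shows "\<iota> f * \<iota> g = \<iota> f"
proof -
  have "(\<lambda>x. f x * g x) = f" using assms(3) by (intro ext)
  then show ?thesis using incl_mult[OF assms(1,2)] by simp
qed

lemma tensor_eqI:
  assumes "tensor_cong UNIV (+) 0 {((\<iota> f * a, b), (a, \<iota> f * b)) |f a b. f \<in> Cc_infinity M} p q"
  shows "tensor M A p = tensor M A q"
  unfolding tensor_def
proof (intro Collect_cong iffI)
  fix r
  note t = tensor_cong.trans
  show "tensor_cong UNIV (+) 0 {((\<iota> f * a, b), (a, \<iota> f * b)) |f a b. f \<in> Cc_infinity M} q r"
    if "tensor_cong UNIV (+) 0 {((\<iota> f * a, b), (a, \<iota> f * b)) |f a b. f \<in> Cc_infinity M} p r"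
    by (rule t[OF tensor_cong.sym[OF assms] that])
  show "tensor_cong UNIV (+) 0 {((\<iota> f * a, b), (a, \<iota> f * b)) |f a b. f \<in> Cc_infinity M} p r"
    if "tensor_cong UNIV (+) 0 {((\<iota> f * a, b), (a, \<iota> f * b)) |f a b. f \<in> Cc_infinity M} q r"
    by (rule t[OF assms that])
qed

lemma tensor_eqD:
  assumes "tensor M A p = tensor M A q"
  shows "tensor_cong UNIV (+) 0 {((\<iota> f * a, b), (a, \<iota> f * b)) |f a b. f \<in> Cc_infinity M} p q"
proof -
  have "q \<in> tensor M A q" unfolding tensor_def using tensor_cong.refl[of q UNIV] by simp
  then show ?thesis using assms unfolding tensor_def by blast
qed

lemma tensor_balanced:
  assumes "f \<in> Cc_infinity M" shows "tensor M A {#(\<iota> f * a, b)#} = tensor M A {#(a, \<iota> f * b)#}"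
  by (rule tensor_eqI, rule tensor_cong.balanced) (use assms in blast)

section \<open>The axioms for tensors with a single term\<close>

lemma comult_mult1:
  "comult A a = tensor M A {#(x, y)#} \<Longrightarrow> comult A b = tensor M A {#(x', y')#} \<Longrightarrow>
    comult A (a * b) = tensor M A {#(x * x', y * y')#}"
  using comult_mult[of a "{#(x, y)#}" b "{#(x', y')#}"] by simp

lemma comult_left1:
  "f \<in> Cc_infinity M \<Longrightarrow> comult A a = tensor M A {#(x, y)#} \<Longrightarrow> comult A (\<iota> f * a) = tensor M A {#(\<iota> f * x, y)#}"
  using comult_left[of f a "{#(x, y)#}"] by simp

lemma right_actions1:
  "f \<in> Cc_infinity M \<Longrightarrow> comult A a = tensor M A {#(x, y)#} \<Longrightarrow>
    tensor M A {#(x * \<iota> f, y)#} = tensor M A {#(x, y * \<iota> f)#}"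
  using comult_right_actions[of f a "{#(x, y)#}"] by simp

lemma counit_left1: "comult A a = tensor M A {#(x, y)#} \<Longrightarrow> \<iota> (\<epsilon> x) * y = a"
  using counit_law_left[of a "{#(x, y)#}"] by simp

lemma antipode1: "comult A a = tensor M A {#(x, y)#} \<Longrightarrow> S x * y = \<iota> (\<epsilon> (S a))"
  using antipode_left[of a "{#(x, y)#}"] by simp

lemma comult_incl1:
  assumes "f \<in> Cc_infinity M" "h \<in> Cc_infinity M" "\<iota> f * \<iota> h = \<iota> f"
  shows "comult A (\<iota> f) = tensor M A {#(\<iota> f, \<iota> h)#}"
  using comult_incl[OF assms(1,2)] assms(3) by simp

text \<open>\<Delta>(f) = f \<otimes> h for every h in the base ring with fh = f. With h chosen so
  that also yh = y, the product \<Delta>(a)\<Delta>(f) becomes xf \<otimes> y.\<close>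

lemma comult_right1:
  assumes f: "f \<in> Cc_infinity M" and a: "comult A a = tensor M A {#(x, y)#}"
  shows "comult A (a * \<iota> f) = tensor M A {#(x * \<iota> f, y)#}"
proof -
  obtain h where h: "h \<in> Cc_infinity M" "y * \<iota> h = y" "\<iota> f * \<iota> h = \<iota> f"
    using local_identities[of "{y, \<iota> f}"] by auto
  show ?thesis using comult_mult1[OF a comult_incl1[OF f h(1,3)]] h(2) by simp
qed

lemma antipode_incl_mult: "f \<in> Cc_infinity M \<Longrightarrow> S (\<iota> f * a) = S a * \<iota> f"
  by (simp add: antipode_mult antipode_incl)

lemma transf_closed: "transf a f \<in> Cc_infinity M"
  by (simp add: transf_def counit_closed)

lemma transf_add: "f \<in> Cc_infinity M \<Longrightarrow> g \<in> Cc_infinity M \<Longrightarrow>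
    transf a (\<lambda>x. f x + g x) = (\<lambda>x. transf a f x + transf a g x)"
  by (simp add: transf_def incl_add distrib_right antipode_add counit_add)

lemma transf_scale: "f \<in> Cc_infinity M \<Longrightarrow> transf a (\<lambda>x. c * f x) = (\<lambda>x. c * transf a f x)"
  by (simp add: transf_def incl_scale scale_mult_left antipode_scale counit_scale)

text \<open>The companion a' is kept visible because the identities for \<open>a\<close> are derived
  through it.\<close>

definition invariant_pair :: "'a \<Rightarrow> 'a \<Rightarrow> bool"
  where "invariant_pair a a' \<longleftrightarrow> comult A a = tensor M A {#(a, a')#} \<and>
    comult A (S a) = tensor M A {#(S a', S a)#}"

abbreviation "GS \<equiv> S_invariant_weakly_grouplike M A"

lemma GS_iff: "a \<in> GS \<longleftrightarrow> (\<exists>a'. invariant_pair a a')"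
  by (simp add: S_invariant_weakly_grouplike_def invariant_pair_def)

lemma invariant_pair_mult:
  "invariant_pair b b' \<Longrightarrow> invariant_pair a a' \<Longrightarrow> invariant_pair (b * a) (b' * a')"
  by (simp add: invariant_pair_def comult_mult1 antipode_mult)

lemma GS_mult: "b \<in> GS \<Longrightarrow> a \<in> GS \<Longrightarrow> b * a \<in> GS"
  using invariant_pair_mult GS_iff by blast

text \<open>If h acts as identity on \<open>f\<close>, then \<Delta>(f) is both f \<otimes> h and h
  \<otimes> f. As S fixes the base ring, these are the two conditions on the pair (f, h).\<close>

lemma GS_incl:
  assumes f: "f \<in> Cc_infinity M" shows "\<iota> f \<in> GS"
proof -
  obtain h where h: "h \<in> Cc_infinity M" "\<iota> h * \<iota> f = \<iota> f" "\<iota> f * \<iota> h = \<iota> f"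
    using local_identities[of "{\<iota> f}"] by auto
  have "comult A (\<iota> f) = tensor M A {#(\<iota> h, \<iota> f)#}" using comult_incl[OF h(1) f] h(2) by simp
  then have "invariant_pair (\<iota> f) (\<iota> h)"
    using comult_incl1[OF f h(1,3)] f h(1) by (simp add: invariant_pair_def antipode_incl)
  then show ?thesis using GS_iff by blast
qed

text \<open>The antipode axiom for S(a), whose comultiplication is S(a') \<otimes> S(a), combined
  with S \<circ> S = id.\<close>

lemma counit_eq: "invariant_pair a a' \<Longrightarrow> a' * S a = \<iota> (\<epsilon> a)"
  using antipode1[of "S a" "S a'" "S a"] by (simp add: invariant_pair_def antipode_antipode)

text \<open>S(fa) = S(a)f, and right multiplication by \<open>f\<close> acts on the first factor of
  \<Delta>(S(a)) = S(a') \<otimes> S(a), where S(a')f = S(fa').\<close>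

lemma comult_antipode_incl_mult:
  assumes a: "invariant_pair a a'" and f: "f \<in> Cc_infinity M"
  shows "comult A (S (\<iota> f * a)) = tensor M A {#(S (\<iota> f * a'), S a)#}"
proof -
  have c: "comult A (S a) = tensor M A {#(S a', S a)#}" using a by (simp add: invariant_pair_def)
  show "comult A (S (\<iota> f * a)) = tensor M A {#(S (\<iota> f * a'), S a)#}"
    using comult_right1[OF f c] by (simp add: antipode_incl_mult[OF f])
qed

text \<open>The algebraic form of being supported where \<open>a\<close> is normalized:
  \<epsilon>(a) is 1 wherever f is nonzero. It passes to products of f with any function of the base
  ring.\<close>

definition unital_on :: "('m \<Rightarrow> 'k) \<Rightarrow> 'a \<Rightarrow> bool"
  where "unital_on f a \<longleftrightarrow> f \<in> Cc_infinity M \<and> (\<forall>x. f x * \<epsilon> a x = f x)"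

lemma unital_onD: "unital_on f a \<Longrightarrow> f \<in> Cc_infinity M"
  by (simp add: unital_on_def)

lemma unital_on_mult: "unital_on f a \<Longrightarrow> g \<in> Cc_infinity M \<Longrightarrow> unital_on (\<lambda>x. f x * g x) a"
  by (auto simp: unital_on_def R_mult)

context
  fixes a a' assumes a: "invariant_pair a a'"
begin

text \<open>By the counit law a = \<epsilon>(a)a', and \<open>f\<close> absorbs the factor
  \<epsilon>(a).\<close>

lemma incl_prime:
  assumes f: "unital_on f a" shows "\<iota> f * a' = \<iota> f * a"
proof -
  have "\<iota> (\<epsilon> a) * a' = a" using counit_left1 a by (simp add: invariant_pair_def)
  moreover have "\<iota> f * \<iota> (\<epsilon> a) = \<iota> f" using f by (intro incl_absorb) (auto simp: unital_on_def counit_closed)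
  ultimately show ?thesis by (metis mult.assoc)
qed

text \<open>\<Delta>(S(fa)) = S(fa') \<otimes> S(a) = S(fa) \<otimes> S(a) by invariance. The second
  condition concerns fa itself: \<Delta>(fa) = fa \<otimes> a' = a \<otimes> fa' = a \<otimes> fa,
  by moving \<open>f\<close> across the tensor sign.\<close>

lemma invariant_pair_antipode:
  assumes f: "unital_on f a" shows "invariant_pair (S (\<iota> f * a)) (S a)"
proof -
  have fR: "f \<in> Cc_infinity M" using f by (rule unital_onD)
  have "comult A (\<iota> f * a) = tensor M A {#(\<iota> f * a, a')#}"
    using comult_left1[OF fR] a by (simp add: invariant_pair_def)
  also have "\<dots> = tensor M A {#(a, \<iota> f * a)#}" using tensor_balanced[OF fR, of a a'] incl_prime[OF f] by simp
  finally have "comult A (\<iota> f * a) = tensor M A {#(a, \<iota> f * a)#}" .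
  then show ?thesis
    using comult_antipode_incl_mult[OF a fR] incl_prime[OF f] by (simp add: invariant_pair_def antipode_antipode)
qed

text \<open>\<Delta>(S(fga)) = \<Delta>(S(fa)g) = S(fa) \<otimes> S(a)g = S(fa) \<otimes> S(ga),
  where g changes sides because the two right actions agree on the image of \<Delta>. The counit law
  turns this into S(fga) = (T f)S(ga), and \<epsilon> is left linear.\<close>

lemma transf_mult:
  assumes f: "unital_on f a" and g: "unital_on g a"
  shows "transf a (\<lambda>x. f x * g x) = (\<lambda>x. transf a f x * transf a g x)"
proof -
  have fR: "f \<in> Cc_infinity M" and gR: "g \<in> Cc_infinity M" using f g unital_onD by blast+
  have c: "comult A (S (\<iota> f * a)) = tensor M A {#(S (\<iota> f * a), S a)#}"
    using comult_antipode_incl_mult[OF a fR] incl_prime[OF f] by simp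
  have "S (\<iota> (\<lambda>x. f x * g x) * a) = S (\<iota> f * a) * \<iota> g"
    using incl_mult[OF fR gR] incl_commute[OF fR gR] antipode_incl_mult[OF gR, of "\<iota> f * a"] by (simp add: mult.assoc)
  then have "comult A (S (\<iota> (\<lambda>x. f x * g x) * a)) = tensor M A {#(S (\<iota> f * a), S (\<iota> g * a))#}"
    using comult_right1[OF gR c] right_actions1[OF gR c] antipode_incl_mult[OF gR] by simp
  then have "S (\<iota> (\<lambda>x. f x * g x) * a) = \<iota> (transf a f) * S (\<iota> g * a)"
    unfolding transf_def by (rule counit_left1[symmetric])
  then show ?thesis using counit_left[OF transf_closed] by (simp add: transf_def)
qed

text \<open>The antipode axiom for \<Delta>(fa) = fa \<otimes> a' reads S(fa)a' = T f, and S(fa)a' =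
  S(a)fa' = S(a)fa.\<close>

lemma antipode_incl_self:
  assumes f: "unital_on f a" shows "S a * (\<iota> f * a) = \<iota> (transf a f)"
proof -
  have fR: "f \<in> Cc_infinity M" using f by (rule unital_onD)
  have "comult A (\<iota> f * a) = tensor M A {#(\<iota> f * a, a')#}"
    using comult_left1[OF fR] a by (simp add: invariant_pair_def)
  from antipode1[OF this] show ?thesis
    using incl_prime[OF f] by (simp add: transf_def antipode_incl_mult[OF fR] mult.assoc)
qed

text \<open>Here fa = fa', and a'S(a) = \<epsilon>(a) is absorbed by \<open>f\<close>.\<close>

lemma incl_self_antipode:
  assumes f: "unital_on f a" shows "\<iota> f * a * S a = \<iota> f"
proof -
  have "\<iota> f * a * S a = \<iota> f * (a' * S a)" using incl_prime[OF f] by (metis mult.assoc)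
  also have "\<dots> = \<iota> f" unfolding counit_eq[OF a] using f by (intro incl_absorb) (auto simp: unital_on_def counit_closed)
  finally show ?thesis .
qed

text \<open>S(a)f = S(a)(faS(a)) = (S(a)fa)S(a) = (T f)S(a).\<close>

lemma antipode_incl_commute:
  assumes f: "unital_on f a" shows "S a * \<iota> f = \<iota> (transf a f) * S a"
  using incl_self_antipode[OF f] antipode_incl_self[OF f] by (metis mult.assoc)

text \<open>The preceding commutation rule, read after applying S.\<close>

lemma incl_commute_transf:
  assumes f: "unital_on f a" shows "\<iota> f * a = a * \<iota> (transf a f)"
proof -
  have "S (S a * \<iota> f) = S (\<iota> (transf a f) * S a)" using antipode_incl_commute[OF f] by simp
  then show ?thesis
    by (simp add: antipode_mult antipode_antipode antipode_incl unital_onD[OF f] transf_closed)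
qed

text \<open>T f = 0 gives fa = a(T f) = 0, and then f = f\<epsilon>(a) = \<epsilon>(fa) = 0.\<close>

lemma transf_eq_zero:
  assumes f: "unital_on f a" and z: "transf a f = (\<lambda>_. 0)" shows "f = (\<lambda>_. 0)"
proof -
  have "\<iota> f * a = \<iota> (\<lambda>_. 0) * a" using incl_commute_transf[OF f] z by (simp add: incl_zero)
  then have "(\<lambda>x. f x * \<epsilon> a x) = (\<lambda>x. 0)"
    using counit_left[OF unital_onD[OF f], of a] counit_left[OF R_zero, of a] by simp
  then have "f x = 0" for x using f unfolding unital_on_def by metis
  then show ?thesis by (intro ext)
qed

text \<open>This is why the image of T is an ideal. The antipode axiom for gS(a) gives a'gS(a) =
  \<epsilon>(ag), so that f\<epsilon>(ag) = fagS(a) in the algebra. Hence T(f\<epsilon>(ag)) =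
  (S(a)fa) g (S(a)ha) = (T f)g(T h), and T h is absorbed by T f. The local unit h is inserted to
  bring the last factor into the form S(a)ha.\<close>

lemma transf_ideal:
  assumes f: "unital_on f a" and h: "unital_on h a" "\<And>x. f x * h x = f x" and g: "g \<in> Cc_infinity M"
  shows "transf a (\<lambda>x. f x * \<epsilon> (a * \<iota> g) x) = (\<lambda>x. transf a f x * g x)"
proof -
  let ?\<phi> = "\<lambda>x. f x * \<epsilon> (a * \<iota> g) x"
  have fR: "f \<in> Cc_infinity M" and hR: "h \<in> Cc_infinity M" using f h(1) unital_onD by blast+
  have \<phi>: "unital_on ?\<phi> a" using unital_on_mult[OF f counit_closed] .
  have "comult A (\<iota> g * S a) = tensor M A {#(\<iota> g * S a', S a)#}"
    using comult_left1[OF g] a by (simp add: invariant_pair_def)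
  from antipode1[OF this] have 1: "a' * (\<iota> g * S a) = \<iota> (\<epsilon> (a * \<iota> g))"
    using g by (simp add: antipode_mult antipode_antipode antipode_incl mult.assoc)
  have "\<iota> ?\<phi> = \<iota> f * a' * (\<iota> g * S a)" using incl_mult[OF fR counit_closed] 1 by (simp add: mult.assoc)
  then have 2: "\<iota> ?\<phi> = \<iota> f * a * (\<iota> g * S a)" using incl_prime[OF f] by simp
  have 3: "\<iota> ?\<phi> * \<iota> h = \<iota> ?\<phi>"
    using h(2) by (intro incl_absorb unital_onD[OF \<phi>] hR) (simp add: mult.assoc mult.left_commute mult.commute, metis mult.commute mult.left_commute)
  have "\<iota> (transf a ?\<phi>) = S a * (\<iota> ?\<phi> * a)" using antipode_incl_self[OF \<phi>] by simp
  also have "\<dots> = S a * (\<iota> ?\<phi> * (\<iota> h * a))" using 3 by (simp only: mult.assoc[symmetric])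
  also have "\<dots> = (S a * (\<iota> f * a)) * \<iota> g * (S a * (\<iota> h * a))" by (simp only: 2 mult.assoc)
  also have "\<dots> = \<iota> (transf a f) * \<iota> g * \<iota> (transf a h)" using antipode_incl_self[OF f] antipode_incl_self[OF h(1)] by simp
  also have "\<dots> = \<iota> (\<lambda>x. transf a f x * g x * transf a h x)"
    using incl_mult transf_closed g R_mult by simp
  also have "(\<lambda>x. transf a f x * g x * transf a h x) = (\<lambda>x. transf a (\<lambda>x. f x * h x) x * g x)"
    using transf_mult[OF f h(1)] by (simp add: mult.assoc mult.commute mult.left_commute)
  also have "(\<lambda>x. f x * h x) = f" by (rule ext) (rule h(2))
  finally have "\<iota> (transf a ?\<phi>) = \<iota> (\<lambda>x. transf a f x * g x)" .
  then show ?thesis by (rule inj_onD[OF incl_inj]) (intro transf_closed R_mult g)+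
qed

end

lemma normalized_at_nbhd:
  assumes "normalized_at M A a y"
  obtains W where "openin (mtop M) W" "y \<in> W" "\<And>x. x \<in> W \<Longrightarrow> normalized_at M A a x"
proof -
  obtain W where "openin (mtop M) W" "y \<in> W" "\<forall>x\<in>W. \<epsilon> a x = 1"
    using assms unfolding normalized_at_def same_germ_def by blast
  then show thesis by (intro that[of W]) (auto simp: normalized_at_def same_germ_def)
qed

lemma normalized_at_point: "normalized_at M A a y \<Longrightarrow> y \<in> points M"
  unfolding normalized_at_def by (rule same_germ_point)

lemma normalized_unital_on:
  assumes "\<And>x. x \<in> W \<Longrightarrow> normalized_at M A a x" "f \<in> Cc_infinity_on M W"
  shows "unital_on f a"
proof -
  have "f x * \<epsilon> a x = f x" for x
  proof (cases "x \<in> W")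
    case True
    then show ?thesis using same_germ_value[of M x "\<epsilon> a" "\<lambda>_. 1"] assms(1) by (simp add: normalized_at_def)
  qed (use Cc_infinity_on_zero[OF assms(2)] in auto)
  then show ?thesis using assms(2) by (simp add: unital_on_def Cc_infinity_onD)
qed

section \<open>Existence and uniqueness of the induced diffeomorphism\<close>

lemma transport_exists:
  assumes aGS: "a \<in> GS" and W: "openin (mtop M) W" and norm: "\<And>x. x \<in> W \<Longrightarrow> normalized_at M A a x"
  shows "\<exists>V \<tau>. is_transport M A W a V \<tau>"
proof -
  obtain a' where a: "invariant_pair a a'" using aGS GS_iff by blast
  have u: "unital_on f a" if "f \<in> Cc_infinity_on M W" for f
    using normalized_unital_on[OF norm that] .
  let ?R = "Cc_infinity_on M :: 'm set \<Rightarrow> ('m \<Rightarrow> 'k) set"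
  let ?T = "transf a"
  \<comment> \<open>Exactly the points x at which evaluating T f gives a nonzero character.\<close>
  define V where "V = (\<Union>f\<in>?R W. {x. ?T f x \<noteq> 0})"
  have oV: "openin (mtop M) V"
    unfolding V_def by (intro openin_Union) (auto intro: Cc_nonzero_open transf_closed)
  have "\<exists>y\<in>W. \<forall>f\<in>?R W. ?T f x = f y" if x: "x \<in> V" for x
  proof -
    obtain f0 where f0: "f0 \<in> ?R W" "?T f0 x \<noteq> 0" using x by (auto simp: V_def)
    show ?thesis
      using f0 by (intro character_is_evaluation[OF W, of "\<lambda>f. ?T f x" f0])
        (simp_all add: transf_add transf_scale transf_mult[OF a] u Cc_infinity_onD)
  qed
  then obtain \<tau>0 where \<tau>0: "\<And>x. x \<in> V \<Longrightarrow> \<tau>0 x \<in> W" "\<And>x f. x \<in> V \<Longrightarrow> f \<in> ?R W \<Longrightarrow> ?T f x = f (\<tau>0 x)"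
    by metis
  define \<tau> where "\<tau> = restrict \<tau>0 V"
  have \<tau>W: "\<tau> x \<in> W" if "x \<in> V" for x using \<tau>0(1) that by (simp add: \<tau>_def)
  have T: "?T f x = f (\<tau> x)" if "x \<in> V" "f \<in> ?R W" for x f using \<tau>0(2) that by (simp add: \<tau>_def)
  have T0: "?T f x = 0" if "x \<notin> V" "f \<in> ?R W" for x f using that by (auto simp: V_def)
  have Teq: "?T f = (\<lambda>x. if x \<in> V then f (\<tau> x) else 0)" if "f \<in> ?R W" for f
    using T T0 that by auto
  have smooth: "smooth_at M M \<tau> x" if x: "x \<in> V" for x
  \<comment> \<open>On V the pullback of g along \<tau> is T g, which belongs to the base ring and
    is therefore smooth.\<close>
  proof (rule smooth_at_if_pullbacks_smooth[OF oV W \<tau>W _ x])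
    fix g :: "'m \<Rightarrow> 'k" and z assume g: "g \<in> ?R W" and z: "z \<in> V"
    have "smooth_fun_at M (?T g) z" using Cc_smooth[OF transf_closed] openin_subset[OF oV] z by blast
    then show "smooth_fun_at M (\<lambda>z. g (\<tau> z)) z"
      by (rule smooth_fun_at_cong[OF manifold _ oV z]) (use T g in auto)
  qed
  have cont: "continuous_map (subtopology (mtop M) V) (mtop M) \<tau>"
    by (rule smooth_at_continuous[OF manifold manifold oV smooth])
  have comp: "compactin (mtop M) (\<tau> ` K)" if "compactin (mtop M) K" "K \<subseteq> V" for K
    using that by (intro image_compactin[OF _ cont]) (simp add: compactin_subtopology)
  have supp: "?T f \<in> ?R V" if f: "f \<in> ?R W" for f
  proof -
    \<comment> \<open>A local unit h of \<open>f\<close> gives (T f)(T h) = T f, so T f vanishes off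
      the closed set where T h = 1. This set lies in V because T h is 0 outside V.\<close>
    obtain h where h: "h \<in> ?R W" "\<And>x. f x * h x = f x" using local_unit[OF W f] by blast
    have "(\<lambda>x. f x * h x) = f" using h(2) by auto
    then have fh: "?T f x * ?T h x = ?T f x" for x using transf_mult[OF a u[OF f] u[OF h(1)]] by metis
    have "continuous_map (mtop M) euclidean (?T h)"
      using transf_closed by (intro smooth_function_continuous[OF manifold]) (simp add: Cc_infinity_def)
    then have "closedin (mtop M) {x \<in> points M. ?T h x \<in> {1}}"
      by (rule closedin_continuous_map_preimage) simp
    then have "support M (?T f) \<subseteq> {x \<in> points M. ?T h x \<in> {1}}"
      using fh by (intro support_minimal) auto
    also have "\<dots> \<subseteq> V" using T0[OF _ h(1)] by force
    finally show ?thesis using transf_closed by (simp add: Cc_infinity_on_def)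
  qed
  have ideal: "\<exists>\<phi>\<in>?R W. ?T \<phi> = (\<lambda>x. ?T f x * g x)" if f: "f \<in> ?R W" and g: "g \<in> Cc_infinity M" for f g
  proof -
    obtain h where h: "h \<in> ?R W" "\<And>x. f x * h x = f x" using local_unit[OF W f] by blast
    show ?thesis
      using transf_ideal[OF a u[OF f] u[OF h(1)] h(2) g] Cc_mult[OF f counit_closed[of "a * \<iota> g"]] by blast
  qed
  have inj: "inj_on \<tau> V"
  proof (rule inj_onI, rule ccontr)
    fix x x' assume x: "x \<in> V" "x' \<in> V" "\<tau> x = \<tau> x'" "x \<noteq> x'"
    obtain g :: "'m \<Rightarrow> 'k" where g: "g \<in> ?R V" "g x = 1" "g x' = 0"
      using separating_function[OF oV x(1) _ x(4)] openin_subset[OF oV] x(2) by blast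
    obtain f :: "'m \<Rightarrow> 'k" where f: "f \<in> ?R W" "same_germ M (\<tau> x) f (\<lambda>_. 1)"
      using exists_bump[OF W \<tau>W[OF x(1)]] by blast
    \<comment> \<open>On V the function (T f)g = T \<phi> factors through \<tau>, so it takes the
      same value at x and x'; but it is 1 at x and 0 at x'.\<close>
    obtain \<phi> where \<phi>: "\<phi> \<in> ?R W" "?T \<phi> = (\<lambda>x. ?T f x * g x)" using ideal[OF f(1) Cc_infinity_onD[OF g(1)]] by blast
    have "\<phi> (\<tau> x) = f (\<tau> x) * g x" "\<phi> (\<tau> x') = f (\<tau> x') * g x'"
      using \<phi> T x(1,2) f(1) by metis+
    then show False using x(3) g same_germ_value[OF f(2)] by simp
  qed
  have surj: "\<tau> ` V = W"
  proof
    show "\<tau> ` V \<subseteq> W" using \<tau>W by blast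
    show "W \<subseteq> \<tau> ` V"
    proof (rule subsetI, rule ccontr)
      fix y assume y: "y \<in> W" "y \<notin> \<tau> ` V"
      obtain h :: "'m \<Rightarrow> 'k" where h: "h \<in> ?R W" "same_germ M y h (\<lambda>_. 1)" using exists_bump[OF W y(1)] by blast
      \<comment> \<open>The image of K under \<tau> is compact, hence closed, and misses y. For g
        supported off this image (T h)(T g) vanishes, so T(hg) = 0 although hg is 1 at y, against
        injectivity of T.\<close>
      define K where "K = support M (?T h)"
      have K: "compactin (mtop M) K" "K \<subseteq> V"
        using supp[OF h(1)] by (auto simp: K_def Cc_infinity_on_def Cc_infinity_def)
      have "openin (mtop M) (W - \<tau> ` K)"
        using W compactin_imp_closedin[OF Hausdorff comp[OF K]] by (intro openin_diff)
      then obtain g :: "'m \<Rightarrow> 'k" where g: "g \<in> ?R (W - \<tau> ` K)" "same_germ M y g (\<lambda>_. 1)"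
        using exists_bump[of "W - \<tau> ` K" y] y K by blast
      have gW: "g \<in> ?R W" by (rule Cc_infinity_on_mono[OF _ g(1)]) blast
      have "?T h x * ?T g x = 0" for x
      proof (cases "x \<in> K")
        case True
        then have "?T g x = g (\<tau> x)" using T[OF _ gW] K by blast
        then show ?thesis using True Cc_infinity_on_zero[OF g(1), of "\<tau> x"] by simp
      next
        case False
        then show ?thesis using zero_outside_support[OF transf_closed, of x a h] by (simp add: K_def)
      qed
      then have z: "?T (\<lambda>x. h x * g x) = (\<lambda>_. 0)" using transf_mult[OF a u[OF h(1)] u[OF gW]] by (simp only:)
      have "(\<lambda>x. h x * g x) = (\<lambda>_. 0)"
        by (rule transf_eq_zero[OF a unital_on_mult[OF u[OF h(1)] Cc_infinity_onD[OF gW]] z])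
      then show False using same_germ_value[OF h(2)] same_germ_value[OF g(2)] by (metis mult.right_neutral zero_neq_one)
    qed
  qed
  have bij: "bij_betw \<tau> V W" using inj surj by (simp add: bij_betw_def)
  have onto: "\<exists>\<phi>\<in>?R W. ?T \<phi> = g" if g: "g \<in> ?R V" for g
  proof -
    have K: "compactin (mtop M) (support M g)" "support M g \<subseteq> V"
      using g by (auto simp: Cc_infinity_on_def Cc_infinity_def)
    have "\<tau> ` support M g \<subseteq> W" using K(2) \<tau>W by blast
    \<comment> \<open>T f is 1 on the support of g, so g = (T f)g belongs to the image of T by the
      ideal property.\<close>
    then obtain f :: "'m \<Rightarrow> 'k" and N where f: "f \<in> ?R W" "\<tau> ` support M g \<subseteq> N" "\<forall>x\<in>N. f x = 1"
      using exists_bump_compact[OF comp[OF K] W] by blast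
    have "?T f x * g x = g x" for x
    proof (cases "x \<in> support M g")
      case True then show ?thesis using f T[OF _ f(1), of x] K(2) by (auto simp: image_subset_iff subset_iff)
    qed (use zero_outside_support[OF Cc_infinity_onD[OF g]] in auto)
    then have "(\<lambda>x. ?T f x * g x) = g" by (intro ext)
    then show ?thesis using ideal[OF f(1) Cc_infinity_onD[OF g]] by simp
  qed
  have smooth_inv: "smooth_at M M (inv_into V \<tau>) y" if y: "y \<in> W" for y
  proof (rule smooth_at_if_pullbacks_smooth[OF W oV _ _ y])
    have inv: "inv_into V \<tau> w \<in> V" "\<tau> (inv_into V \<tau> w) = w" if "w \<in> W" for w
      using surj that by (auto intro: inv_into_into f_inv_into_f)
    then show "inv_into V \<tau> w \<in> V" if "w \<in> W" for w using that by blast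
    fix g :: "'m \<Rightarrow> 'k" and z assume g: "g \<in> ?R V" and z: "z \<in> W"
    \<comment> \<open>If T \<phi> = g, then on W the pullback of g along the inverse of \<tau> is
      \<phi>, hence smooth.\<close>
    obtain \<phi> where \<phi>: "\<phi> \<in> ?R W" "?T \<phi> = g" using onto[OF g] by blast
    have "smooth_fun_at M \<phi> z" using Cc_smooth[OF Cc_infinity_onD[OF \<phi>(1)]] openin_subset[OF W] z by blast
    then show "smooth_fun_at M (\<lambda>w. g (inv_into V \<tau> w)) z"
      by (rule smooth_fun_at_cong[OF manifold _ W z]) (use T[OF _ \<phi>(1)] \<phi>(2) inv in metis)
  qed
  have "is_transport M A W a V \<tau>"
    unfolding is_transport_def diffeomorphism_open_submanifold_iff[OF manifold manifold oV W] transf_def[symmetric]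
  proof (intro conjI ballI oV bij smooth smooth_inv)
    show "\<tau> \<in> extensional V" by (simp add: \<tau>_def)
    show "transf a f = (\<lambda>x. if x \<in> V then f (\<tau> x) else 0)" if "f \<in> ?R W" for f using Teq[OF that] .
    show "transf a ` ?R W = ?R V" using supp onto by force
  qed
  then show ?thesis by blast
qed

text \<open>V is recovered from the functions compactly supported in it, and \<tau> by functions
  that separate the points of W. The definite description in \<open>transport_inv\<close> rests on
  this.\<close>

lemma transport_unique:
  assumes W: "openin (mtop M) W" and 1: "is_transport M A W a V \<tau>" and 2: "is_transport M A W a V' \<tau>'"
  shows "V = V' \<and> \<tau> = \<tau>'"
proof -
  let ?R = "Cc_infinity_on M :: 'm set \<Rightarrow> ('m \<Rightarrow> 'k) set"
  have oV: "openin (mtop M) V" and oV': "openin (mtop M) V'" using 1 2 by (simp_all add: is_transport_def)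
  have "(\<lambda>f. \<epsilon> (S (\<iota> f * a))) ` ?R W = ?R V" "(\<lambda>f. \<epsilon> (S (\<iota> f * a))) ` ?R W = ?R V'"
    using 1 2 unfolding is_transport_def by blast+
  then have R: "?R V = ?R V'" by (rule subst)
  have sub: "x \<in> V2" if V1: "openin (mtop M) V1" "?R V1 = ?R V2" "x \<in> V1" for V1 V2 x
  proof -
    obtain g :: "'m \<Rightarrow> 'k" where g: "g \<in> ?R V1" "same_germ M x g (\<lambda>_. 1)" using exists_bump[OF V1(1,3)] by blast
    then show ?thesis using Cc_infinity_on_zero[of g M V2 x] same_germ_value[OF g(2)] V1(2) by auto
  qed
  have VV: "V = V'" using sub[OF oV R] sub[OF oV' R[symmetric]] by blast
  have "\<tau> x = \<tau>' x" for x
  proof (cases "x \<in> V")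
    case True
    have b: "bij_betw \<tau> V W" "bij_betw \<tau>' V W"
      using 1 2 unfolding is_transport_def VV diffeomorphism_open_submanifold_iff[OF manifold manifold oV' W] by auto
    then have \<tau>: "\<tau> x \<in> W" "\<tau>' x \<in> W" using True bij_betwE by blast+
    show ?thesis
    proof (rule ccontr)
      assume "\<tau> x \<noteq> \<tau>' x"
      then obtain f :: "'m \<Rightarrow> 'k" where f: "f \<in> ?R W" "f (\<tau> x) = 1" "f (\<tau>' x) = 0"
        using separating_function[OF W \<tau>(1)] openin_subset[OF W] \<tau>(2) by blast
      have *: "\<epsilon> (S (\<iota> f * a)) x = f (\<sigma> x)" if "is_transport M A W a V \<sigma>" for \<sigma>
        using that f(1) True unfolding is_transport_def by auto
      have "f (\<tau> x) = f (\<tau>' x)" using *[OF 1] *[of \<tau>'] 2 VV by simp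
      then show False using f by simp
    qed
  next
    case False
    have "\<tau> x = undefined" using 1 False by (intro extensional_arb[of \<tau> V]) (simp_all add: is_transport_def)
    moreover have "\<tau>' x = undefined" using 2 False VV by (intro extensional_arb[of \<tau>' V']) (simp_all add: is_transport_def)
    ultimately show ?thesis by simp
  qed
  then show ?thesis using VV by auto
qed

text \<open>The properties of the inverse of \<tau> in terms of T. \<open>transport_inv_eqI\<close>
  recognizes the source point by test functions supported in an arbitrarily small neighbourhood of
  y; independence of W and of the representative follows from it.\<close>

lemma
  assumes aGS: "a \<in> GS" and W: "openin (mtop M) W" and norm: "\<And>x. x \<in> W \<Longrightarrow> normalized_at M A a x"
  shows transport_inv_transf: "y \<in> W \<Longrightarrow> f \<in> Cc_infinity_on M W \<Longrightarrow> transf a f (transport_inv M A W a y) = f y"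
    and transport_inv_point: "y \<in> W \<Longrightarrow> transport_inv M A W a y \<in> points M"
    and transport_inv_etale: "etale_on M M (transport_inv M A W a) W"
    and transport_inv_eqI: "openin (mtop M) N \<Longrightarrow> N \<subseteq> W \<Longrightarrow> y \<in> N \<Longrightarrow>
      (\<And>f. f \<in> Cc_infinity_on M N \<Longrightarrow> transf a f x = f y) \<Longrightarrow> transport_inv M A W a y = x"
    and transport_inv_germ: "y \<in> W \<Longrightarrow> f \<in> Cc_infinity_on M W \<Longrightarrow> same_germ M y f (\<lambda>_. 1) \<Longrightarrow>
      same_germ M (transport_inv M A W a y) (transf a f) (\<lambda>_. 1)"
    and transport_inv_local_inverse: "g \<in> Cc_infinity_on M (transport_inv M A W a ` W) \<Longrightarrow>
      \<exists>\<phi>\<in>Cc_infinity_on M W. transf a \<phi> = g"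
    and transport_inv_support: "f \<in> Cc_infinity_on M W \<Longrightarrow> transf a f \<in> Cc_infinity_on M (transport_inv M A W a ` W)"
proof -
  let ?R = "Cc_infinity_on M :: 'm set \<Rightarrow> ('m \<Rightarrow> 'k) set"
  obtain V \<tau> where t: "is_transport M A W a V \<tau>" using transport_exists[OF assms] by blast
  have "(THE (V, \<tau>). is_transport M A W a V \<tau>) = (V, \<tau>)"
  proof (rule the_equality)
    show "case (V, \<tau>) of (V, \<tau>) \<Rightarrow> is_transport M A W a V \<tau>" using t by simp
    fix p assume p: "case p of (V, \<tau>) \<Rightarrow> is_transport M A W a V \<tau>"
    have "is_transport M A W a (fst p) (snd p)" using p by (simp add: split_beta)
    from transport_unique[OF W this t] show "p = (V, \<tau>)" by (simp add: prod_eq_iff)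
  qed
  then have inv: "transport_inv M A W a = inv_into V \<tau>" by (simp add: transport_inv_def)
  have oV: "openin (mtop M) V" using t by (simp add: is_transport_def)
  have d: "bij_betw \<tau> V W" "\<forall>x\<in>V. smooth_at M M \<tau> x" "\<forall>y\<in>W. smooth_at M M (inv_into V \<tau>) y"
    using t unfolding is_transport_def diffeomorphism_open_submanifold_iff[OF manifold manifold oV W] by auto
  have im: "\<tau> ` V = W" and inj: "inj_on \<tau> V" using d(1) by (auto simp: bij_betw_def)
  have T: "transf a f x = (if x \<in> V then f (\<tau> x) else 0)" if "f \<in> ?R W" for f x
    using t that unfolding is_transport_def transf_def by auto
  have onto: "transf a ` ?R W = ?R V"
    using t unfolding is_transport_def transf_def by auto
  have imV: "inv_into V \<tau> ` W = V" using im inj by force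
  have i: "inv_into V \<tau> y \<in> V" "\<tau> (inv_into V \<tau> y) = y" if "y \<in> W" for y
    using im that by (auto intro: inv_into_into f_inv_into_f)
  show "transf a f (transport_inv M A W a y) = f y" if "y \<in> W" "f \<in> ?R W" for y f
    unfolding inv using T[OF that(2)] i[OF that(1)] by simp
  show "transport_inv M A W a y \<in> points M" if "y \<in> W" for y
    unfolding inv using i[OF that] openin_subset[OF oV] by blast
  have "etale_on M M \<tau> V" unfolding etale_on_def using oV W im inj d by auto
  from etale_on_inv[OF manifold manifold this] show "etale_on M M (transport_inv M A W a) W" by (simp add: inv im)
  show "transport_inv M A W a y = x" if N: "openin (mtop M) N" "N \<subseteq> W" "y \<in> N"
    and f: "\<And>f. f \<in> ?R N \<Longrightarrow> transf a f x = f y" for N x y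
  proof -
    have NW: "?R N \<subseteq> ?R W" using Cc_infinity_on_mono[OF N(2)] by blast
    obtain b :: "'m \<Rightarrow> 'k" where b: "b \<in> ?R N" "same_germ M y b (\<lambda>_. 1)" using exists_bump[OF N(1,3)] by blast
    have "transf a b x = 1" using f[OF b(1)] same_germ_value[OF b(2)] by simp
    then have x: "x \<in> V" using T[of b x] b(1) NW by (auto split: if_splits)
    have "\<tau> x = y"
    proof (rule ccontr)
      assume "\<tau> x \<noteq> y"
      moreover have "\<tau> x \<in> points M" using x im openin_subset[OF W] by blast
      ultimately obtain g :: "'m \<Rightarrow> 'k" where g: "g \<in> ?R N" "g y = 1" "g (\<tau> x) = 0"
        using separating_function[OF N(1,3), of "\<tau> x"] by metis
      then show False using f[OF g(1)] T[of g x] x NW by auto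
    qed
    then show ?thesis unfolding inv using x inj by auto
  qed
  show "same_germ M (transport_inv M A W a y) (transf a f) (\<lambda>_. 1)"
    if y: "y \<in> W" and f: "f \<in> ?R W" "same_germ M y f (\<lambda>_. 1)" for y f
  proof -
    obtain N where N: "openin (mtop M) N" "y \<in> N" "\<forall>x\<in>N. f x = 1" using f(2) unfolding same_germ_def by blast
    have c: "continuous_map (subtopology (mtop M) V) (mtop M) \<tau>"
      using d(2) by (intro smooth_at_continuous[OF manifold manifold oV]) blast
    have "openin (subtopology (mtop M) V) {x \<in> topspace (subtopology (mtop M) V). \<tau> x \<in> N}" (is "openin _ ?N")
      by (rule openin_continuous_map_preimage[OF c N(1)])
    then have "openin (mtop M) ?N" using oV openin_trans_full by blast
    moreover have "inv_into V \<tau> y \<in> ?N" using i[OF y] N(2) openin_subset[OF oV] by auto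
    moreover have "transf a f x = 1" if "x \<in> ?N" for x using that T[OF f(1), of x] N(3) by auto
    ultimately show ?thesis unfolding same_germ_def inv by blast
  qed
  show "\<exists>\<phi>\<in>?R W. transf a \<phi> = g" if "g \<in> ?R (transport_inv M A W a ` W)" for g
  proof -
    have "g \<in> transf a ` ?R W" using that onto by (simp add: inv imV)
    then show ?thesis by force
  qed
  show "transf a f \<in> ?R (transport_inv M A W a ` W)" if "f \<in> ?R W" for f
    using that onto unfolding inv imV by blast
qed

end

section \<open>The spectral sheaf\<close>

text \<open>Functoriality of the tensor product in the underlying group and the balancing relation;
  it serves for passing to stalks.\<close>

lemma tensor_cong_map:
  assumes "tensor_cong X add z bal p q"
    and "\<And>x. x \<in> X \<Longrightarrow> \<phi> x \<in> Y" "\<And>x y. x \<in> X \<Longrightarrow> y \<in> X \<Longrightarrow> \<phi> (add x y) = add' (\<phi> x) (\<phi> y)" "\<phi> z = z'"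
    and "\<And>u v. (u, v) \<in> bal \<Longrightarrow> (map_prod \<phi> \<phi> u, map_prod \<phi> \<phi> v) \<in> bal'"
  shows "tensor_cong Y add' z' bal' (image_mset (map_prod \<phi> \<phi>) p) (image_mset (map_prod \<phi> \<phi>) q)"
  using assms(1)
proof induction
  case (refl p)
  then show ?case using assms(2) by (intro tensor_cong.refl) auto
next
  case (sym p q) show ?case by (rule tensor_cong.sym[OF sym.IH])
next
  case (trans p q r) show ?case by (rule tensor_cong.trans[OF trans.IH])
next
  case (sum p q p' q') then show ?case by (simp add: tensor_cong.sum)
next
  case (add_left x x' y) then show ?case by (simp add: assms(2,3) tensor_cong.add_left)
next
  case (add_right x y y') then show ?case by (simp add: assms(2,3) tensor_cong.add_right)
next
  case (zero_left y) then show ?case by (simp add: assms(2,4) tensor_cong.zero_left)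
next
  case (zero_right x) then show ?case by (simp add: assms(2,4) tensor_cong.zero_right)
next
  case (balanced u v) then show ?case using tensor_cong.balanced[OF assms(5)] by simp
qed

context hopf_algebroid_on_manifold
begin

section \<open>Stalks and their coalgebra structure\<close>

abbreviation "cl \<equiv> stalk_class M A"
abbreviation "\<N> \<equiv> null_at M A"

lemma null_at_zero: "y \<in> points M \<Longrightarrow> 0 \<in> \<N> y"
  using exists_bump[OF openin_topspace, of y] unfolding null_at_def Cc_infinity_on_points by auto

lemma null_at_add:
  assumes "a \<in> \<N> y" "b \<in> \<N> y" shows "a + b \<in> \<N> y"
proof -
  obtain f g where f: "f \<in> Cc_infinity M" "same_germ M y f (\<lambda>_. 1)" "\<iota> f * a = 0"
    and g: "g \<in> Cc_infinity M" "same_germ M y g (\<lambda>_. 1)" "\<iota> g * b = 0"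
    using assms unfolding null_at_def by blast
  have "\<iota> (\<lambda>x. f x * g x) * (a + b) = \<iota> g * (\<iota> f * a) + \<iota> f * (\<iota> g * b)"
    using incl_mult[OF f(1) g(1)] incl_commute[OF f(1) g(1)] by (simp add: distrib_left mult.assoc[symmetric])
  also have "\<dots> = 0" using f(3) g(3) by simp
  finally have "\<iota> (\<lambda>x. f x * g x) * (a + b) = 0" .
  moreover have "same_germ M y (\<lambda>x. f x * g x) (\<lambda>_. 1)"
    using same_germ_map2[OF f(2) g(2), of "(*)"] by simp
  ultimately show ?thesis unfolding null_at_def using R_mult[OF f(1) g(1)] by blast
qed

lemma null_at_uminus: "a \<in> \<N> y \<Longrightarrow> - a \<in> \<N> y"
  unfolding null_at_def by auto

lemma stalk_class_eq_iff:
  assumes y: "y \<in> points M" shows "cl y a = cl y b \<longleftrightarrow> a - b \<in> \<N> y"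
proof
  assume "cl y a = cl y b"
  moreover have "a \<in> cl y a" using null_at_zero[OF y] by (force simp: stalk_class_def elt_set_plus_def)
  ultimately show "a - b \<in> \<N> y" by (auto simp: stalk_class_def elt_set_plus_def)
next
  have sub: "cl y a \<subseteq> cl y b" if "a - b \<in> \<N> y" for a b
  proof
    fix c assume "c \<in> cl y a"
    then have "c - a \<in> \<N> y" by (auto simp: stalk_class_def elt_set_plus_def)
    then have "c - b \<in> \<N> y" using null_at_add[OF _ that, of "c - a"] by simp
    then show "c \<in> cl y b" by (force simp: stalk_class_def elt_set_plus_def intro: bexI[of _ "c - b"])
  qed
  assume "a - b \<in> \<N> y"
  then show "cl y a = cl y b" using sub[of a b] sub[of b a] null_at_uminus[of "a - b" y] by auto
qed

lemma stalk_class_eqI: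
  assumes "f \<in> Cc_infinity M" "same_germ M y f (\<lambda>_. 1)" "\<iota> f * a = \<iota> f * b"
  shows "cl y a = cl y b"
  using assms stalk_class_eq_iff[OF same_germ_point[OF assms(2)]]
  unfolding null_at_def by (auto simp: right_diff_distrib)

text \<open>If f(a - b) = 0 with f = 1 on N, then every g supported in N satisfies g = gf, hence g(a
  - b) = 0. Equality of germs thus spreads to a neighbourhood and can be used with all functions
  supported there.\<close>

lemma stalk_class_eqE:
  assumes y: "y \<in> points M" and eq: "cl y a = cl y b"
  obtains N where "openin (mtop M) N" "y \<in> N" "\<And>f. f \<in> Cc_infinity_on M N \<Longrightarrow> \<iota> f * a = \<iota> f * b"
    "\<And>x. x \<in> N \<Longrightarrow> cl x a = cl x b"
proof -
  obtain f where f: "f \<in> Cc_infinity M" "same_germ M y f (\<lambda>_. 1)" "\<iota> f * a = \<iota> f * b"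
    using eq stalk_class_eq_iff[OF y] unfolding null_at_def by (auto simp: right_diff_distrib)
  obtain N where N: "openin (mtop M) N" "y \<in> N" "\<forall>x\<in>N. f x = 1" using f(2) unfolding same_germ_def by blast
  show thesis
  proof (rule that[OF N(1,2)])
    show "\<iota> g * a = \<iota> g * b" if g: "g \<in> Cc_infinity_on M N" for g
    proof -
      have "g x * f x = g x" for x using N(3) Cc_infinity_on_zero[OF g] by (cases "x \<in> N") auto
      then have "\<iota> g * \<iota> f = \<iota> g" by (rule incl_absorb[OF Cc_infinity_onD[OF g] f(1)])
      then show ?thesis using f(3) by (metis mult.assoc)
    qed
    show "cl x a = cl x b" if "x \<in> N" for x
      using N that by (intro stalk_class_eqI[OF f(1) _ f(3)]) (auto simp: same_germ_def)
  qed
qed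

lemma germ_one_bump:
  assumes "same_germ M y g (\<lambda>_. 1)" "openin (mtop M) O'" "y \<in> O'"
  obtains f :: "'m \<Rightarrow> 'k" where "f \<in> Cc_infinity_on M O'" "same_germ M y f (\<lambda>_. 1)" "\<And>x. f x * g x = f x"
proof -
  obtain N where N: "openin (mtop M) N" "y \<in> N" "\<forall>x\<in>N. g x = 1" using assms(1) unfolding same_germ_def by blast
  have oN: "openin (mtop M) (N \<inter> O')" using N assms by blast
  obtain f :: "'m \<Rightarrow> 'k" where f: "f \<in> Cc_infinity_on M (N \<inter> O')" "same_germ M y f (\<lambda>_. 1)"
    using exists_bump[OF oN, of y] N assms(3) by blast
  have "f x * g x = f x" for x using N(3) Cc_infinity_on_zero[OF f(1), of x] by (cases "x \<in> N") auto
  then show thesis using that f Cc_infinity_on_mono[OF _ f(1)] by blast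
qed

lemma stalk_class_incl_mult:
  assumes g: "g \<in> Cc_infinity M" "same_germ M y g (\<lambda>_. 1)"
  shows "cl y (\<iota> g * a) = cl y a"
proof -
  obtain f :: "'m \<Rightarrow> 'k" where f: "f \<in> Cc_infinity_on M (points M)" "same_germ M y f (\<lambda>_. 1)" "\<And>x. f x * g x = f x"
    using germ_one_bump[OF g(2) openin_topspace same_germ_point[OF g(2)]] by blast
  have "\<iota> f * (\<iota> g * a) = \<iota> f * a" using incl_absorb[OF Cc_infinity_onD[OF f(1)] g(1) f(3)] by (simp add: mult.assoc[symmetric])
  then show ?thesis by (rule stalk_class_eqI[OF Cc_infinity_onD[OF f(1)] f(2)])
qed

text \<open>Elementwise addition of sets is the addition of cosets; that 0 lies in
  \<open>null_at\<close> is needed for the second inclusion.\<close>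

lemma stalk_class_add:
  assumes y: "y \<in> points M" shows "cl y a + cl y b = cl y (a + b)"
proof
  show "cl y a + cl y b \<subseteq> cl y (a + b)"
  proof
    fix c assume "c \<in> cl y a + cl y b"
    then obtain m n where "m \<in> \<N> y" "n \<in> \<N> y" "c = (a + m) + (b + n)"
      by (auto simp: stalk_class_def elt_set_plus_def set_plus_def)
    then show "c \<in> cl y (a + b)"
      using null_at_add[of m y n] by (auto simp: stalk_class_def elt_set_plus_def intro!: bexI[of _ "m + n"])
  qed
  show "cl y (a + b) \<subseteq> cl y a + cl y b"
  proof
    fix c assume "c \<in> cl y (a + b)"
    then obtain m where m: "m \<in> \<N> y" "c = (a + 0) + (b + m)" by (auto simp: stalk_class_def elt_set_plus_def add.assoc)
    moreover have "a + 0 \<in> cl y a" "b + m \<in> cl y b"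
      using null_at_zero[OF y] m(1) unfolding stalk_class_def elt_set_plus_def by blast+
    ultimately show "c \<in> cl y a + cl y b" by (metis set_plus_intro)
  qed
qed

lemma stalk_class_zero: "cl y 0 = \<N> y"
  by (auto simp: stalk_class_def elt_set_plus_def)

abbreviation stalk_cong :: "'m \<Rightarrow> ('a set \<times> 'a set) multiset \<Rightarrow> ('a set \<times> 'a set) multiset \<Rightarrow> bool"
  where "stalk_cong y \<equiv> tensor_cong (range (cl y)) (+) (\<N> y)
          {((cl y (\<iota> f * a), cl y b), (cl y a, cl y (\<iota> f * b))) |f a b. f \<in> Cc_infinity M}"

lemma stalk_tensor_eqI:
  assumes "stalk_cong y p q" shows "stalk_tensor M A y p = stalk_tensor M A y q"
  unfolding stalk_tensor_def
proof (intro Collect_cong iffI)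
  note t = tensor_cong.trans
  show "stalk_cong y q r" if "stalk_cong y p r" for r by (rule t[OF tensor_cong.sym[OF assms] that])
  show "stalk_cong y p r" if "stalk_cong y q r" for r by (rule t[OF assms that])
qed

lemma stalk_tensor_of_tensor_eq:
  assumes y: "y \<in> points M" and eq: "tensor M A p = tensor M A q"
  shows "stalk_tensor M A y (image_mset (map_prod (cl y) (cl y)) p) = stalk_tensor M A y (image_mset (map_prod (cl y) (cl y)) q)"
proof (rule stalk_tensor_eqI, rule tensor_cong_map[OF tensor_eqD[OF eq]])
  fix u v assume "(u, v) \<in> {((\<iota> f * a, b), (a, \<iota> f * b)) |f a b. f \<in> Cc_infinity M}"
  then obtain f a b where "f \<in> Cc_infinity M" "u = (\<iota> f * a, b)" "v = (a, \<iota> f * b)" by blast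
  then show "(map_prod (cl y) (cl y) u, map_prod (cl y) (cl y) v) \<in>
      {((cl y (\<iota> f * a), cl y b), (cl y a, cl y (\<iota> f * b))) |f a b. f \<in> Cc_infinity M}"
    by (intro CollectI exI[of _ f] exI[of _ a] exI[of _ b]) simp
qed (auto simp: stalk_class_add[OF y] stalk_class_zero)

text \<open>Two representatives become equal after multiplication by some \<open>f\<close> that is 1
  near y. As \<Delta> is left linear and multiplying the left factors by \<open>f\<close> leaves
  their classes at y unchanged, both representatives give the same tensor.\<close>

lemma stalk_comult_eq:
  assumes y: "y \<in> points M" and p: "comult A a = tensor M A p"
  shows "stalk_comult M A y (cl y a) = stalk_tensor M A y (image_mset (map_prod (cl y) (cl y)) p)"
proof -
  have mp: "(\<lambda>(u, v). (cl y u, cl y v)) = map_prod (cl y) (cl y)" by auto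
  show ?thesis
    unfolding stalk_comult_def mp
  proof (rule the_equality)
    show "\<exists>b q. cl y a = cl y b \<and> comult A b = tensor M A q \<and>
        stalk_tensor M A y (image_mset (map_prod (cl y) (cl y)) p) = stalk_tensor M A y (image_mset (map_prod (cl y) (cl y)) q)"
      using p by blast
    fix t assume "\<exists>b q. cl y a = cl y b \<and> comult A b = tensor M A q \<and>
        t = stalk_tensor M A y (image_mset (map_prod (cl y) (cl y)) q)"
    then obtain b q where b: "cl y a = cl y b" "comult A b = tensor M A q"
      "t = stalk_tensor M A y (image_mset (map_prod (cl y) (cl y)) q)" by blast
    obtain f where f: "f \<in> Cc_infinity M" "same_germ M y f (\<lambda>_. 1)" "\<iota> f * a = \<iota> f * b"
      using b(1) stalk_class_eq_iff[OF y] unfolding null_at_def by (auto simp: right_diff_distrib)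
    have im: "image_mset (map_prod (cl y) (cl y)) {#(\<iota> f * x, y). (x, y) \<in># r#} = image_mset (map_prod (cl y) (cl y)) r"
      for r :: "('a \<times> 'a) multiset"
      unfolding image_mset.compositionality
      by (rule image_mset_cong) (auto simp: stalk_class_incl_mult[OF f(1,2)])
    have "tensor M A {#(\<iota> f * x, y). (x, y) \<in># p#} = tensor M A {#(\<iota> f * x, y). (x, y) \<in># q#}"
      using comult_left[OF f(1) p] comult_left[OF f(1) b(2)] f(3) by simp
    from stalk_tensor_of_tensor_eq[OF y this]
    show "t = stalk_tensor M A y (image_mset (map_prod (cl y) (cl y)) p)" unfolding im b(3) by simp
  qed
qed

lemma germ_eqI:
  assumes "same_germ M y f g" shows "germ M y f = germ M y g"
  using same_germ_trans[OF _ assms] same_germ_trans[OF _ same_germ_sym[OF assms]] unfolding germ_def by blast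

lemma counit_same_germ:
  assumes f: "f \<in> Cc_infinity M" "same_germ M y f (\<lambda>_. 1)" "\<iota> f * a = \<iota> f * b"
  shows "same_germ M y (\<epsilon> a) (\<epsilon> b)"
proof -
  have eq: "(\<lambda>x. f x * \<epsilon> a x) = (\<lambda>x. f x * \<epsilon> b x)" using counit_left[OF f(1)] f(3) by metis
  obtain N where N: "openin (mtop M) N" "y \<in> N" "\<forall>x\<in>N. f x = 1" using f(2) unfolding same_germ_def by blast
  have "\<epsilon> a x = \<epsilon> b x" if "x \<in> N" for x using fun_cong[OF eq, of x] N(3) that by simp
  then show ?thesis unfolding same_germ_def using N by blast
qed

lemma stalk_counit_eq:
  assumes y: "y \<in> points M" shows "stalk_counit M A y (cl y a) = germ M y (\<epsilon> a)"
  unfolding stalk_counit_def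
proof (rule the_equality)
  fix \<gamma> assume "\<exists>b. cl y a = cl y b \<and> \<gamma> = germ M y (\<epsilon> b)"
  then obtain b where b: "cl y a = cl y b" "\<gamma> = germ M y (\<epsilon> b)" by blast
  obtain f where f: "f \<in> Cc_infinity M" "same_germ M y f (\<lambda>_. 1)" "\<iota> f * a = \<iota> f * b"
    using b(1) stalk_class_eq_iff[OF y] unfolding null_at_def by (auto simp: right_diff_distrib)
  show "\<gamma> = germ M y (\<epsilon> a)" unfolding b(2) using germ_eqI[OF counit_same_germ[OF f]] by simp
qed blast

text \<open>The largest open set on which \<open>a\<close> is normalized. Taking it for W makes the
  transport a function of \<open>a\<close> alone.\<close>

definition Norm :: "'a \<Rightarrow> 'm set"
  where "Norm a = {x. normalized_at M A a x}"

lemma openin_Norm: "openin (mtop M) (Norm a)"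
  using normalized_at_nbhd by (subst openin_subopen) (metis Norm_def mem_Collect_eq subsetI)

lemma Norm_unital_on: "f \<in> Cc_infinity_on M (Norm a) \<Longrightarrow> unital_on f a"
  by (rule normalized_unital_on[of "Norm a"]) (simp_all add: Norm_def)

text \<open>Near y, where \<epsilon>(a) = 1, the counit law a = \<epsilon>(a)a' identifies the germs
  of \<open>a\<close> and a', so that a \<otimes> a' becomes the tensor square of the germ of
  \<open>a\<close>.\<close>

lemma weakly_grouplike_in_stalk:
  assumes a: "weakly_grouplike M A a" and y: "y \<in> Norm a"
  shows "cl y a \<in> stalk_grouplike M A y"
proof -
  have yM: "y \<in> points M" using y openin_subset[OF openin_Norm] by blast
  obtain a' where a': "comult A a = tensor M A {#(a, a')#}" using a unfolding weakly_grouplike_def by blast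
  have 1: "\<iota> (\<epsilon> a) * a' = a" using counit_left1[OF a'] .
  obtain f :: "'m \<Rightarrow> 'k" where f: "f \<in> Cc_infinity_on M (Norm a)" "same_germ M y f (\<lambda>_. 1)"
    using exists_bump[OF openin_Norm y] by blast
  have fR: "f \<in> Cc_infinity M" using f(1) by (rule Cc_infinity_onD)
  have "\<iota> f * \<iota> (\<epsilon> a) = \<iota> f"
    using Norm_unital_on[OF f(1)] by (intro incl_absorb fR counit_closed) (simp add: unital_on_def)
  then have "\<iota> f * a' = \<iota> f * a" using 1 by (metis mult.assoc)
  then have eq: "cl y a' = cl y a" by (rule stalk_class_eqI[OF fR f(2)])
  have "stalk_comult M A y (cl y a) = stalk_tensor M A y {#(cl y a, cl y a)#}"
    using stalk_comult_eq[OF yM a'] eq by simp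
  moreover have "stalk_counit M A y (cl y a) = germ M y (\<lambda>_. 1)"
    using stalk_counit_eq[OF yM] germ_eqI[of y "\<epsilon> a" "\<lambda>_. 1"] y by (simp add: Norm_def normalized_at_def)
  ultimately show ?thesis by (simp add: stalk_grouplike_def)
qed

section \<open>Topology and smooth structure of the spectral sheaf\<close>

abbreviation "\<E> \<equiv> spectral_sheaf M A"

definition good_sheet :: "'a \<Rightarrow> 'm set \<Rightarrow> bool"
  where "good_sheet a W \<longleftrightarrow> weakly_grouplike M A a \<and> openin (mtop M) W \<and> W \<subseteq> Norm a"

lemma good_sheet_iff:
  "good_sheet a W \<longleftrightarrow> weakly_grouplike M A a \<and> openin (mtop M) W \<and> (\<forall>y\<in>W. normalized_at M A a y)"
  by (auto simp: good_sheet_def Norm_def)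

lemma atlas_spectral_sheaf:
  "atlas \<E> = {(sheet M A a W, \<phi> \<circ> fst) |a W U \<phi>. good_sheet a W \<and> W \<subseteq> U \<and> (U, \<phi>) \<in> atlas M}"
  by (simp add: spectral_sheaf_def good_sheet_iff conj_assoc)

lemma mem_sheet: "g \<in> sheet M A a W \<longleftrightarrow> fst g \<in> W \<and> snd g = cl (fst g) a"
  by (cases g) (auto simp: sheet_def)

lemma sheet_subset_stalks: "good_sheet a W \<Longrightarrow> sheet M A a W \<subseteq> (SIGMA y : points M. stalk_grouplike M A y)"
  using weakly_grouplike_in_stalk openin_subset unfolding good_sheet_def sheet_def by blast

lemma mtop_spectral_sheaf: "mtop \<E> = topology_generated_by {sheet M A a W |a W. good_sheet a W}"
proof -
  have "{sheet M A a W |a W. weakly_grouplike M A a \<and> openin (mtop M) W \<and> (\<forall>y\<in>W. normalized_at M A a y)} =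
      {sheet M A a W |a W. good_sheet a W}"
    unfolding good_sheet_def Norm_def by blast
  moreover have "topspace (topology_generated_by {sheet M A a W |a W. good_sheet a W}) \<subseteq>
      (SIGMA y : points M. stalk_grouplike M A y)"
    using sheet_subset_stalks by (auto simp: topology_generated_by_topspace)
  ultimately show ?thesis
    by (simp add: spectral_sheaf_def subtopology_superset)
qed

lemma openin_sheet: "good_sheet a W \<Longrightarrow> openin (mtop \<E>) (sheet M A a W)"
  unfolding mtop_spectral_sheaf by (rule topology_generated_by_Basis) blast

text \<open>The topology is only generated by the sheets. They form a basis because two sheets
  through the same point coincide over a neighbourhood, by \<open>stalk_class_eqE\<close>.\<close>

lemma sheet_basis:
  assumes "openin (mtop \<E>) T" "g \<in> T"
  obtains a W where "good_sheet a W" "g \<in> sheet M A a W" "sheet M A a W \<subseteq> T"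
proof -
  have "generate_topology_on {sheet M A a W |a W. good_sheet a W} T"
    using assms(1) unfolding mtop_spectral_sheaf by (simp add: openin_topology_generated_by_iff)
  then have "g \<in> T \<longrightarrow> (\<exists>a W. good_sheet a W \<and> g \<in> sheet M A a W \<and> sheet M A a W \<subseteq> T)"
  proof induction
    case (Int S T)
    show ?case
    proof
      assume g: "g \<in> S \<inter> T"
      obtain a W where a: "good_sheet a W" "g \<in> sheet M A a W" "sheet M A a W \<subseteq> S" using Int g by blast
      obtain b V where b: "good_sheet b V" "g \<in> sheet M A b V" "sheet M A b V \<subseteq> T" using Int g by blast
      have y: "fst g \<in> points M" using a openin_subset unfolding good_sheet_def mem_sheet by blast
      have "cl (fst g) a = cl (fst g) b" using a(2) b(2) unfolding mem_sheet by simp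
      from stalk_class_eqE[OF y this] obtain N where N: "openin (mtop M) N" "fst g \<in> N" "\<And>x. x \<in> N \<Longrightarrow> cl x a = cl x b"
        by metis
      have "good_sheet a (W \<inter> V \<inter> N)" using a(1) b(1) N(1) unfolding good_sheet_def by blast
      moreover have "g \<in> sheet M A a (W \<inter> V \<inter> N)" using a(2) b(2) N(2) unfolding mem_sheet by blast
      moreover have "sheet M A a (W \<inter> V \<inter> N) \<subseteq> S \<inter> T"
      proof
        fix h assume "h \<in> sheet M A a (W \<inter> V \<inter> N)"
        then have "h \<in> sheet M A a W" "h \<in> sheet M A b V" using N(3) unfolding mem_sheet by auto
        then show "h \<in> S \<inter> T" using a(3) b(3) by blast
      qed
      ultimately show "\<exists>a W. good_sheet a W \<and> g \<in> sheet M A a W \<and> sheet M A a W \<subseteq> S \<inter> T" by blast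
    qed
  next
    case (UN K) then show ?case by blast
  next
    case (Basis s) then show ?case by blast
  qed simp
  then show thesis using assms(2) that by blast
qed

lemma sheet_of_point:
  assumes "g \<in> points \<E>"
  obtains a W where "good_sheet a W" "g \<in> sheet M A a W"
  using sheet_basis[OF openin_topspace assms] by metis

lemma good_sheet_Int: "good_sheet a W \<Longrightarrow> openin (mtop M) U \<Longrightarrow> good_sheet a (W \<inter> U)"
  unfolding good_sheet_def by blast

lemma fst_continuous: "continuous_map (mtop \<E>) (mtop M) fst"
  unfolding continuous_map_def
proof (intro conjI allI impI)
  show "fst \<in> points \<E> \<rightarrow> points M"
  proof
    fix g assume "g \<in> points \<E>"
    then obtain a W where "good_sheet a W" "g \<in> sheet M A a W" by (rule sheet_of_point)
    then show "fst g \<in> points M" using openin_subset[of "mtop M" W] by (auto simp: good_sheet_def mem_sheet)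
  qed
  fix U assume U: "openin (mtop M) U"
  show "openin (mtop \<E>) {g \<in> points \<E>. fst g \<in> U}"
  proof (subst openin_subopen, intro ballI)
    fix g assume g: "g \<in> {g \<in> points \<E>. fst g \<in> U}"
    then obtain a W where a: "good_sheet a W" "g \<in> sheet M A a W" using sheet_of_point by blast
    have o: "openin (mtop \<E>) (sheet M A a (W \<inter> U))" using openin_sheet[OF good_sheet_Int[OF a(1) U]] .
    have "g \<in> sheet M A a (W \<inter> U)" using a(2) g by (simp add: mem_sheet)
    moreover have "sheet M A a (W \<inter> U) \<subseteq> {g \<in> points \<E>. fst g \<in> U}"
      using openin_subset[OF o] by (auto simp: sheet_def)
    ultimately show "\<exists>T. openin (mtop \<E>) T \<and> g \<in> T \<and> T \<subseteq> {g \<in> points \<E>. fst g \<in> U}" using o by blast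
  qed
qed

lemma fst_open_map: "open_map (mtop \<E>) (mtop M) fst"
  unfolding open_map_def
proof (intro allI impI)
  fix T assume T: "openin (mtop \<E>) T"
  show "openin (mtop M) (fst ` T)"
  proof (subst openin_subopen, intro ballI)
    fix y assume "y \<in> fst ` T"
    then obtain g where g: "g \<in> T" "y = fst g" by blast
    obtain a W where a: "good_sheet a W" "g \<in> sheet M A a W" "sheet M A a W \<subseteq> T" using sheet_basis[OF T g(1)] .
    have "W = fst ` sheet M A a W" by (force simp: sheet_def)
    then have "W \<subseteq> fst ` T" using a(3) by blast
    then show "\<exists>W. openin (mtop M) W \<and> y \<in> W \<and> W \<subseteq> fst ` T"
      using a(1,2) g(2) unfolding good_sheet_def mem_sheet by blast
  qed
qed

lemma spectral_sheaf_atlas: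
  assumes "(T, \<theta>) \<in> atlas \<E>"
  shows "openin (mtop \<E>) T \<and> inj_on fst T \<and> (\<exists>U \<phi>. (U, \<phi>) \<in> atlas M \<and> fst ` T \<subseteq> U \<and> \<theta> = \<phi> \<circ> fst)"
proof -
  obtain a W U \<phi> where *: "T = sheet M A a W" "\<theta> = \<phi> \<circ> fst" "good_sheet a W" "W \<subseteq> U" "(U, \<phi>) \<in> atlas M"
    using assms unfolding atlas_spectral_sheaf by blast
  have "inj_on fst T" unfolding *(1) sheet_def by (auto simp: inj_on_def)
  moreover have "fst ` T \<subseteq> U" unfolding *(1) sheet_def using *(4) by auto
  ultimately show ?thesis using openin_sheet[OF *(3)] * by blast
qed

lemma spectral_sheaf_cover: "points \<E> \<subseteq> (\<Union>(T, \<theta>)\<in>atlas \<E>. T)"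
proof
  fix g assume "g \<in> points \<E>"
  then obtain a W where a: "good_sheet a W" "g \<in> sheet M A a W" using sheet_of_point by blast
  then have "fst g \<in> points M" using openin_subset unfolding good_sheet_def mem_sheet by blast
  then obtain U \<phi> where c: "(U, \<phi>) \<in> atlas M" "fst g \<in> U" using atlas_cover[OF manifold] by blast
  have good: "good_sheet a (W \<inter> U)" using good_sheet_Int[OF a(1) chart_open[OF manifold c(1)]] .
  have "(sheet M A a (W \<inter> U), \<phi> \<circ> fst) \<in> atlas \<E>"
    using good c(1) unfolding atlas_spectral_sheaf by blast
  moreover have "g \<in> sheet M A a (W \<inter> U)" using a(2) c(2) by (simp add: mem_sheet)
  ultimately show "g \<in> (\<Union>(T, \<theta>)\<in>atlas \<E>. T)" by blast
qed

lemma spectral_sheaf_manifold: "smooth_manifold \<E>"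
  by (rule pullback_smooth_manifold[OF manifold fst_continuous fst_open_map _ spectral_sheaf_cover spectral_sheaf_atlas])
    (simp add: spectral_sheaf_def)

lemma spectral_sheaf_fst_etale: "local_diffeomorphism \<E> M fst"
  by (rule pullback_local_diffeomorphism[OF manifold fst_continuous fst_open_map _ spectral_sheaf_cover spectral_sheaf_atlas])
    (simp add: spectral_sheaf_def)

end

section \<open>The spectral groupoid\<close>

context hopf_algebroid_on_manifold
begin

abbreviation "\<G> \<equiv> spectral_groupoid M A"

abbreviation arr :: "'a \<Rightarrow> 'm \<Rightarrow> 'm \<times> 'a set"
  where "arr a y \<equiv> (y, cl y a)"

abbreviation srcf :: "'a \<Rightarrow> 'm \<Rightarrow> 'm"
  where "srcf a \<equiv> transport_inv M A (Norm a) a"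

lemma NormD: "x \<in> Norm a \<Longrightarrow> normalized_at M A a x"
  by (simp add: Norm_def)

lemma Norm_points: "y \<in> Norm a \<Longrightarrow> y \<in> points M"
  using openin_subset[OF openin_Norm] by blast

text \<open>Both points x satisfy T f x = f(y) for all f supported in W, and this determines
  x.\<close>

lemma transport_inv_eq_srcf:
  assumes a: "a \<in> GS" and W: "openin (mtop M) W" "W \<subseteq> Norm a" and y: "y \<in> W"
  shows "transport_inv M A W a y = srcf a y"
proof -
  have n: "normalized_at M A a x" if "x \<in> W" for x using that W(2) NormD by blast
  show ?thesis
  proof (rule transport_inv_eqI[OF a openin_Norm _ W y, symmetric])
    show "transf a f (transport_inv M A W a y) = f y" if "f \<in> Cc_infinity_on M W" for f
      by (rule transport_inv_transf[OF a W(1) n y that])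
  qed (rule NormD)
qed

lemma srcf_transf: "a \<in> GS \<Longrightarrow> y \<in> Norm a \<Longrightarrow> f \<in> Cc_infinity_on M (Norm a) \<Longrightarrow> transf a f (srcf a y) = f y"
  by (rule transport_inv_transf[OF _ openin_Norm NormD])

lemma srcf_point: "a \<in> GS \<Longrightarrow> y \<in> Norm a \<Longrightarrow> srcf a y \<in> points M"
  by (rule transport_inv_point[OF _ openin_Norm NormD])

lemma srcf_germ: "a \<in> GS \<Longrightarrow> y \<in> Norm a \<Longrightarrow> f \<in> Cc_infinity_on M (Norm a) \<Longrightarrow> same_germ M y f (\<lambda>_. 1) \<Longrightarrow>
    same_germ M (srcf a y) (transf a f) (\<lambda>_. 1)"
  by (rule transport_inv_germ[OF _ openin_Norm NormD])

lemma srcf_etale: "a \<in> GS \<Longrightarrow> etale_on M M (srcf a) (Norm a)"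
  by (rule transport_inv_etale[OF _ openin_Norm NormD])

lemma srcf_eqI:
  assumes a: "a \<in> GS" and y: "y \<in> Norm a" and N: "openin (mtop M) N" "y \<in> N"
    and f: "\<And>f. f \<in> Cc_infinity_on M (N \<inter> Norm a) \<Longrightarrow> transf a f x = f y"
  shows "srcf a y = x"
  using N openin_Norm[of a] y
  by (intro transport_inv_eqI[OF a openin_Norm NormD, of a "N \<inter> Norm a"] f) auto

lemma transf_cong: "\<iota> f * a = \<iota> f * b \<Longrightarrow> transf a f = transf b f"
  by (simp add: transf_def)

text \<open>For f supported near y equal germs give fa = fb, hence equal transfers of f, and these
  determine the source point.\<close>

lemma srcf_class:
  assumes a: "a \<in> GS" "y \<in> Norm a" and b: "b \<in> GS" "y \<in> Norm b" and eq: "cl y a = cl y b"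
  shows "srcf a y = srcf b y"
proof -
  obtain N where N: "openin (mtop M) N" "y \<in> N" "\<And>f. f \<in> Cc_infinity_on M N \<Longrightarrow> \<iota> f * a = \<iota> f * b"
    using stalk_class_eqE[OF Norm_points[OF a(2)] eq] by metis
  show ?thesis
  proof (rule srcf_eqI[OF a])
    show "openin (mtop M) (N \<inter> Norm b)" using N openin_Norm by blast
    show "y \<in> N \<inter> Norm b" using N b by blast
    fix f :: "'m \<Rightarrow> 'k" assume f: "f \<in> Cc_infinity_on M (N \<inter> Norm b \<inter> Norm a)"
    have "f \<in> Cc_infinity_on M N" by (rule Cc_infinity_on_mono[OF _ f]) blast
    moreover have "f \<in> Cc_infinity_on M (Norm b)" by (rule Cc_infinity_on_mono[OF _ f]) blast
    ultimately show "transf a f (srcf b y) = f y"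
      using transf_cong[OF N(3)] srcf_transf[OF b] by metis
  qed
qed

lemma spectral_arrow_set_iff: "g \<in> spectral_arrow_set M A \<longleftrightarrow> (\<exists>a y. a \<in> GS \<and> y \<in> Norm a \<and> g = arr a y)"
  unfolding spectral_arrow_set_def Norm_def using normalized_at_point by blast

lemma represents_arr: "represents M A b (arr a y) \<longleftrightarrow> b \<in> GS \<and> y \<in> Norm b \<and> cl y a = cl y b"
  by (auto simp: represents_def Norm_def)

lemma spectral_src_arr:
  assumes a: "a \<in> GS" "y \<in> Norm a"
  shows "spectral_src M A (arr a y) = srcf a y"
  unfolding spectral_src_def
proof (rule the_equality)
  show "\<exists>b W. represents M A b (arr a y) \<and> openin (mtop M) W \<and> fst (arr a y) \<in> W \<and>
      (\<forall>y\<in>W. normalized_at M A b y) \<and> srcf a y = transport_inv M A W b (fst (arr a y))"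
    using a openin_Norm NormD by (intro exI[of _ a] exI[of _ "Norm a"]) (simp add: represents_arr)
  fix x assume "\<exists>b W. represents M A b (arr a y) \<and> openin (mtop M) W \<and> fst (arr a y) \<in> W \<and>
      (\<forall>y\<in>W. normalized_at M A b y) \<and> x = transport_inv M A W b (fst (arr a y))"
  then obtain b W where b: "b \<in> GS" "y \<in> Norm b" "cl y a = cl y b" "openin (mtop M) W" "y \<in> W" "W \<subseteq> Norm b"
      "x = transport_inv M A W b y"
    unfolding represents_arr Norm_def by auto
  show "x = srcf a y"
    unfolding b(7) transport_inv_eq_srcf[OF b(1,4,6,5)] using srcf_class[OF a b(1-3)] by simp
qed

text \<open>The source point varies continuously, so near z it stays in N, and the transfer then
  carries functions supported near z to functions supported in N. This is how information on germs
  at the source point is used at z.\<close>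

lemma localize:
  assumes b: "b \<in> GS" "z \<in> Norm b" and N: "openin (mtop M) N" "srcf b z \<in> N"
  obtains W where "openin (mtop M) W" "z \<in> W" "W \<subseteq> Norm b" "\<And>w. w \<in> W \<Longrightarrow> srcf b w \<in> N"
    "\<And>f. f \<in> Cc_infinity_on M W \<Longrightarrow> transf b f \<in> Cc_infinity_on M N"
proof -
  define W where "W = {w \<in> topspace (subtopology (mtop M) (Norm b)). srcf b w \<in> N}"
  have "openin (subtopology (mtop M) (Norm b)) W"
    unfolding W_def
    by (rule openin_continuous_map_preimage[OF etale_on_continuous[OF manifold manifold srcf_etale[OF b(1)]] N(1)])
  then have oW: "openin (mtop M) W" using openin_Norm openin_trans_full by blast
  have zW: "z \<in> W" using b N Norm_points by (simp add: W_def)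
  have WN: "W \<subseteq> Norm b" by (auto simp: W_def)
  have n: "normalized_at M A b x" if "x \<in> W" for x using that WN NormD by blast
  have sN: "srcf b w \<in> N" if "w \<in> W" for w using that by (simp add: W_def)
  show thesis
  proof (rule that[OF oW zW WN sN])
    fix f :: "'m \<Rightarrow> 'k" assume f: "f \<in> Cc_infinity_on M W"
    have "transport_inv M A W b ` W \<subseteq> N"
      using transport_inv_eq_srcf[OF b(1) oW WN] sN by auto
    then show "transf b f \<in> Cc_infinity_on M N"
      using transport_inv_support[OF b(1) oW n f] by (rule Cc_infinity_on_mono)
  qed
qed

lemma GS_incl_commute:
  assumes b: "b \<in> GS" and f: "f \<in> Cc_infinity_on M (Norm b)"
  shows "\<iota> f * b = b * \<iota> (transf b f)"
  using b GS_iff incl_commute_transf Norm_unital_on[OF f] by blast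

text \<open>For f supported near z, fba = b(T f)a with T f supported near the source point, so only
  the germ of \<open>a\<close> at that point matters for the product.\<close>

lemma stalk_class_mult_cong:
  assumes b: "b \<in> GS" "z \<in> Norm b" and c: "cl z b = cl z c" and a: "cl (srcf b z) a = cl (srcf b z) d"
  shows "cl z (b * a) = cl z (c * d)"
proof -
  obtain N where N: "openin (mtop M) N" "z \<in> N" "\<And>f. f \<in> Cc_infinity_on M N \<Longrightarrow> \<iota> f * b = \<iota> f * c"
    using stalk_class_eqE[OF Norm_points[OF b(2)] c] by metis
  obtain N' where N': "openin (mtop M) N'" "srcf b z \<in> N'" "\<And>f. f \<in> Cc_infinity_on M N' \<Longrightarrow> \<iota> f * a = \<iota> f * d"
    using stalk_class_eqE[OF srcf_point[OF b] a] by metis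
  obtain W where W: "openin (mtop M) W" "z \<in> W" "W \<subseteq> Norm b"
    "\<And>f. f \<in> Cc_infinity_on M W \<Longrightarrow> transf b f \<in> Cc_infinity_on M N'"
    using localize[OF b N'(1,2)] by metis
  have oW: "openin (mtop M) (W \<inter> N)" using W N by blast
  obtain f :: "'m \<Rightarrow> 'k" where f: "f \<in> Cc_infinity_on M (W \<inter> N)" "same_germ M z f (\<lambda>_. 1)"
    using exists_bump[OF oW, of z] W N by blast
  have fW: "f \<in> Cc_infinity_on M W" and fN: "f \<in> Cc_infinity_on M N"
    by (rule Cc_infinity_on_mono[OF _ f(1)], blast)+
  have e: "\<iota> f * b = b * \<iota> (transf b f)" using GS_incl_commute[OF b(1) Cc_infinity_on_mono[OF W(3) fW]] .
  have "\<iota> f * (b * a) = b * (\<iota> (transf b f) * a)" using e by (simp add: mult.assoc[symmetric])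
  also have "\<dots> = b * (\<iota> (transf b f) * d)" using N'(3)[OF W(4)[OF fW]] by simp
  also have "\<dots> = \<iota> f * b * d" using e by (simp add: mult.assoc[symmetric])
  also have "\<dots> = \<iota> f * (c * d)" using N(3)[OF fN] by (simp add: mult.assoc)
  finally show ?thesis by (rule stalk_class_eqI[OF Cc_infinity_onD[OF f(1)] f(2)])
qed

text \<open>The product f\<epsilon>(ba) = fb'a'S(a)S(b) collapses from the inside: fb' = fb = b(T
  f), a'S(a) = \<epsilon>(a) is absorbed by T f, and b(T f)S(b) = fbS(b) = f. Here T is the transfer
  of \<open>b\<close>.\<close>

lemma product_unital_and_transf:
  assumes b: "b \<in> GS" and a: "a \<in> GS" and f: "f \<in> Cc_infinity_on M (Norm b)" "transf b f \<in> Cc_infinity_on M (Norm a)"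
  shows "unital_on f (b * a)" and "transf (b * a) f = transf a (transf b f)"
proof -
  obtain b' where b': "invariant_pair b b'" using b GS_iff by blast
  obtain a' where a': "invariant_pair a a'" using a GS_iff by blast
  have fR: "f \<in> Cc_infinity M" using f(1) by (rule Cc_infinity_onD)
  have uf: "unital_on f b" and ut: "unital_on (transf b f) a" using f Norm_unital_on by blast+
  note ba = invariant_pair_mult[OF b' a']
  have "\<iota> f * \<iota> (\<epsilon> (b * a)) = \<iota> f * (b' * a' * S (b * a))" using counit_eq[OF ba] by simp
  also have "\<dots> = \<iota> f * b' * (a' * S a) * S b" by (simp add: antipode_mult mult.assoc)
  also have "\<dots> = b * (\<iota> (transf b f) * \<iota> (\<epsilon> a)) * S b"
    using incl_prime[OF b' uf] incl_commute_transf[OF b' uf] counit_eq[OF a'] by (simp add: mult.assoc)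
  also have "\<iota> (transf b f) * \<iota> (\<epsilon> a) = \<iota> (transf b f)"
    using ut by (intro incl_absorb transf_closed counit_closed) (simp add: unital_on_def)
  also have "b * \<iota> (transf b f) * S b = \<iota> f"
    using incl_commute_transf[OF b' uf] incl_self_antipode[OF b' uf] by simp
  finally have "\<iota> (\<lambda>x. f x * \<epsilon> (b * a) x) = \<iota> f" using incl_mult[OF fR counit_closed] by simp
  then have "(\<lambda>x. f x * \<epsilon> (b * a) x) = f" by (rule inj_onD[OF incl_inj]) (intro R_mult fR counit_closed)+
  then show u: "unital_on f (b * a)" unfolding unital_on_def using fR by metis
  have "\<iota> (transf (b * a) f) = S (b * a) * (\<iota> f * (b * a))" using antipode_incl_self[OF ba u] by simp
  also have "\<dots> = S a * (S b * (\<iota> f * b)) * a" by (simp add: antipode_mult mult.assoc)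
  also have "\<dots> = S a * (\<iota> (transf b f) * a)" using antipode_incl_self[OF b' uf] by (simp add: mult.assoc)
  also have "\<dots> = \<iota> (transf a (transf b f))" using antipode_incl_self[OF a' ut] .
  finally show "transf (b * a) f = transf a (transf b f)"
    by (rule inj_onD[OF incl_inj]) (intro transf_closed)+
qed

lemma unital_imp_Norm:
  assumes "unital_on f a" "same_germ M z f (\<lambda>_. 1)" shows "z \<in> Norm a"
proof -
  obtain N where N: "openin (mtop M) N" "z \<in> N" "\<forall>x\<in>N. f x = 1" using assms(2) unfolding same_germ_def by blast
  have "\<epsilon> a x = 1" if "x \<in> N" for x using assms(1) N(3) that unfolding unital_on_def by (metis mult_1)
  then show ?thesis using N unfolding Norm_def normalized_at_def same_germ_def by blast
qed

lemma product_Norm_and_srcf: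
  assumes b: "b \<in> GS" "z \<in> Norm b" and a: "a \<in> GS" "srcf b z \<in> Norm a"
  shows "z \<in> Norm (b * a)" and "srcf (b * a) z = srcf a (srcf b z)"
proof -
  obtain W where W: "openin (mtop M) W" "z \<in> W" "W \<subseteq> Norm b"
    "\<And>f. f \<in> Cc_infinity_on M W \<Longrightarrow> transf b f \<in> Cc_infinity_on M (Norm a)"
    using localize[OF b openin_Norm a(2)] by metis
  have p: "unital_on f (b * a)" "transf (b * a) f = transf a (transf b f)"
    if f: "f \<in> Cc_infinity_on M W" for f
    using product_unital_and_transf[OF b(1) a(1) Cc_infinity_on_mono[OF W(3) f] W(4)[OF f]] by auto
  obtain f :: "'m \<Rightarrow> 'k" where f: "f \<in> Cc_infinity_on M W" "same_germ M z f (\<lambda>_. 1)"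
    using exists_bump[OF W(1,2)] by blast
  show n: "z \<in> Norm (b * a)" using unital_imp_Norm[OF p(1)[OF f(1)] f(2)] .
  show "srcf (b * a) z = srcf a (srcf b z)"
  proof (rule srcf_eqI[OF GS_mult[OF b(1) a(1)] n W(1,2)])
    fix f :: "'m \<Rightarrow> 'k" assume "f \<in> Cc_infinity_on M (W \<inter> Norm (b * a))"
    then have f: "f \<in> Cc_infinity_on M W" by (rule Cc_infinity_on_mono[rotated]) blast
    show "transf (b * a) f (srcf a (srcf b z)) = f z"
      using p(2)[OF f] srcf_transf[OF a W(4)[OF f]] srcf_transf[OF b Cc_infinity_on_mono[OF W(3) f]] by simp
  qed
qed

lemma spectral_mult_arr:
  assumes b: "b \<in> GS" "z \<in> Norm b" and a: "a \<in> GS" "y \<in> Norm a" and y: "srcf b z = y"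
  shows "spectral_mult M A (arr b z) (arr a y) = arr (b * a) z"
  unfolding spectral_mult_def
proof (rule the_equality)
  show "\<exists>c d. represents M A c (arr b z) \<and> represents M A d (arr a y) \<and>
      arr (b * a) z = (fst (arr b z), cl (fst (arr b z)) (c * d))"
    using a b by (intro exI[of _ b] exI[of _ a]) (simp add: represents_arr)
  fix k assume "\<exists>c d. represents M A c (arr b z) \<and> represents M A d (arr a y) \<and>
      k = (fst (arr b z), cl (fst (arr b z)) (c * d))"
  then obtain c d where "cl z b = cl z c" "cl y a = cl y d" "k = arr (c * d) z" unfolding represents_arr by auto
  then show "k = arr (b * a) z" using stalk_class_mult_cong[OF b, of c a d] y by simp
qed

section \<open>Units and inverses\<close>

lemma incl_Norm: "f \<in> Cc_infinity M \<Longrightarrow> same_germ M y f (\<lambda>_. 1) \<Longrightarrow> y \<in> Norm (\<iota> f)"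
  by (simp add: Norm_def normalized_at_def counit_incl)

lemma stalk_class_incl_eq:
  assumes f: "f \<in> Cc_infinity M" "same_germ M y f (\<lambda>_. 1)" and g: "g \<in> Cc_infinity M" "same_germ M y g (\<lambda>_. 1)"
  shows "cl y (\<iota> f) = cl y (\<iota> g)"
  using stalk_class_incl_mult[OF f, of "\<iota> g"] stalk_class_incl_mult[OF g, of "\<iota> f"] incl_commute[OF f(1) g(1)] by simp

lemma spectral_unit_arr:
  assumes f: "f \<in> Cc_infinity M" "same_germ M y f (\<lambda>_. 1)"
  shows "spectral_unit M A y = arr (\<iota> f) y"
  unfolding spectral_unit_def
proof (rule the_equality)
  show "\<exists>g\<in>Cc_infinity M. same_germ M y g (\<lambda>_. 1) \<and> arr (\<iota> f) y = arr (\<iota> g) y" using f by blast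
  fix h assume "\<exists>g\<in>Cc_infinity M. same_germ M y g (\<lambda>_. 1) \<and> h = arr (\<iota> g) y"
  then show "h = arr (\<iota> f) y" using stalk_class_incl_eq[OF _ _ f] by auto
qed

text \<open>S fixes the base ring, so the transfer along \<open>f\<close> fixes every g with gf =
  g.\<close>

lemma srcf_incl:
  assumes f: "f \<in> Cc_infinity M" "same_germ M y f (\<lambda>_. 1)"
  shows "srcf (\<iota> f) y = y"
proof -
  obtain N where N: "openin (mtop M) N" "y \<in> N" "\<forall>x\<in>N. f x = 1" using f(2) unfolding same_germ_def by blast
  show ?thesis
  proof (rule srcf_eqI[OF GS_incl[OF f(1)] incl_Norm[OF f] N(1,2)])
    fix g :: "'m \<Rightarrow> 'k" assume g: "g \<in> Cc_infinity_on M (N \<inter> Norm (\<iota> f))"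
    have gR: "g \<in> Cc_infinity M" using g by (rule Cc_infinity_onD)
    have "g x * f x = g x" for x using N(3) Cc_infinity_on_zero[OF g, of x] by (cases "x \<in> N") auto
    then have "\<iota> g * \<iota> f = \<iota> g" by (rule incl_absorb[OF gR f(1)])
    then show "transf (\<iota> f) g y = g y" by (simp add: transf_def antipode_incl[OF gR] counit_incl[OF gR])
  qed
qed

text \<open>From fa = fb one gets S(a)f = S(b)f, that is (T f)S(a) = (T f)S(b), and T f is 1 near
  the source point when f is 1 near y.\<close>

lemma antipode_stalk_class_cong:
  assumes a: "a \<in> GS" "y \<in> Norm a" and b: "b \<in> GS" "y \<in> Norm b" and eq: "cl y a = cl y b"
  shows "cl (srcf a y) (S a) = cl (srcf a y) (S b)"
proof -
  obtain N where N: "openin (mtop M) N" "y \<in> N" "\<And>f. f \<in> Cc_infinity_on M N \<Longrightarrow> \<iota> f * a = \<iota> f * b"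
    using stalk_class_eqE[OF Norm_points[OF a(2)] eq] by metis
  have o: "openin (mtop M) (N \<inter> Norm a \<inter> Norm b)" using N openin_Norm by blast
  obtain f :: "'m \<Rightarrow> 'k" where f: "f \<in> Cc_infinity_on M (N \<inter> Norm a \<inter> Norm b)" "same_germ M y f (\<lambda>_. 1)"
    using exists_bump[OF o, of y] N a b by blast
  have f': "f \<in> Cc_infinity_on M N" "f \<in> Cc_infinity_on M (Norm a)" "f \<in> Cc_infinity_on M (Norm b)"
    by (rule Cc_infinity_on_mono[OF _ f(1)], blast)+
  have fR: "f \<in> Cc_infinity M" using f(1) by (rule Cc_infinity_onD)
  obtain a' b' where p: "invariant_pair a a'" "invariant_pair b b'" using a b GS_iff by blast
  have "S a * \<iota> f = S b * \<iota> f" using N(3)[OF f'(1)] antipode_incl_mult[OF fR] by metis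
  then have "\<iota> (transf a f) * S a = \<iota> (transf a f) * S b"
    using antipode_incl_commute[OF p(1) Norm_unital_on[OF f'(2)]] antipode_incl_commute[OF p(2) Norm_unital_on[OF f'(3)]]
      transf_cong[OF N(3)[OF f'(1)]] by simp
  then show ?thesis
    by (rule stalk_class_eqI[OF transf_closed srcf_germ[OF a f'(2) f(2)]])
qed

lemma spectral_inv_arr:
  assumes a: "a \<in> GS" "y \<in> Norm a"
  shows "spectral_inv M A (arr a y) = arr (S a) (srcf a y)"
  unfolding spectral_inv_def spectral_src_arr[OF a]
proof (rule the_equality)
  show "\<exists>b. represents M A b (arr a y) \<and> arr (S a) (srcf a y) = arr (S b) (srcf a y)"
    using a by (intro exI[of _ a]) (simp add: represents_arr)
  fix k assume "\<exists>b. represents M A b (arr a y) \<and> k = arr (S b) (srcf a y)"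
  then obtain b where "b \<in> GS" "y \<in> Norm b" "cl y a = cl y b" "k = arr (S b) (srcf a y)" unfolding represents_arr by blast
  then show "k = arr (S a) (srcf a y)" using antipode_stalk_class_cong[OF a] by simp
qed

text \<open>\<open>S(a)\<close> itself need not be \<open>S\<close>-invariant weakly grouplike, but \<open>S(fa)\<close> is, and it has the same
  germs as \<open>S(a)\<close> where it is normalized.\<close>

lemma inverse_representative:
  assumes a: "a \<in> GS" "y \<in> Norm a" and f: "f \<in> Cc_infinity_on M (Norm a)" "same_germ M y f (\<lambda>_. 1)"
  shows "S (\<iota> f * a) \<in> GS" and "srcf a y \<in> Norm (S (\<iota> f * a))"
    and "cl (srcf a y) (S (\<iota> f * a)) = cl (srcf a y) (S a)"
    and "srcf (S (\<iota> f * a)) (srcf a y) = y"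
    and "S (\<iota> f * a) * a = \<iota> (transf a f)" and "a * S (\<iota> f * a) = \<iota> f"
proof -
  obtain a' where a': "invariant_pair a a'" using a GS_iff by blast
  have u: "unital_on f a" using Norm_unital_on[OF f(1)] .
  have fR: "f \<in> Cc_infinity M" using f(1) by (rule Cc_infinity_onD)
  let ?b = "S (\<iota> f * a)" and ?x = "srcf a y"
  show b: "?b \<in> GS" using invariant_pair_antipode[OF a' u] GS_iff by blast
  show n: "?x \<in> Norm ?b"
    using srcf_germ[OF a f] by (simp add: Norm_def normalized_at_def transf_def)
  have bf: "?b = \<iota> (transf a f) * S a"
    using antipode_incl_mult[OF fR] antipode_incl_commute[OF a' u] by simp
  show "cl ?x ?b = cl ?x (S a)" unfolding bf by (rule stalk_class_incl_mult[OF transf_closed srcf_germ[OF a f]])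
  show "?b * a = \<iota> (transf a f)"
    using antipode_incl_self[OF a' u] antipode_incl_mult[OF fR] by (simp add: mult.assoc)
  show "a * ?b = \<iota> f"
    unfolding bf using incl_commute_transf[OF a' u] incl_self_antipode[OF a' u] by (simp add: mult.assoc[symmetric])
  show "srcf ?b ?x = y"
  proof (rule srcf_eqI[OF b n])
    have "openin (mtop M) (srcf a ` Norm a)" using srcf_etale[OF a(1)] by (simp add: etale_on_def)
    then show "openin (mtop M) (srcf a ` Norm a)" .
    show "?x \<in> srcf a ` Norm a" using a by blast
    fix g :: "'m \<Rightarrow> 'k" assume "g \<in> Cc_infinity_on M (srcf a ` Norm a \<inter> Norm ?b)"
    then have g: "g \<in> Cc_infinity_on M (srcf a ` Norm a)" by (rule Cc_infinity_on_mono[rotated]) blast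
    \<comment> \<open>Near the source point every test function is g = T \<phi>. Its transfer along
      S(fa) is \<epsilon>(fag) = \<epsilon>(f\<phi>a) = f\<phi>\<epsilon>(a), whose value at y is
      \<phi>(y), the value of g at the source point.\<close>
    then obtain \<phi> where \<phi>: "\<phi> \<in> Cc_infinity_on M (Norm a)" "transf a \<phi> = g"
      using transport_inv_local_inverse[OF a(1) openin_Norm NormD] by blast
    have \<phi>R: "\<phi> \<in> Cc_infinity M" using \<phi>(1) by (rule Cc_infinity_onD)
    have "transf ?b g = \<epsilon> (\<iota> f * (a * \<iota> g))"
      using transf_closed[of a \<phi>] \<phi>(2) by (simp add: transf_def antipode_mult antipode_antipode antipode_incl mult.assoc)
    also have "a * \<iota> g = \<iota> \<phi> * a" using incl_commute_transf[OF a' Norm_unital_on[OF \<phi>(1)]] \<phi>(2) by simp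
    also have "\<epsilon> (\<iota> f * (\<iota> \<phi> * a)) = (\<lambda>x. f x * (\<phi> x * \<epsilon> a x))"
      using counit_left[OF fR] counit_left[OF \<phi>R] by simp
    finally have "transf ?b g y = f y * (\<phi> y * \<epsilon> a y)" by simp
    also have "\<dots> = \<phi> y" using same_germ_value[OF f(2)] Norm_unital_on[OF \<phi>(1)] by (simp add: unital_on_def)
    also have "\<dots> = g ?x" using srcf_transf[OF a \<phi>(1)] \<phi>(2) by simp
    finally show "transf ?b g y = g ?x" .
  qed
qed

lemma exists_inverse_representative:
  assumes a: "a \<in> GS" "y \<in> Norm a"
  obtains f :: "'m \<Rightarrow> 'k" where "f \<in> Cc_infinity_on M (Norm a)" "same_germ M y f (\<lambda>_. 1)"
  using exists_bump[OF openin_Norm a(2)] by blast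

lemma weakly_grouplike_GS: "a \<in> GS \<Longrightarrow> weakly_grouplike M A a"
  unfolding S_invariant_weakly_grouplike_def weakly_grouplike_def by blast

lemma good_sheet_Norm: "a \<in> GS \<Longrightarrow> good_sheet a (Norm a)"
  using weakly_grouplike_GS openin_Norm by (simp add: good_sheet_def)

lemma sheet_Norm_subset: "a \<in> GS \<Longrightarrow> sheet M A a (Norm a) \<subseteq> spectral_arrow_set M A"
  by (auto simp: sheet_def spectral_arrow_set_iff)

lemma openin_spectral_arrow_set: "openin (mtop \<E>) (spectral_arrow_set M A)"
proof (subst openin_subopen, intro ballI)
  fix g assume "g \<in> spectral_arrow_set M A"
  then obtain a y where a: "a \<in> GS" "y \<in> Norm a" "g = arr a y" unfolding spectral_arrow_set_iff by blast
  then have "g \<in> sheet M A a (Norm a)" by (simp add: mem_sheet)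
  then show "\<exists>T. openin (mtop \<E>) T \<and> g \<in> T \<and> T \<subseteq> spectral_arrow_set M A"
    using openin_sheet[OF good_sheet_Norm[OF a(1)]] sheet_Norm_subset[OF a(1)] by blast
qed

lemma groupoid_simps [simp]:
  "arrows \<G> = open_submanifold \<E> (spectral_arrow_set M A)" "gsrc \<G> = spectral_src M A" "gtgt \<G> = fst"
  "gmult \<G> = spectral_mult M A" "gunit \<G> = spectral_unit M A" "ginv \<G> = spectral_inv M A"
  by (simp_all add: spectral_groupoid_def)

lemma points_arrows: "points (arrows \<G>) = spectral_arrow_set M A"
  using points_open_submanifold[OF openin_subset[OF openin_spectral_arrow_set]] by simp

lemma arrowE:
  assumes "g \<in> points (arrows \<G>)"
  obtains a y where "a \<in> GS" "y \<in> Norm a" "g = arr a y"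
  using assms unfolding points_arrows spectral_arrow_set_iff by blast

lemma arr_in_arrows: "a \<in> GS \<Longrightarrow> y \<in> Norm a \<Longrightarrow> arr a y \<in> points (arrows \<G>)"
  unfolding points_arrows spectral_arrow_set_iff by blast

lemma composableE:
  assumes "(h, g) \<in> composable \<G>"
  obtains b z a where "b \<in> GS" "z \<in> Norm b" "h = arr b z" "a \<in> GS" "srcf b z \<in> Norm a" "g = arr a (srcf b z)"
proof -
  have hg: "h \<in> points (arrows \<G>)" "g \<in> points (arrows \<G>)" "spectral_src M A h = fst g"
    using assms by (simp_all add: composable_def)
  obtain b z where b: "b \<in> GS" "z \<in> Norm b" "h = arr b z" using arrowE[OF hg(1)] .
  obtain a y where a: "a \<in> GS" "y \<in> Norm a" "g = arr a y" using arrowE[OF hg(2)] .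
  have "srcf b z = y" using hg(3) a(3) b spectral_src_arr[OF b(1,2)] by simp
  then show thesis using that[OF b a(1)] a by blast
qed

lemma composable_mult:
  assumes b: "b \<in> GS" "z \<in> Norm b" and a: "a \<in> GS" "srcf b z \<in> Norm a"
  shows "spectral_mult M A (arr b z) (arr a (srcf b z)) = arr (b * a) z"
    "arr (b * a) z \<in> points (arrows \<G>)" "spectral_src M A (arr (b * a) z) = srcf a (srcf b z)"
  using spectral_mult_arr[OF b a HOL.refl] product_Norm_and_srcf[OF b a] GS_mult[OF b(1) a(1)]
    arr_in_arrows spectral_src_arr by metis+

lemma exists_unit:
  assumes "y \<in> points M"
  obtains f :: "'m \<Rightarrow> 'k" where "f \<in> Cc_infinity M" "same_germ M y f (\<lambda>_. 1)"
    "spectral_unit M A y = arr (\<iota> f) y" "\<iota> f \<in> GS" "y \<in> Norm (\<iota> f)" "srcf (\<iota> f) y = y"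
proof -
  obtain f :: "'m \<Rightarrow> 'k" where f: "f \<in> Cc_infinity M" "same_germ M y f (\<lambda>_. 1)"
    using exists_bump[OF openin_topspace assms] Cc_infinity_onD by blast
  show thesis by (rule that[OF f spectral_unit_arr[OF f] GS_incl[OF f(1)] incl_Norm[OF f] srcf_incl[OF f]])
qed

text \<open>For f supported close enough to y, T f is supported where h = 1, so fah = a(T f)h = a(T
  f) = fa.\<close>

lemma stalk_class_mult_unit:
  assumes a: "a \<in> GS" "y \<in> Norm a" and h: "h \<in> Cc_infinity M" "same_germ M (srcf a y) h (\<lambda>_. 1)"
  shows "cl y (a * \<iota> h) = cl y a"
proof -
  obtain N where N: "openin (mtop M) N" "srcf a y \<in> N" "\<forall>x\<in>N. h x = 1" using h(2) unfolding same_germ_def by blast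
  obtain W where W: "openin (mtop M) W" "y \<in> W" "W \<subseteq> Norm a"
    "\<And>f. f \<in> Cc_infinity_on M W \<Longrightarrow> transf a f \<in> Cc_infinity_on M N"
    using localize[OF a N(1,2)] by metis
  obtain f :: "'m \<Rightarrow> 'k" where f: "f \<in> Cc_infinity_on M W" "same_germ M y f (\<lambda>_. 1)" using exists_bump[OF W(1,2)] by blast
  have "transf a f x * h x = transf a f x" for x
    using N(3) Cc_infinity_on_zero[OF W(4)[OF f(1)], of x] by (cases "x \<in> N") auto
  then have 1: "\<iota> (transf a f) * \<iota> h = \<iota> (transf a f)" by (rule incl_absorb[OF transf_closed h(1)])
  have 2: "\<iota> f * a = a * \<iota> (transf a f)" using GS_incl_commute[OF a(1) Cc_infinity_on_mono[OF W(3) f(1)]] .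
  have "\<iota> f * (a * \<iota> h) = a * (\<iota> (transf a f) * \<iota> h)" using 2 by (simp add: mult.assoc[symmetric])
  also have "\<dots> = \<iota> f * a" using 1 2 by simp
  finally show ?thesis by (rule stalk_class_eqI[OF Cc_infinity_onD[OF f(1)] f(2)])
qed

lemma inv_arr:
  assumes a: "a \<in> GS" "y \<in> Norm a"
  obtains f b where "f \<in> Cc_infinity M" "same_germ M y f (\<lambda>_. 1)" "b \<in> GS" "srcf a y \<in> Norm b"
    "spectral_inv M A (arr a y) = arr b (srcf a y)" "srcf b (srcf a y) = y"
    "b * a = \<iota> (transf a f)" "a * b = \<iota> f" "same_germ M (srcf a y) (transf a f) (\<lambda>_. 1)"
proof -
  obtain f :: "'m \<Rightarrow> 'k" where f: "f \<in> Cc_infinity_on M (Norm a)" "same_germ M y f (\<lambda>_. 1)"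
    using exists_inverse_representative[OF a] .
  note r = inverse_representative[OF a f]
  show thesis
    using that[OF Cc_infinity_onD[OF f(1)] f(2) r(1,2) _ r(4,5,6) srcf_germ[OF a f]] spectral_inv_arr[OF a] r(3) by simp
qed

end

section \<open>The smooth structure of the spectral groupoid\<close>

lemma continuous_map_local:
  assumes "\<And>x. x \<in> topspace X \<Longrightarrow> \<exists>N. openin X N \<and> x \<in> N \<and> continuous_map (subtopology X N) Y f"
  shows "continuous_map X Y f"
proof -
  have "\<exists>N. x \<in> topspace X \<longrightarrow> openin X N \<and> x \<in> N \<and> continuous_map (subtopology X N) Y f" for x
    using assms[of x] by blast
  then obtain N where N: "\<And>x. x \<in> topspace X \<longrightarrow> openin X (N x) \<and> x \<in> N x \<and> continuous_map (subtopology X (N x)) Y f"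
    by metis
  show ?thesis
    by (rule pasting_lemma[where I = "topspace X" and T = N and f = "\<lambda>_. f"]) (use N in auto)
qed

lemma local_diffeomorphism_open_submanifold:
  assumes X: "smooth_manifold X" and Y: "smooth_manifold Y" and f: "local_diffeomorphism X Y f" and U: "openin (mtop X) U"
  shows "local_diffeomorphism (open_submanifold X U) Y f"
proof -
  let ?S = "open_submanifold X U"
  have S: "smooth_manifold ?S" using smooth_manifold_open_submanifold[OF X U] .
  have pS: "points ?S = U" using points_open_submanifold[OF openin_subset[OF U]] .
  have inv: "inv_into U (\<lambda>x. x) z = z" if "z \<in> U" for z using inv_into_f_f[of "\<lambda>x. x" U z] that by simp
  have "etale_on ?S X (\<lambda>x. x) U"
    unfolding etale_on_def
  proof (intro conjI ballI)
    show "openin (mtop ?S) U" using pS by (metis openin_topspace)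
    show "smooth_at ?S X (\<lambda>x. x) x" if "x \<in> U" for x by (rule smooth_at_inclusion[OF X U that])
    fix y assume "y \<in> (\<lambda>x. x) ` U"
    then have y: "y \<in> U" by simp
    show "smooth_at X ?S (inv_into U (\<lambda>x. x)) y"
      by (rule smooth_at_cong[OF X smooth_at_into_open_submanifold[OF X U y] U y]) (simp add: inv)
  qed (use U in simp_all)
  then have "local_diffeomorphism ?S X (\<lambda>x. x)"
    unfolding local_diffeomorphism_iff[OF S X] pS by blast
  from local_diffeomorphism_compose[OF S X Y this f] show ?thesis .
qed

lemma local_diffeomorphism_id:
  assumes X: "smooth_manifold X" shows "local_diffeomorphism X X (\<lambda>x. x)"
proof -
  have e: "etale_on X X (\<lambda>x. x) (points X)"
    unfolding etale_on_def
  proof (intro conjI ballI)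
    have s: "smooth_at X X (\<lambda>x. x) x" if x: "x \<in> points X" for x
    proof -
      obtain U \<phi> where c: "(U, \<phi>) \<in> atlas X" "x \<in> U" using atlas_cover[OF X x] by blast
      have o: "openin (Euclidean_space (mdim X)) (\<phi> ` U)" using chart_image_open[OF X c(1)] .
      have "smooth_between (mdim X) (mdim X) (\<phi> ` U) (\<phi> \<circ> (\<lambda>x. x) \<circ> inv_into U \<phi>)"
        by (rule smooth_between_cong[OF o smooth_between_id[OF o]]) (use chart_inj[OF X c(1)] in auto)
      then show ?thesis unfolding smooth_at_def using c chart_open[OF X c(1)]
        by (intro exI[of _ U] exI[of _ U] exI[of _ \<phi>] exI[of _ U] exI[of _ \<phi>]) auto
    qed
    show "smooth_at X X (\<lambda>x. x) x" if "x \<in> points X" for x using s[OF that] .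
    fix y assume "y \<in> (\<lambda>x. x) ` points X"
    then have y: "y \<in> points X" by simp
    show "smooth_at X X (inv_into (points X) (\<lambda>x. x)) y"
      by (rule smooth_at_cong[OF X s[OF y] openin_topspace y]) (use inv_into_f_f[of "\<lambda>x. x" "points X"] in simp)
  qed simp_all
  show ?thesis unfolding local_diffeomorphism_iff[OF X X] using e by blast
qed

section \<open>The manifold of composable pairs\<close>

context
  fixes M :: "'m manifold" and G :: "('m, 'g) groupoid"
  assumes M: "smooth_manifold M" and G: "smooth_manifold (arrows G)"
    and src: "local_diffeomorphism (arrows G) M (gsrc G)" and tgt: "local_diffeomorphism (arrows G) M (gtgt G)"
begin

lemma mtop_composable_pairs:
  "mtop (composable_pairs G) = subtopology (prod_topology (mtop (arrows G)) (mtop (arrows G))) (composable G)"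
  by (simp add: composable_pairs_def)

lemma points_composable_pairs: "points (composable_pairs G) = composable G"
  by (auto simp: mtop_composable_pairs composable_def)

lemma composable_pairs_box:
  assumes "openin (mtop (arrows G)) V" "openin (mtop (arrows G)) U"
  shows "openin (mtop (composable_pairs G)) (composable G \<inter> (V \<times> U))"
  unfolding mtop_composable_pairs openin_subtopology_Int2 openin_subtopology
  using assms openin_prod_Times_iff by blast

lemma composable_pairs_snd_continuous: "continuous_map (mtop (composable_pairs G)) (mtop (arrows G)) snd"
  unfolding mtop_composable_pairs by (intro continuous_map_from_subtopology continuous_map_snd)

lemma composable_pairs_fst_continuous: "continuous_map (mtop (composable_pairs G)) (mtop (arrows G)) fst"
  unfolding mtop_composable_pairs by (intro continuous_map_from_subtopology continuous_map_fst)

text \<open>If (g, h) lies in T, the arrows k near h whose target lies in the open set of sources of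
  arrows near g each have a composable partner there, so that k is again a second component of
  T.\<close>

lemma composable_pairs_snd_open: "open_map (mtop (composable_pairs G)) (mtop (arrows G)) snd"
  unfolding open_map_def
proof (intro allI impI)
  fix T assume T: "openin (mtop (composable_pairs G)) T"
  obtain P where P: "openin (prod_topology (mtop (arrows G)) (mtop (arrows G))) P" "T = P \<inter> composable G"
    using T unfolding mtop_composable_pairs openin_subtopology by blast
  show "openin (mtop (arrows G)) (snd ` T)"
  proof (subst openin_subopen, intro ballI)
    fix h assume "h \<in> snd ` T"
    then obtain g where gh: "(g, h) \<in> T" by force
    then have "(g, h) \<in> P" using P(2) by blast
    from P(1)[unfolded openin_prod_topology_alt, rule_format, OF this]
    obtain V U where VU: "openin (mtop (arrows G)) V" "openin (mtop (arrows G)) U" "g \<in> V" "h \<in> U" "V \<times> U \<subseteq> P"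
      by (elim exE conjE)
    have g: "g \<in> points (arrows G)" "h \<in> points (arrows G)" "gsrc G g = gtgt G h" using gh P by (auto simp: composable_def)
    obtain V0 where V0: "g \<in> V0" "etale_on (arrows G) M (gsrc G) V0"
      using src g(1) unfolding local_diffeomorphism_iff[OF G M] by blast
    have oV: "openin (mtop (arrows G)) (V \<inter> V0)" using VU V0 by (auto simp: etale_on_def)
    have oS: "openin (mtop M) (gsrc G ` (V \<inter> V0))" by (rule etale_on_open_image[OF G M V0(2) oV]) simp
    have oU: "openin (mtop (arrows G)) (U \<inter> {k \<in> points (arrows G). gtgt G k \<in> gsrc G ` (V \<inter> V0)})"
      using VU(2) openin_continuous_map_preimage[OF local_diffeomorphism_continuous[OF G M tgt] oS] by blast
    have "h \<in> U \<inter> {k \<in> points (arrows G). gtgt G k \<in> gsrc G ` (V \<inter> V0)}"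
      using VU(3,4) V0(1) g(2) g(3)[symmetric] by auto
    moreover have "U \<inter> {k \<in> points (arrows G). gtgt G k \<in> gsrc G ` (V \<inter> V0)} \<subseteq> snd ` T"
    proof
      fix k assume k: "k \<in> U \<inter> {k \<in> points (arrows G). gtgt G k \<in> gsrc G ` (V \<inter> V0)}"
      then obtain l where l: "l \<in> V" "gtgt G k = gsrc G l" by blast
      have "l \<in> points (arrows G)" using l(1) openin_subset[OF VU(1)] by blast
      then have "(l, k) \<in> T" using l k VU(5) P(2) by (auto simp: composable_def)
      then show "k \<in> snd ` T" by force
    qed
    ultimately show "\<exists>B. openin (mtop (arrows G)) B \<and> h \<in> B \<and> B \<subseteq> snd ` T" using oU by blast
  qed
qed

lemma atlas_composable_pairs:
  assumes "(T, \<theta>) \<in> atlas (composable_pairs G)"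
  shows "openin (mtop (composable_pairs G)) T \<and> inj_on snd T \<and>
    (\<exists>U \<phi>. (U, \<phi>) \<in> atlas (arrows G) \<and> snd ` T \<subseteq> U \<and> \<theta> = \<phi> \<circ> snd)"
proof -
  obtain V U \<phi> where *: "T = composable G \<inter> (V \<times> U)" "\<theta> = \<phi> \<circ> snd" "openin (mtop (arrows G)) V"
    "inj_on (gsrc G) V" "(U, \<phi>) \<in> atlas (arrows G)"
    using assms unfolding composable_pairs_def by auto
  have "inj_on snd T"
    unfolding *(1) using *(4) by (auto simp: inj_on_def composable_def)
  moreover have "snd ` T \<subseteq> U" unfolding *(1) by auto
  ultimately show ?thesis using composable_pairs_box[OF *(3) chart_open[OF G *(5)]] *(1,2,5) by blast
qed

lemma composable_pairs_cover: "points (composable_pairs G) \<subseteq> (\<Union>(T, \<theta>)\<in>atlas (composable_pairs G). T)"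
proof
  fix q assume "q \<in> points (composable_pairs G)"
  then obtain g h where q: "q = (g, h)" "(g, h) \<in> composable G" unfolding points_composable_pairs by (cases q) auto
  then have gh: "g \<in> points (arrows G)" "h \<in> points (arrows G)" by (auto simp: composable_def)
  obtain V where V: "g \<in> V" "etale_on (arrows G) M (gsrc G) V"
    using src gh(1) unfolding local_diffeomorphism_iff[OF G M] by blast
  obtain U \<phi> where c: "(U, \<phi>) \<in> atlas (arrows G)" "h \<in> U" using atlas_cover[OF G gh(2)] by blast
  have "(composable G \<inter> (V \<times> U), \<phi> \<circ> snd) \<in> atlas (composable_pairs G)"
    using V(2) c(1) unfolding composable_pairs_def etale_on_def by auto
  moreover have "q \<in> composable G \<inter> (V \<times> U)" using q V(1) c(2) by simp
  ultimately show "q \<in> (\<Union>(T, \<theta>)\<in>atlas (composable_pairs G). T)" by blast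
qed

lemma composable_pairs_dim: "mdim (composable_pairs G) = mdim (arrows G)"
  by (simp add: composable_pairs_def)

text \<open>The source of a product is the source of its second factor. Hence multiplication lifts
  the local diffeomorphism \<open>gsrc G\<close> \<circ> \<open>snd\<close> through
  \<open>gsrc G\<close>.\<close>

lemma mult_etale_if_continuous:
  assumes cont: "continuous_map (mtop (composable_pairs G)) (mtop (arrows G)) (\<lambda>(g, h). gmult G g h)"
    and s: "\<And>g h. (g, h) \<in> composable G \<Longrightarrow> gsrc G (gmult G g h) = gsrc G h"
  shows "local_diffeomorphism (composable_pairs G) (arrows G) (\<lambda>(g, h). gmult G g h)"
proof -
  note P = G composable_pairs_snd_continuous composable_pairs_snd_open composable_pairs_dim composable_pairs_cover atlas_composable_pairs
  have X: "smooth_manifold (composable_pairs G)" by (rule pullback_smooth_manifold[OF P])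
  have "local_diffeomorphism (composable_pairs G) (arrows G) snd" by (rule pullback_local_diffeomorphism[OF P])
  from local_diffeomorphism_compose[OF X G M this src]
  have "local_diffeomorphism (composable_pairs G) M (\<lambda>q. gsrc G (snd q))" .
  from local_diffeomorphism_cancel[OF X M G this src cont] show ?thesis
    using s by (auto simp: points_composable_pairs)
qed

end

section \<open>The structure maps as local diffeomorphisms\<close>

context hopf_algebroid_on_manifold
begin

lemma arrows_manifold: "smooth_manifold (arrows \<G>)"
  using smooth_manifold_open_submanifold[OF spectral_sheaf_manifold openin_spectral_arrow_set] by simp

lemma mtop_arrows: "mtop (arrows \<G>) = subtopology (mtop \<E>) (spectral_arrow_set M A)"
  by (simp add: open_submanifold_def)

lemma fst_etale: "local_diffeomorphism (arrows \<G>) M fst"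
  using local_diffeomorphism_open_submanifold[OF spectral_sheaf_manifold manifold spectral_sheaf_fst_etale openin_spectral_arrow_set]
  by simp

lemma openin_arrows_sheet:
  assumes "a \<in> GS" "openin (mtop M) W" "W \<subseteq> Norm a"
  shows "openin (mtop (arrows \<G>)) (sheet M A a W)"
proof -
  have "good_sheet a W" using assms weakly_grouplike_GS by (simp add: good_sheet_def)
  moreover have "sheet M A a W \<subseteq> spectral_arrow_set M A"
    using assms(3) sheet_Norm_subset[OF assms(1)] unfolding sheet_def by blast
  ultimately show ?thesis
    unfolding mtop_arrows using openin_sheet openin_open_subtopology[OF openin_spectral_arrow_set] by blast
qed

text \<open>Elements with the same germ at a point have the same germs near it, so the preimage of a
  sheet under the section is open.\<close>

lemma section_continuous:
  assumes a: "a \<in> GS"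
  shows "continuous_map (subtopology (mtop M) (Norm a)) (mtop (arrows \<G>)) (arr a)"
  unfolding mtop_arrows continuous_map_in_subtopology
proof
  have N: "topspace (subtopology (mtop M) (Norm a)) = Norm a" using openin_subset[OF openin_Norm] by auto
  have sub: "arr a y \<in> spectral_arrow_set M A" if "y \<in> Norm a" for y using a that spectral_arrow_set_iff by blast
  then show "arr a \<in> topspace (subtopology (mtop M) (Norm a)) \<rightarrow> spectral_arrow_set M A" unfolding N by blast
  show "continuous_map (subtopology (mtop M) (Norm a)) (mtop \<E>) (arr a)"
    unfolding continuous_map_def N
  proof (intro conjI allI impI)
    show "arr a \<in> Norm a \<rightarrow> points \<E>" using sub openin_subset[OF openin_spectral_arrow_set] by blast
    fix T assume T: "openin (mtop \<E>) T"
    have "openin (mtop M) {y \<in> Norm a. arr a y \<in> T}"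
    proof (subst openin_subopen, intro ballI)
      fix y assume y: "y \<in> {y \<in> Norm a. arr a y \<in> T}"
      then obtain b W where b: "good_sheet b W" "arr a y \<in> sheet M A b W" "sheet M A b W \<subseteq> T"
        using sheet_basis[OF T, of "arr a y"] by blast
      then have yW: "y \<in> W" "cl y a = cl y b" by (simp_all add: mem_sheet)
      have "y \<in> points M" using y Norm_points by blast
      from stalk_class_eqE[OF this yW(2)]
      obtain N where N: "openin (mtop M) N" "y \<in> N" "\<And>x. x \<in> N \<Longrightarrow> cl x a = cl x b" by metis
      have "arr a x \<in> T" if "x \<in> N \<inter> W" for x using that N(3)[of x] b(3) by (auto simp: mem_sheet subset_iff)
      then have "N \<inter> W \<inter> Norm a \<subseteq> {y \<in> Norm a. arr a y \<in> T}" by blast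
      moreover have "openin (mtop M) (N \<inter> W \<inter> Norm a)" using N(1) b(1) openin_Norm by (simp add: good_sheet_def openin_Int)
      ultimately show "\<exists>B. openin (mtop M) B \<and> y \<in> B \<and> B \<subseteq> {y \<in> Norm a. arr a y \<in> T}" using N(2) yW(1) y by blast
    qed
    then show "openin (subtopology (mtop M) (Norm a)) {y \<in> Norm a. arr a y \<in> T}"
      using openin_open_subtopology[OF openin_Norm[of a]] by auto
  qed
qed

lemma arrow_nbhd:
  assumes "g \<in> points (arrows \<G>)"
  obtains a where "a \<in> GS" "fst g \<in> Norm a" "g = arr a (fst g)"
    "openin (mtop (arrows \<G>)) (sheet M A a (Norm a))" "g \<in> sheet M A a (Norm a)"
proof -
  obtain a y where a: "a \<in> GS" "y \<in> Norm a" "g = arr a y" using arrowE[OF assms] .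
  show thesis using that[of a] a openin_arrows_sheet[OF a(1) openin_Norm] by (simp add: mem_sheet)
qed

lemma arrows_fst_continuous: "continuous_map (mtop (arrows \<G>)) (mtop M) fst"
  by (rule local_diffeomorphism_continuous[OF arrows_manifold manifold fst_etale])

text \<open>The common pattern of all continuity proofs below: locally the map is a continuous map
  to M followed by the section of one fixed element.\<close>

lemma continuous_via_sections:
  assumes p: "continuous_map X (mtop M) p"
    and f: "\<And>x. x \<in> topspace X \<Longrightarrow> \<exists>N a. openin X N \<and> x \<in> N \<and> a \<in> GS \<and> (\<forall>z\<in>N. p z \<in> Norm a \<and> f z = arr a (p z))"
  shows "continuous_map X (mtop (arrows \<G>)) f"
proof (rule continuous_map_local)
  fix x assume "x \<in> topspace X"
  then obtain N a where N: "openin X N" "x \<in> N" "a \<in> GS" "\<forall>z\<in>N. p z \<in> Norm a \<and> f z = arr a (p z)" using f by blast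
  have "continuous_map (subtopology X N) (subtopology (mtop M) (Norm a)) p"
    using continuous_map_from_subtopology[OF p] N(4) by (auto simp: continuous_map_in_subtopology)
  from continuous_map_compose[OF this section_continuous[OF N(3)]]
  have "continuous_map (subtopology X N) (mtop (arrows \<G>)) (arr a \<circ> p)" .
  then have "continuous_map (subtopology X N) (mtop (arrows \<G>)) f"
    by (rule continuous_map_eq) (use N(4) in auto)
  then show "\<exists>N. openin X N \<and> x \<in> N \<and> continuous_map (subtopology X N) (mtop (arrows \<G>)) f" using N by blast
qed

lemma src_etale: "local_diffeomorphism (arrows \<G>) M (spectral_src M A)"
  unfolding local_diffeomorphism_iff[OF arrows_manifold manifold]
proof
  fix g assume g: "g \<in> points (arrows \<G>)"
  obtain a where a: "a \<in> GS" "fst g \<in> Norm a" "g = arr a (fst g)"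
    "openin (mtop (arrows \<G>)) (sheet M A a (Norm a))" "g \<in> sheet M A a (Norm a)" using arrow_nbhd[OF g] .
  obtain U where U: "g \<in> U" "etale_on (arrows \<G>) M fst U"
    using fst_etale g unfolding local_diffeomorphism_iff[OF arrows_manifold manifold] by blast
  let ?U = "U \<inter> sheet M A a (Norm a)"
  have o: "openin (mtop (arrows \<G>)) ?U" using U(2) a(4) by (auto simp: etale_on_def)
  have e: "etale_on (arrows \<G>) M fst ?U" by (rule etale_on_subset[OF arrows_manifold manifold U(2) o]) simp
  have "fst ` ?U \<subseteq> Norm a" by (auto simp: mem_sheet)
  from etale_on_compose[OF arrows_manifold manifold manifold e srcf_etale[OF a(1)] this]
  have "etale_on (arrows \<G>) M (\<lambda>h. srcf a (fst h)) ?U" .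
  then have "etale_on (arrows \<G>) M (spectral_src M A) ?U"
  proof (rule etale_on_cong[OF arrows_manifold])
    fix h assume "h \<in> ?U"
    then have "fst h \<in> Norm a" "h = arr a (fst h)" by (auto simp: mem_sheet prod_eq_iff)
    then show "srcf a (fst h) = spectral_src M A h" using spectral_src_arr[OF a(1), of "fst h"] by metis
  qed
  then show "\<exists>U. g \<in> U \<and> etale_on (arrows \<G>) M (spectral_src M A) U" using U(1) a(5) by blast
qed

lemma src_continuous: "continuous_map (mtop (arrows \<G>)) (mtop M) (spectral_src M A)"
  by (rule local_diffeomorphism_continuous[OF arrows_manifold manifold src_etale])

lemma unit_etale: "local_diffeomorphism M (arrows \<G>) (spectral_unit M A)"
\<comment> \<open>The unit map lifts the identity of M through the target map.\<close>
proof (rule local_diffeomorphism_cancel[OF manifold manifold arrows_manifold local_diffeomorphism_id[OF manifold] fst_etale])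
  show "continuous_map (mtop M) (mtop (arrows \<G>)) (spectral_unit M A)"
  proof (rule continuous_via_sections[OF continuous_map_id[unfolded id_def]])
    fix x assume "x \<in> points M"
    then obtain f :: "'m \<Rightarrow> 'k" where f: "f \<in> Cc_infinity M" "same_germ M x f (\<lambda>_. 1)" by (rule exists_unit)
    obtain N where N: "openin (mtop M) N" "x \<in> N" "\<forall>z\<in>N. f z = 1" using f(2) unfolding same_germ_def by blast
    have "z \<in> Norm (\<iota> f) \<and> spectral_unit M A z = arr (\<iota> f) z" if "z \<in> N" for z
    proof -
      have "same_germ M z f (\<lambda>_. 1)" using N that unfolding same_germ_def by blast
      then show ?thesis using incl_Norm[OF f(1)] spectral_unit_arr[OF f(1)] by blast
    qed
    then show "\<exists>N a. openin (mtop M) N \<and> x \<in> N \<and> a \<in> GS \<and> (\<forall>z\<in>N. z \<in> Norm a \<and> spectral_unit M A z = arr a z)"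
      using N GS_incl[OF f(1)] by blast
  qed
  show "fst (spectral_unit M A x) = x" if "x \<in> points M" for x using exists_unit[OF that] by (metis fst_conv)
qed

lemma inv_etale: "local_diffeomorphism (arrows \<G>) (arrows \<G>) (spectral_inv M A)"
\<comment> \<open>The target of an inverse is the source, so inversion lifts the source map through
  the target map.\<close>
proof (rule local_diffeomorphism_cancel[OF arrows_manifold manifold arrows_manifold src_etale fst_etale])
  show "continuous_map (mtop (arrows \<G>)) (mtop (arrows \<G>)) (spectral_inv M A)"
  proof (rule continuous_via_sections[OF src_continuous])
    fix g assume g: "g \<in> points (arrows \<G>)"
    obtain a y where a: "a \<in> GS" "y \<in> Norm a" "g = arr a y" using arrowE[OF g] .
    obtain f :: "'m \<Rightarrow> 'k" where f: "f \<in> Cc_infinity_on M (Norm a)" "same_germ M y f (\<lambda>_. 1)"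
      using exists_inverse_representative[OF a(1,2)] .
    \<comment> \<open>One \<open>f\<close> serves for all arrows of the sheet over N, where f = 1:
      there S(fa) represents all the inverses at once.\<close>
    obtain N where N: "openin (mtop M) N" "y \<in> N" "\<forall>z\<in>N. f z = 1" using f(2) unfolding same_germ_def by blast
    let ?b = "S (\<iota> f * a)"
    have o: "openin (mtop (arrows \<G>)) (sheet M A a (N \<inter> Norm a))"
      using N(1) openin_Norm by (intro openin_arrows_sheet[OF a(1)]) auto
    have "spectral_src M A h \<in> Norm ?b \<and> spectral_inv M A h = arr ?b (spectral_src M A h)"
      if h: "h \<in> sheet M A a (N \<inter> Norm a)" for h
    proof -
      obtain w where w: "w \<in> N" "w \<in> Norm a" "h = arr a w" using h by (auto simp: sheet_def)
      have "same_germ M w f (\<lambda>_. 1)" using N w(1) unfolding same_germ_def by blast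
      from inverse_representative[OF a(1) w(2) f(1) this] show ?thesis
        using spectral_src_arr[OF a(1) w(2)] spectral_inv_arr[OF a(1) w(2)] w(3) by simp
    qed
    moreover have "?b \<in> GS" using inverse_representative(1)[OF a(1,2) f] .
    moreover have "g \<in> sheet M A a (N \<inter> Norm a)" using a N(2) by (simp add: mem_sheet)
    ultimately show "\<exists>N b. openin (mtop (arrows \<G>)) N \<and> g \<in> N \<and> b \<in> GS \<and>
        (\<forall>h\<in>N. spectral_src M A h \<in> Norm b \<and> spectral_inv M A h = arr b (spectral_src M A h))"
      using o by blast
  qed
  show "fst (spectral_inv M A g) = spectral_src M A g" if "g \<in> points (arrows \<G>)" for g
    using arrowE[OF that] spectral_inv_arr spectral_src_arr by (metis fst_conv)
qed

lemma mult_etale: "local_diffeomorphism (composable_pairs \<G>) (arrows \<G>) (\<lambda>(g, h). gmult \<G> g h)"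
proof (rule mult_etale_if_continuous[OF manifold arrows_manifold])
  show "local_diffeomorphism (arrows \<G>) M (gsrc \<G>)" "local_diffeomorphism (arrows \<G>) M (gtgt \<G>)"
    using src_etale fst_etale by simp_all
  then have st: "local_diffeomorphism (arrows \<G>) M (gsrc \<G>)" "local_diffeomorphism (arrows \<G>) M (gtgt \<G>)" .
  note cp = manifold arrows_manifold st
  show "continuous_map (mtop (composable_pairs \<G>)) (mtop (arrows \<G>)) (\<lambda>(g, h). gmult \<G> g h)"
  proof (rule continuous_via_sections)
    show "continuous_map (mtop (composable_pairs \<G>)) (mtop M) (fst \<circ> fst)"
      by (rule continuous_map_compose[OF composable_pairs_fst_continuous[OF cp] arrows_fst_continuous])
    fix q assume "q \<in> points (composable_pairs \<G>)"
    then have q: "(fst q, snd q) \<in> composable \<G>" unfolding points_composable_pairs[OF cp] by simp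
    obtain b z a where b: "b \<in> GS" "z \<in> Norm b" "fst q = arr b z" and a: "a \<in> GS" "srcf b z \<in> Norm a" "snd q = arr a (srcf b z)"
      using composableE[OF q] by metis
    \<comment> \<open>For composable arrows from these two sheets the product is always represented
      by the single element ba.\<close>
    let ?N = "composable \<G> \<inter> (sheet M A b (Norm b) \<times> sheet M A a (Norm a))"
    have o: "openin (mtop (composable_pairs \<G>)) ?N"
      by (rule composable_pairs_box[OF cp]) (use openin_arrows_sheet[OF _ openin_Norm] a(1) b(1) in auto)
    have "(fst \<circ> fst) r \<in> Norm (b * a) \<and> (\<lambda>(g, h). gmult \<G> g h) r = arr (b * a) ((fst \<circ> fst) r)" if r: "r \<in> ?N" for r
    proof -
      obtain w v where w: "r = (arr b w, arr a v)" "w \<in> Norm b" "v \<in> Norm a" using r by (auto simp: sheet_def)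
      have "spectral_src M A (arr b w) = v" using r w(1) by (simp add: composable_def)
      then have v: "srcf b w = v" using spectral_src_arr[OF b(1) w(2)] by simp
      then show ?thesis
        using product_Norm_and_srcf(1)[OF b(1) w(2) a(1)] composable_mult(1)[OF b(1) w(2) a(1)] w by simp
    qed
    moreover have "q \<in> ?N" using q a b by (cases q) (simp add: mem_sheet)
    ultimately show "\<exists>N c. openin (mtop (composable_pairs \<G>)) N \<and> q \<in> N \<and> c \<in> GS \<and>
        (\<forall>r\<in>N. (fst \<circ> fst) r \<in> Norm c \<and> (\<lambda>(g, h). gmult \<G> g h) r = arr c ((fst \<circ> fst) r))"
      using o GS_mult[OF b(1) a(1)] by blast
  qed
  show "gsrc \<G> (gmult \<G> g h) = gsrc \<G> h" if gh: "(g, h) \<in> composable \<G>" for g h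
  proof -
    obtain b z a where b: "b \<in> GS" "z \<in> Norm b" "g = arr b z" and a: "a \<in> GS" "srcf b z \<in> Norm a" "h = arr a (srcf b z)"
      using composableE[OF gh] .
    show ?thesis using composable_mult[OF b(1,2) a(1,2)] spectral_src_arr[OF a(1,2)] a b by simp
  qed
qed

text \<open>On representatives the groupoid laws become identities of the algebra: associativity is
  that of A, and the inverse laws are S(fa)a = T f and aS(fa) = f, whose right-hand sides represent
  units.\<close>

lemma spectral_etale_groupoid: "etale_groupoid M \<G>"
proof
  show "smooth_manifold M" by (rule manifold)
  show "smooth_manifold (arrows \<G>)" by (rule arrows_manifold)
  show "local_diffeomorphism (arrows \<G>) M (gsrc \<G>)" "local_diffeomorphism (arrows \<G>) M (gtgt \<G>)"
    "local_diffeomorphism M (arrows \<G>) (gunit \<G>)" "local_diffeomorphism (arrows \<G>) (arrows \<G>) (ginv \<G>)"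
    using src_etale fst_etale unit_etale inv_etale by simp_all
  show "local_diffeomorphism (composable_pairs \<G>) (arrows \<G>) (\<lambda>(g, h). gmult \<G> g h)" by (rule mult_etale)
next
  fix g assume g: "g \<in> points (arrows \<G>)"
  obtain a y where a: "a \<in> GS" "y \<in> Norm a" "g = arr a y" using arrowE[OF g] .
  have sg: "spectral_src M A g = srcf a y" using spectral_src_arr[OF a(1,2)] a(3) by simp
  show "gsrc \<G> g \<in> points M" using sg srcf_point[OF a(1,2)] by simp
  show "gtgt \<G> g \<in> points M" using a Norm_points by simp
  obtain f b where b: "f \<in> Cc_infinity M" "same_germ M y f (\<lambda>_. 1)" "b \<in> GS" "srcf a y \<in> Norm b"
    "spectral_inv M A (arr a y) = arr b (srcf a y)" "srcf b (srcf a y) = y"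
    "b * a = \<iota> (transf a f)" "a * b = \<iota> f" "same_germ M (srcf a y) (transf a f) (\<lambda>_. 1)"
    using inv_arr[OF a(1,2)] .
  show "ginv \<G> g \<in> points (arrows \<G>)" using arr_in_arrows[OF b(3,4)] b(5) a(3) by simp
  show "gsrc \<G> (ginv \<G> g) = gtgt \<G> g" using spectral_src_arr[OF b(3,4)] b(5,6) a(3) by simp
  show "gtgt \<G> (ginv \<G> g) = gsrc \<G> g" using sg b(5) a(3) by simp
  have u: "spectral_unit M A (srcf a y) = arr (\<iota> (transf a f)) (srcf a y)"
    by (rule spectral_unit_arr[OF transf_closed b(9)])
  show "gmult \<G> (ginv \<G> g) g = gunit \<G> (gsrc \<G> g)"
    using spectral_mult_arr[OF b(3,4) a(1,2) b(6)] b(5,7) a(3) u sg by simp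
  show "gmult \<G> g (ginv \<G> g) = gunit \<G> (gtgt \<G> g)"
    using spectral_mult_arr[OF a(1,2) b(3,4) HOL.refl] b(5,8) a(3) spectral_unit_arr[OF b(1,2)] by simp
  obtain h :: "'m \<Rightarrow> 'k" where h: "h \<in> Cc_infinity M" "same_germ M (srcf a y) h (\<lambda>_. 1)"
    "spectral_unit M A (srcf a y) = arr (\<iota> h) (srcf a y)" "\<iota> h \<in> GS" "srcf a y \<in> Norm (\<iota> h)" "srcf (\<iota> h) (srcf a y) = srcf a y"
    using exists_unit[OF srcf_point[OF a(1,2)]] .
  show "gmult \<G> g (gunit \<G> (gsrc \<G> g)) = g"
    using spectral_mult_arr[OF a(1,2) h(4,5) HOL.refl] stalk_class_mult_unit[OF a(1,2) h(1,2)] h(3) sg a(3) by simp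
  obtain k :: "'m \<Rightarrow> 'k" where k: "k \<in> Cc_infinity M" "same_germ M y k (\<lambda>_. 1)"
    "spectral_unit M A y = arr (\<iota> k) y" "\<iota> k \<in> GS" "y \<in> Norm (\<iota> k)" "srcf (\<iota> k) y = y"
    using exists_unit[OF Norm_points[OF a(2)]] .
  show "gmult \<G> (gunit \<G> (gtgt \<G> g)) g = g"
    using spectral_mult_arr[OF k(4,5) a(1,2) k(6)] stalk_class_incl_mult[OF k(1,2)] k(3) a(3) by simp
next
  fix x assume "x \<in> points M"
  then obtain f :: "'m \<Rightarrow> 'k" where f: "f \<in> Cc_infinity M" "same_germ M x f (\<lambda>_. 1)"
    "spectral_unit M A x = arr (\<iota> f) x" "\<iota> f \<in> GS" "x \<in> Norm (\<iota> f)" "srcf (\<iota> f) x = x" by (rule exists_unit)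
  show "gunit \<G> x \<in> points (arrows \<G>)" using arr_in_arrows[OF f(4,5)] f(3) by simp
  show "gsrc \<G> (gunit \<G> x) = x" using spectral_src_arr[OF f(4,5)] f(3,6) by simp
  show "gtgt \<G> (gunit \<G> x) = x" using f(3) by simp
next
  fix g h assume gh: "(g, h) \<in> composable \<G>"
  obtain b z a where b: "b \<in> GS" "z \<in> Norm b" "g = arr b z" and a: "a \<in> GS" "srcf b z \<in> Norm a" "h = arr a (srcf b z)"
    using composableE[OF gh] .
  note m = composable_mult[OF b(1,2) a(1,2)]
  show "gmult \<G> g h \<in> points (arrows \<G>)" using m a b by simp
  show "gsrc \<G> (gmult \<G> g h) = gsrc \<G> h" using m a b spectral_src_arr[OF a(1,2)] by simp
  show "gtgt \<G> (gmult \<G> g h) = gtgt \<G> g" using m a b by simp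
  fix k assume hk: "(h, k) \<in> composable \<G>"
  have "k \<in> points (arrows \<G>)" using hk by (simp add: composable_def)
  then obtain c v where c: "c \<in> GS" "v \<in> Norm c" "k = arr c v" by (rule arrowE)
  have v: "v = srcf a (srcf b z)" using hk spectral_src_arr[OF a(1,2)] a(3) c(3) by (simp add: composable_def)
  note p = product_Norm_and_srcf[OF b(1,2) a(1,2)] and q = product_Norm_and_srcf[OF a(1,2) c(1), folded v, OF c(2)]
  have 1: "spectral_mult M A (arr (b * a) z) (arr c v) = arr (b * a * c) z"
    by (rule spectral_mult_arr[OF GS_mult[OF b(1) a(1)] p(1) c(1,2)]) (simp add: p(2) v)
  have 2: "spectral_mult M A (arr a (srcf b z)) (arr c v) = arr (a * c) (srcf b z)"
    by (rule spectral_mult_arr[OF a(1,2) c(1,2)]) (simp add: v)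
  have 3: "spectral_mult M A (arr b z) (arr (a * c) (srcf b z)) = arr (b * (a * c)) z"
    by (rule spectral_mult_arr[OF b(1,2) GS_mult[OF a(1) c(1)] q(1) HOL.refl])
  show "gmult \<G> (gmult \<G> g h) k = gmult \<G> g (gmult \<G> h k)"
    using m(1) 1 2 3 a(3) b(3) c(3) by (simp add: mult.assoc)
qed

end

section \<open>Functoriality\<close>

locale hopf_algebroid_hom_on_manifold =
  hopf_algebroid_hom M A B \<alpha> + hausdorff_manifold M
  for M :: "'m manifold"
    and A :: "('k::real_or_complex, 'm, 'a::ring) hopf_structure"
    and B :: "('k, 'm, 'b::ring) hopf_structure"
    and \<alpha> :: "'a \<Rightarrow> 'b"
begin

sublocale A: hopf_algebroid_on_manifold M A ..
sublocale B: hopf_algebroid_on_manifold M B ..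

lemma hom_GS:
  assumes "a \<in> A.GS" shows "\<alpha> a \<in> B.GS"
proof -
  obtain a' where "A.invariant_pair a a'" using assms A.GS_iff by blast
  then have a': "comult A a = tensor M A {#(a, a')#}" "comult A (antipode A a) = tensor M A {#(antipode A a', antipode A a)#}"
    by (simp_all add: A.invariant_pair_def)
  have "B.invariant_pair (\<alpha> a) (\<alpha> a')"
    using hom_comult[OF a'(1)] hom_comult[OF a'(2)] by (simp add: B.invariant_pair_def hom_antipode)
  then show ?thesis using B.GS_iff by blast
qed

lemma hom_normalized_at: "normalized_at M B (\<alpha> a) y \<longleftrightarrow> normalized_at M A a y"
  by (simp add: normalized_at_def hom_counit)

lemma hom_Norm: "B.Norm (\<alpha> a) = A.Norm a"
  by (simp add: A.Norm_def B.Norm_def hom_normalized_at)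

text \<open>A homomorphism fixes the base ring, so fa = fb implies f\<alpha>(a) = f\<alpha>(b) with
  the same f.\<close>

lemma hom_stalk_class:
  assumes y: "y \<in> points M" and eq: "stalk_class M A y a = stalk_class M A y b"
  shows "stalk_class M B y (\<alpha> a) = stalk_class M B y (\<alpha> b)"
proof -
  obtain f where f: "f \<in> Cc_infinity M" "same_germ M y f (\<lambda>_. 1)" "incl A f * a = incl A f * b"
    using eq A.stalk_class_eq_iff[OF y] unfolding null_at_def by (auto simp: right_diff_distrib)
  have "incl B f * \<alpha> a = incl B f * \<alpha> b"
    using f(3) hom_mult[of "incl A f" a] hom_mult[of "incl A f" b] hom_incl[OF f(1)] by simp
  then show ?thesis by (rule B.stalk_class_eqI[OF f(1,2)])
qed

lemma spectral_sheaf_map_arr: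
  assumes y: "y \<in> points M"
  shows "spectral_sheaf_map M A B \<alpha> (A.arr a y) = B.arr (\<alpha> a) y"
proof -
  have "(THE \<eta>. \<exists>b. stalk_class M A y a = stalk_class M A y b \<and> \<eta> = stalk_class M B y (\<alpha> b)) = stalk_class M B y (\<alpha> a)"
  proof (rule the_equality)
    show "\<exists>b. stalk_class M A y a = stalk_class M A y b \<and> stalk_class M B y (\<alpha> a) = stalk_class M B y (\<alpha> b)"
      by (intro exI[of _ a]) simp
    fix \<eta> assume "\<exists>b. stalk_class M A y a = stalk_class M A y b \<and> \<eta> = stalk_class M B y (\<alpha> b)"
    then obtain b where b: "stalk_class M A y a = stalk_class M A y b" "\<eta> = stalk_class M B y (\<alpha> b)"
      by (elim exE conjE)
    show "\<eta> = stalk_class M B y (\<alpha> a)" unfolding b(2) by (rule hom_stalk_class[OF y b(1), symmetric])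
  qed
  then show ?thesis by (simp add: spectral_sheaf_map_def)
qed

lemma hom_transf:
  assumes "f \<in> Cc_infinity M" shows "counit B (antipode B (incl B f * \<alpha> a)) = counit A (antipode A (incl A f * a))"
proof -
  have "incl B f * \<alpha> a = \<alpha> (incl A f * a)" using hom_mult hom_incl[OF assms] by simp
  then show ?thesis by (simp add: hom_antipode hom_counit)
qed

text \<open>The transfer of functions is built from the counit and the antipode, which \<alpha>
  preserves. So \<open>a\<close> and \<alpha>(a) have the same transports, and the induced map of
  arrows preserves sources.\<close>

lemma hom_transport_inv: "transport_inv M B W (\<alpha> a) = transport_inv M A W a"
proof -
  have t: "counit B (antipode B (incl B f * \<alpha> a)) = counit A (antipode A (incl A f * a))"
    if "f \<in> Cc_infinity_on M W" for f using hom_transf[OF Cc_infinity_onD[OF that]] .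
  have "is_transport M B W (\<alpha> a) V \<tau> \<longleftrightarrow> is_transport M A W a V \<tau>" for V \<tau>
    unfolding is_transport_def using t by (simp cong: image_cong)
  then show ?thesis by (simp add: transport_inv_def)
qed

lemma hom_srcf: "B.srcf (\<alpha> a) y = A.srcf a y"
  by (simp add: hom_Norm hom_transport_inv)

lemma spectral_groupoid_map_arr:
  assumes a: "a \<in> A.GS" "y \<in> A.Norm a"
  shows "spectral_groupoid_map M A B \<alpha> (A.arr a y) = B.arr (\<alpha> a) y"
  using A.arr_in_arrows[OF a] spectral_sheaf_map_arr[OF A.Norm_points[OF a(2)], of a]
  unfolding spectral_groupoid_map_def by simp

lemma hom_arr_in_arrows:
  assumes a: "a \<in> A.GS" "y \<in> A.Norm a"
  shows "B.arr (\<alpha> a) y \<in> points (arrows B.\<G>)"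
  using B.arr_in_arrows[OF hom_GS[OF a(1)]] a(2) hom_Norm by blast

lemma spectral_sheaf_map_arrows: "spectral_sheaf_map M A B \<alpha> ` points (arrows A.\<G>) \<subseteq> points (arrows B.\<G>)"
proof (rule image_subsetI)
  fix g assume "g \<in> points (arrows A.\<G>)"
  then obtain a y where a: "a \<in> A.GS" "y \<in> A.Norm a" "g = A.arr a y" by (rule A.arrowE)
  then show "spectral_sheaf_map M A B \<alpha> g \<in> points (arrows B.\<G>)"
    using spectral_sheaf_map_arr[OF A.Norm_points[OF a(2)], of a] hom_arr_in_arrows[OF a(1,2)] by simp
qed

lemma spectral_groupoid_map_morphism:
  "etale_groupoid_morphism M A.\<G> B.\<G> (spectral_groupoid_map M A B \<alpha>)"
  unfolding etale_groupoid_morphism_def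
proof (intro conjI)
  let ?\<theta> = "spectral_groupoid_map M A B \<alpha>"
  show "smooth_map (arrows A.\<G>) (arrows B.\<G>) ?\<theta>"
  \<comment> \<open>The induced map preserves targets, so it lifts one target map through the other
    and is even a local diffeomorphism.\<close>
  proof (rule local_diffeomorphism_smooth_map[OF A.arrows_manifold B.arrows_manifold],
      rule local_diffeomorphism_cancel[OF A.arrows_manifold manifold B.arrows_manifold A.fst_etale B.fst_etale])
    show "continuous_map (mtop (arrows A.\<G>)) (mtop (arrows B.\<G>)) ?\<theta>"
    proof (rule B.continuous_via_sections[OF A.arrows_fst_continuous])
      fix g assume g: "g \<in> points (arrows A.\<G>)"
      obtain a where a: "a \<in> A.GS" "fst g \<in> A.Norm a" "g = A.arr a (fst g)"
        "openin (mtop (arrows A.\<G>)) (sheet M A a (A.Norm a))" "g \<in> sheet M A a (A.Norm a)" using A.arrow_nbhd[OF g] .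
      have "fst h \<in> B.Norm (\<alpha> a) \<and> ?\<theta> h = B.arr (\<alpha> a) (fst h)" if h: "h \<in> sheet M A a (A.Norm a)" for h
      proof -
        obtain y where y: "y \<in> A.Norm a" "h = A.arr a y" using h by (auto simp: sheet_def)
        then show ?thesis using spectral_groupoid_map_arr[OF a(1) y(1)] hom_Norm by simp
      qed
      then show "\<exists>N b. openin (mtop (arrows A.\<G>)) N \<and> g \<in> N \<and> b \<in> B.GS \<and> (\<forall>h\<in>N. fst h \<in> B.Norm b \<and> ?\<theta> h = B.arr b (fst h))"
        using a hom_GS[OF a(1)] by blast
    qed
    fix g assume "g \<in> points (arrows A.\<G>)"
    then obtain a y where a: "a \<in> A.GS" "y \<in> A.Norm a" "g = A.arr a y" by (rule A.arrowE)
    then show "fst (?\<theta> g) = fst g" using spectral_groupoid_map_arr[OF a(1,2)] by simp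
  qed
  show "\<forall>g\<in>points (arrows A.\<G>). gsrc B.\<G> (?\<theta> g) = gsrc A.\<G> g \<and> gtgt B.\<G> (?\<theta> g) = gtgt A.\<G> g"
  proof
    fix g assume "g \<in> points (arrows A.\<G>)"
    then obtain a y where a: "a \<in> A.GS" "y \<in> A.Norm a" "g = A.arr a y" by (rule A.arrowE)
    have "y \<in> B.Norm (\<alpha> a)" using a(2) hom_Norm by simp
    then show "gsrc B.\<G> (?\<theta> g) = gsrc A.\<G> g \<and> gtgt B.\<G> (?\<theta> g) = gtgt A.\<G> g"
      using spectral_groupoid_map_arr[OF a(1,2)] a(3) A.spectral_src_arr[OF a(1,2)]
        B.spectral_src_arr[OF hom_GS[OF a(1)], of y] hom_srcf[of a y] by simp
  qed
  show "\<forall>(g, h)\<in>composable A.\<G>. ?\<theta> (gmult A.\<G> g h) = gmult B.\<G> (?\<theta> g) (?\<theta> h)"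
  proof (rule ballI, unfold split_paired_all prod.case)
    fix g h assume gh: "(g, h) \<in> composable A.\<G>"
    obtain b z a where b: "b \<in> A.GS" "z \<in> A.Norm b" "g = A.arr b z"
      and a: "a \<in> A.GS" "A.srcf b z \<in> A.Norm a" "h = A.arr a (A.srcf b z)"
      using A.composableE[OF gh] .
    have n: "z \<in> B.Norm (\<alpha> b)" "A.srcf b z \<in> B.Norm (\<alpha> a)" using a(2) b(2) hom_Norm by simp_all
    have "?\<theta> (gmult A.\<G> g h) = B.arr (\<alpha> b * \<alpha> a) z"
      using A.composable_mult(1)[OF b(1,2) a(1,2)] a(3) b(3)
        spectral_groupoid_map_arr[OF A.GS_mult[OF b(1) a(1)] A.product_Norm_and_srcf(1)[OF b(1,2) a(1,2)]]
      by (simp add: hom_mult)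
    also have "\<dots> = gmult B.\<G> (B.arr (\<alpha> b) z) (B.arr (\<alpha> a) (A.srcf b z))"
      using B.spectral_mult_arr[OF hom_GS[OF b(1)] n(1) hom_GS[OF a(1)] n(2) hom_srcf] by simp
    finally show "?\<theta> (gmult A.\<G> g h) = gmult B.\<G> (?\<theta> g) (?\<theta> h)"
      using spectral_groupoid_map_arr[OF b(1,2)] spectral_groupoid_map_arr[OF a(1,2)] a(3) b(3) by simp
  qed
  show "\<forall>x\<in>points M. ?\<theta> (gunit A.\<G> x) = gunit B.\<G> x"
  proof
    fix x assume "x \<in> points M"
    then obtain f :: "'m \<Rightarrow> 'k" where f: "f \<in> Cc_infinity M" "same_germ M x f (\<lambda>_. 1)"
      "spectral_unit M A x = A.arr (incl A f) x" "incl A f \<in> A.GS" "x \<in> A.Norm (incl A f)" by (rule A.exists_unit)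
    show "?\<theta> (gunit A.\<G> x) = gunit B.\<G> x"
      using spectral_groupoid_map_arr[OF f(4,5)] f(3) hom_incl[OF f(1)] B.spectral_unit_arr[OF f(1,2)] by simp
  qed
qed

end

context hopf_algebroid_on_manifold
begin

lemma hom_id: "hopf_algebroid_hom M A A id"
proof
  show "comult A a = tensor M A p \<Longrightarrow> comult A (id a) = tensor M A {#(id x, id y). (x, y) \<in># p#}" for a p
    by (simp add: case_prod_unfold)
qed simp_all

text \<open>The induced maps are restricted to the arrows, so identities and composites are
  expressed by \<open>restrict\<close> and \<open>compose\<close>.\<close>

lemma spectral_groupoid_map_id: "spectral_groupoid_map M A A id = restrict id (points (arrows \<G>))"
proof -
  interpret I: hopf_algebroid_hom_on_manifold M A A id
    by (intro hopf_algebroid_hom_on_manifold.intro hom_id hausdorff_manifold_axioms)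
  have "spectral_groupoid_map M A A id g = g" if "g \<in> points (arrows \<G>)" for g
    using arrowE[OF that] I.spectral_groupoid_map_arr by (metis id_apply)
  then show ?thesis unfolding spectral_groupoid_map_def by (intro ext) auto
qed

end

lemma hopf_algebroid_hom_comp:
  assumes "hopf_algebroid_hom M A B \<alpha>" "hopf_algebroid_hom M B C \<beta>"
  shows "hopf_algebroid_hom M A C (\<beta> \<circ> \<alpha>)"
proof -
  interpret ab: hopf_algebroid_hom M A B \<alpha> by fact
  interpret bc: hopf_algebroid_hom M B C \<beta> by fact
  show ?thesis
  proof
    show "comult C ((\<beta> \<circ> \<alpha>) a) = tensor M C {#((\<beta> \<circ> \<alpha>) x, (\<beta> \<circ> \<alpha>) y). (x, y) \<in># p#}"
      if "comult A a = tensor M A p" for a p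
      using bc.hom_comult[OF ab.hom_comult[OF that]] by (simp add: case_prod_unfold o_def multiset.map_comp)
  qed (simp_all add: ab.hom_add bc.hom_add ab.hom_scale bc.hom_scale ab.hom_mult bc.hom_mult ab.hom_incl bc.hom_incl
      ab.hom_counit bc.hom_counit ab.hom_antipode bc.hom_antipode)
qed

lemma spectral_groupoid_map_comp:
  assumes M: "hausdorff_manifold M" and \<alpha>: "hopf_algebroid_hom M A B \<alpha>" and \<beta>: "hopf_algebroid_hom M B C \<beta>"
  shows "spectral_groupoid_map M A C (\<beta> \<circ> \<alpha>) =
    compose (points (arrows (spectral_groupoid M A))) (spectral_groupoid_map M B C \<beta>) (spectral_groupoid_map M A B \<alpha>)"
proof
  interpret AB: hopf_algebroid_hom_on_manifold M A B \<alpha>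
    by (intro hopf_algebroid_hom_on_manifold.intro \<alpha> M)
  interpret BC: hopf_algebroid_hom_on_manifold M B C \<beta>
    by (intro hopf_algebroid_hom_on_manifold.intro \<beta> M)
  interpret AC: hopf_algebroid_hom_on_manifold M A C "\<beta> \<circ> \<alpha>"
    by (intro hopf_algebroid_hom_on_manifold.intro hopf_algebroid_hom_comp[OF \<alpha> \<beta>] M)
  fix g
  show "spectral_groupoid_map M A C (\<beta> \<circ> \<alpha>) g =
    compose (points (arrows (spectral_groupoid M A))) (spectral_groupoid_map M B C \<beta>) (spectral_groupoid_map M A B \<alpha>) g"
  proof (cases "g \<in> points (arrows AB.A.\<G>)")
    case True
    then obtain a y where a: "a \<in> AB.A.GS" "y \<in> AB.A.Norm a" "g = AB.A.arr a y" by (rule AB.A.arrowE)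
    have "y \<in> AB.B.Norm (\<alpha> a)" using a(2) AB.hom_Norm by simp
    then show ?thesis
      using True AB.spectral_groupoid_map_arr[OF a(1,2)] AC.spectral_groupoid_map_arr[OF a(1,2)]
        BC.spectral_groupoid_map_arr[OF AB.hom_GS[OF a(1)]] a(3) by (simp add: compose_def)
  next
    case False
    then show ?thesis unfolding spectral_groupoid_map_def compose_def by simp
  qed
qed

text \<open>The structure maps are given by definite descriptions, so their formulas are asserted
  for every representative and every admissible W. B and C have carrier types of their own, which
  makes functoriality a statement on algebras over different types.\<close>

theorem theorem4p4:
  fixes M :: "'m manifold"
    and A :: "('k::real_or_complex, 'm, 'a::ring) hopf_structure"
    and B :: "('k, 'm, 'b::ring) hopf_structure"
    and C :: "('k, 'm, 'c::ring) hopf_structure"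
  assumes M: "smooth_manifold M" "Hausdorff_space (mtop M)"
    and A: "hopf_algebroid M A"
  shows
    "(let G = spectral_groupoid M A; GS = S_invariant_weakly_grouplike M A; cl = stalk_class M A in
        etale_groupoid M G \<and>
        points (arrows G) =
          (SIGMA y : points M. {cl y a |a. a \<in> GS \<and> normalized_at M A a y}) \<and>
        (\<forall>a\<in>GS. \<forall>y \<in> points M. normalized_at M A a y \<longrightarrow>
           gtgt G (y, cl y a) = y \<and>
           (\<forall>W. openin (mtop M) W \<and> y \<in> W \<and> (\<forall>x\<in>W. normalized_at M A a x) \<longrightarrow>
              gsrc G (y, cl y a) = transport_inv M A W a y) \<and>
           (\<forall>b\<in>GS. \<forall>z \<in> points M. normalized_at M A b z \<and> gsrc G (z, cl z b) = y \<longrightarrow>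
              gmult G (z, cl z b) (y, cl y a) = (z, cl z (b * a))) \<and>
           ginv G (y, cl y a) =
             (gsrc G (y, cl y a), cl (gsrc G (y, cl y a)) (antipode A a))) \<and>
        (\<forall>y \<in> points M. \<forall>f \<in> Cc_infinity M. same_germ M y f (\<lambda>_. 1) \<longrightarrow>
           gunit G y = (y, cl y (incl A f))))
     \<and> (\<forall>\<alpha>. hopf_algebroid M B \<and> hopf_algebroid_hom M A B \<alpha> \<longrightarrow>
          spectral_sheaf_map M A B \<alpha> ` points (arrows (spectral_groupoid M A))
            \<subseteq> points (arrows (spectral_groupoid M B)) \<and>
          etale_groupoid_morphism M (spectral_groupoid M A) (spectral_groupoid M B)
            (spectral_groupoid_map M A B \<alpha>))
     \<and> spectral_groupoid_map M A A id = restrict id (points (arrows (spectral_groupoid M A)))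
     \<and> (\<forall>\<alpha> \<beta>. hopf_algebroid M B \<and> hopf_algebroid M C \<and>
            hopf_algebroid_hom M A B \<alpha> \<and> hopf_algebroid_hom M B C \<beta> \<longrightarrow>
          spectral_groupoid_map M A C (\<beta> \<circ> \<alpha>) =
            compose (points (arrows (spectral_groupoid M A)))
              (spectral_groupoid_map M B C \<beta>) (spectral_groupoid_map M A B \<alpha>))"
proof -
  have H: "hausdorff_manifold M" using M by (rule hausdorff_manifold.intro)
  interpret A: hopf_algebroid_on_manifold M A by (intro hopf_algebroid_on_manifold.intro H A)
  have "points (arrows A.\<G>) = (SIGMA y : points M. {stalk_class M A y a |a. a \<in> A.GS \<and> normalized_at M A a y})"
    unfolding A.points_arrows spectral_arrow_set_def by blast
  moreover have "gsrc A.\<G> (A.arr a y) = transport_inv M A W a y"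
    if "a \<in> A.GS" "openin (mtop M) W" "y \<in> W" "\<forall>x\<in>W. normalized_at M A a x" for a y W
  proof -
    have "W \<subseteq> A.Norm a" using that(4) by (auto simp: A.Norm_def)
    then show ?thesis
      using A.transport_inv_eq_srcf[OF that(1,2) _ that(3)] A.spectral_src_arr[OF that(1), of y] that(3) by auto
  qed
  moreover have "gmult A.\<G> (A.arr b z) (A.arr a y) = A.arr (b * a) z"
    if "a \<in> A.GS" "normalized_at M A a y" "b \<in> A.GS" "normalized_at M A b z" "gsrc A.\<G> (A.arr b z) = y" for a y b z
    using that A.spectral_src_arr[of b z] A.spectral_mult_arr[of b z a y] by (simp add: A.Norm_def)
  moreover have "ginv A.\<G> (A.arr a y) = A.arr (antipode A a) (gsrc A.\<G> (A.arr a y))"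
    if "a \<in> A.GS" "normalized_at M A a y" for a y
    using that A.spectral_src_arr[of a y] A.spectral_inv_arr[of a y] by (simp add: A.Norm_def)
  moreover have "gunit A.\<G> y = A.arr (incl A f) y" if "f \<in> Cc_infinity M" "same_germ M y f (\<lambda>_. 1)" for f y
    using A.spectral_unit_arr[OF that] by simp
  moreover have "spectral_sheaf_map M A B \<alpha> ` points (arrows A.\<G>) \<subseteq> points (arrows (spectral_groupoid M B)) \<and>
      etale_groupoid_morphism M A.\<G> (spectral_groupoid M B) (spectral_groupoid_map M A B \<alpha>)"
    if "hopf_algebroid_hom M A B \<alpha>" for \<alpha>
  proof -
    interpret hopf_algebroid_hom_on_manifold M A B \<alpha> by (intro hopf_algebroid_hom_on_manifold.intro that H)
    show ?thesis using spectral_sheaf_map_arrows spectral_groupoid_map_morphism by blast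
  qed
  moreover have "spectral_groupoid_map M A C (\<beta> \<circ> \<alpha>) =
      compose (points (arrows A.\<G>)) (spectral_groupoid_map M B C \<beta>) (spectral_groupoid_map M A B \<alpha>)"
    if "hopf_algebroid_hom M A B \<alpha>" "hopf_algebroid_hom M B C \<beta>" for \<alpha> \<beta>
    by (rule spectral_groupoid_map_comp[OF H that])
  ultimately show ?thesis
    unfolding Let_def
    using A.spectral_etale_groupoid A.spectral_groupoid_map_id
    by (intro conjI ballI allI impI) (simp_all del: A.groupoid_simps(1,2,4,5,6))
qed

end
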